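(* Let $m\in\mathbb{Z}_{>0}$. Let $\mathrm{embed}:\mathfrak{u}(2,\mathbb{H})\hookrightarrow\mathcal{W}^\hbar$ be the formal embedding, $\mathrm{shorten}:\mathrm{embed}(\mathfrak{u}(2,\mathbb{H}))\to\mathfrak{u}(\mathcal{H}^{\frac1m})$ the map given by taking limits of truncations at $\hbar=\tfrac1m$, and $\rho^{\frac1m}:\mathfrak{u}(2,\mathbb{H})\to\mathfrak{u}(\mathcal{H}^{\frac1m})$ the representation on the finite-dimensional Hilbert space $\mathcal{H}^{\frac1m}$, all as defined in the context. Then the diagram formed by these maps commutes: $$\mathrm{shorten}\circ\mathrm{embed}=\rho^{\frac1m}:\ \mathfrak{u}(2,\mathbb{H})\longrightarrow\mathfrak{u}(\mathcal{H}^{\frac1m}).$$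
   Context: **The Lie algebra.** $\mathfrak{u}(2,\mathbb{H})$ is the real Lie algebra of quaternionic antihermitean $2\times2$ matrices, with real basis ($e_1,e_2,e_3$ the quaternionic units) $j_i=\tfrac12\begin{pmatrix}e_i&0\\0&0\end{pmatrix}$, $p_0=\tfrac12\begin{pmatrix}0&1\\-1&0\end{pmatrix}$, $p_i=\tfrac12\begin{pmatrix}0&e_i\\ e_i&0\end{pmatrix}$, $k_i=\tfrac12\begin{pmatrix}0&0\\0&e_i\end{pmatrix}$. Its complexification has basis $J^{++}=2(-j_1+ij_2)$, $J^{+-}=J^{-+}=-2j_3$, $J^{--}=2(j_1+ij_2)$; $P^+_{\dot+}=-p_3-ip_0$, $P^+_{\dot-}=-p_1+ip_2$, $P^-_{\dot+}=p_1+ip_2$, $P^-_{\dot-}=-p_3+ip_0$; $K_{\dot+\dot+}=2(k_1+ik_2)$, $K_{\dot+\dot-}=K_{\dot-\dot+}=-2k_3$, $K_{\dot-\dot-}=2(-k_1+ik_2)$. All maps below are specified on these elements, extended complex linearly, and restricted to $\mathfrak{u}(2,\mathbb{H})$. **Weyl algebra and $\mathrm{embed}$.** $\mathcal{W}(\mathfrak{heis}_3)$ is the unital $\mathbb{C}$-algebra generated by $a,a^\dagger,a^\alpha_{\dot\alpha}$ ($\alpha=\pm$, $\dot\alpha=\dot\pm$) whose only nonvanishing commutators of generators are $[a,a^\dagger]=1$, $[a^+_{\dot+},a^-_{\dot-}]=-1$, $[a^+_{\dot-},a^-_{\dot+}]=-1$ (and their negatives in reversed order). $\mathcal{W}^\hbar$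 is the algebra of formal Laurent series in $\sqrt\hbar$ with coefficients in $\mathcal{W}(\mathfrak{heis}_3)$. Let $n=2a^\dagger a$, $N=a^+_{\dot-}a^-_{\dot+}-a^+_{\dot+}a^-_{\dot-}$, $b_k(x)=(-1)^k\frac{\prod_{l=0}^{k-1}(1-2l)}{2^kk!}x^k$, and $S=\sqrt{\tfrac1\hbar-N-\tfrac n2}:=\tfrac1{\sqrt\hbar}\sum_{k=0}^\infty b_k(N+\tfrac n2)\hbar^k$. The map $\mathrm{embed}$ is $J^{\alpha\beta}\mapsto\mathcal{J}^{\alpha\beta}$, $P^\alpha_{\dot\alpha}\mapsto\mathcal{P}^\alpha_{\dot\alpha}$, $K_{\dot\alpha\dot\beta}\mapsto\mathcal{K}_{\dot\alpha\dot\beta}$, with $\mathcal{K}_{\dot+\dot+}=-2iSa$, $\mathcal{K}_{\dot+\dot-}=\mathcal{K}_{\dot-\dot+}=i(\tfrac1\hbar-N-n)$, $\mathcal{K}_{\dot-\dot-}=2ia^\dagger S$, $\mathcal{P}^+_{\dot+}=-a^+_{\dot-}a+Sa^+_{\dot+}$, $\mathcal{P}^-_{\dot-}=a^\dagger a^-_{\dot+}+a^-_{\dot-}S$, $\mathcal{P}^+_{\dot-}=a^\dagger a^+_{\dot+}+a^+_{\dot-}S$, $\mathcal{P}^-_{\dot+}=-a^-_{\dot-}a+Sa^-_{\dot+}$, $\mathcal{J}^{++}=-2ia^+_{\dot-}a^+_{\dot+}$, $\mathcal{J}^{+-}=\mathcal{J}^{-+}=-i(a^+_{\dot+}a^-_{\dot-}+a^-_{\dot+}a^+_{\dot-})$,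 $\mathcal{J}^{--}=-2ia^-_{\dot+}a^-_{\dot-}$. **Representation of the Weyl algebra.** On Schwartz functions in $\mathcal{H}=L^2(\mathbb{R}^3)$, with orthonormal Hermite basis $|n_1,n_2,n_3\rangle$, $\rho$ is the unital algebra homomorphism with $\rho(a)=\tfrac1{\sqrt2}(x_1+\partial_{x_1})$, $\rho(a^\dagger)=\tfrac1{\sqrt2}(x_1-\partial_{x_1})$, $\rho(a^+_{\dot+})=-\tfrac1{\sqrt2}(x_2+\partial_{x_2})$, $\rho(a^-_{\dot-})=\tfrac1{\sqrt2}(x_2-\partial_{x_2})$, $\rho(a^-_{\dot+})=\tfrac1{\sqrt2}(x_3+\partial_{x_3})$, $\rho(a^+_{\dot-})=\tfrac1{\sqrt2}(x_3-\partial_{x_3})$. **Truncation, $\mathrm{shorten}$ and $\rho^{\frac1m}$.** $\mathcal{H}^{\frac1m}=\mathrm{Span}\{|n_1,n_2,n_3\rangle:n_1+n_2+n_3\le m-1\}$, and $\mathfrak{u}(\mathcal{H}^{\frac1m})$ is the Lie algebra of antihermitean endomorphisms of $\mathcal{H}^{\frac1m}$. For a positive number $\hbar$, write $(\mathcal{P}^\alpha_{\dot\alpha})^\hbar_\ell,(\mathcal{K}_{\dot\alpha\dot\beta})^\hbar_\ell\in\mathcal{W}(\mathfrak{heis}_3)$ for the elements obtained by replacing $S$ with its partial sum $\tfrac1{\sqrt\hbar}\sum_{k=0}^\ell b_k(N+\tfrac n2)\hbar^k$. The map $\mathrm{shorten}$ is the linear map sending $\mathcal{J}^{\alpha\beta}$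 to $\rho(\mathcal{J}^{\alpha\beta})|_{\mathcal{H}^{1/m}}$, and $\mathcal{P}^\alpha_{\dot\alpha}$, $\mathcal{K}_{\dot\alpha\dot\beta}$ to the strong limits, as $\ell\to\infty$, of $\rho((\mathcal{P}^\alpha_{\dot\alpha})_\ell^{1/m})$, $\rho((\mathcal{K}_{\dot\alpha\dot\beta})_\ell^{1/m})$ acting on $\mathcal{H}^{\frac1m}$. The representation $\rho^{\frac1m}$ sends $J^{\alpha\beta}\mapsto\rho(\mathcal{J}^{\alpha\beta})$, and sends $P^\alpha_{\dot\alpha}$, $K_{\dot\alpha\dot\beta}$ to the operators on $\mathcal{H}^{\frac1m}$ obtained from the formulas for $\mathcal{P}^\alpha_{\dot\alpha}$, $\mathcal{K}_{\dot\alpha\dot\beta}$ by setting $\hbar=\tfrac1m$, applying $\rho$ to the generators and replacing $S$ with the operator $\rho_S^{\frac1m}|n_1,n_2,n_3\rangle=\sqrt{m-n_1-n_2-n_3-1}\,|n_1,n_2,n_3\rangle$ on $\mathcal{H}^{\frac1m}$. *)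

theory Defs
  imports
    "HOL-Analysis.Analysis"
    "HOL-Library.Poly_Mapping"
    "HOL-Computational_Algebra.Formal_Laurent_Series"
begin

section \<open>Quaternions and the Lie algebra of antihermitean quaternionic matrices\<close>

datatype quat = Quat (q0: real) (q1: real) (q2: real) (q3: real)

lemma quat_eq_iff: "x = y \<longleftrightarrow> q0 x = q0 y \<and> q1 x = q1 y \<and> q2 x = q2 y \<and> q3 x = q3 y"
  by (metis quat.expand)

instantiation quat :: real_algebra_1
begin

definition "0 = Quat 0 0 0 0"
definition "1 = Quat 1 0 0 0"
definition "x + y = Quat (q0 x + q0 y) (q1 x + q1 y) (q2 x + q2 y) (q3 x + q3 y)"
definition "- x = Quat (- q0 x) (- q1 x) (- q2 x) (- q3 x)"
definition "x - y = Quat (q0 x - q0 y) (q1 x - q1 y) (q2 x - q2 y) (q3 x - q3 y)"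
definition "r *\<^sub>R x = Quat (r * q0 x) (r * q1 x) (r * q2 x) (r * q3 x)"
definition "x * y = Quat
  (q0 x * q0 y - q1 x * q1 y - q2 x * q2 y - q3 x * q3 y)
  (q0 x * q1 y + q1 x * q0 y + q2 x * q3 y - q3 x * q2 y)
  (q0 x * q2 y - q1 x * q3 y + q2 x * q0 y + q3 x * q1 y)
  (q0 x * q3 y + q1 x * q2 y - q2 x * q1 y + q3 x * q0 y)"

instance
  by standard
    (auto simp: quat_eq_iff zero_quat_def one_quat_def plus_quat_def uminus_quat_def
      minus_quat_def scaleR_quat_def times_quat_def algebra_simps)

end

definition qcnj :: "quat \<Rightarrow> quat"
  where "qcnj x = Quat (q0 x) (- q1 x) (- q2 x) (- q3 x)"

datatype qunit = E1 | E2 | E3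

fun quat_unit :: "qunit \<Rightarrow> quat" where
  "quat_unit E1 = Quat 0 1 0 0"
| "quat_unit E2 = Quat 0 0 1 0"
| "quat_unit E3 = Quat 0 0 0 1"

definition u2H :: "(quat^2^2) set"
  where "u2H = {X. \<forall>r s. qcnj (X $ s $ r) = - (X $ r $ s)}"

definition mat2 :: "quat \<Rightarrow> quat \<Rightarrow> quat \<Rightarrow> quat \<Rightarrow> quat^2^2"
  where "mat2 a b c d = vector [vector [a, b], vector [c, d]]"

definition u2H_j :: "qunit \<Rightarrow> quat^2^2"
  where "u2H_j i = (1/2) *\<^sub>R mat2 (quat_unit i) 0 0 0"

definition u2H_p0 :: "quat^2^2"
  where "u2H_p0 = (1/2) *\<^sub>R mat2 0 1 (- 1) 0"

definition u2H_p :: "qunit \<Rightarrow> quat^2^2"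
  where "u2H_p i = (1/2) *\<^sub>R mat2 0 (quat_unit i) (quat_unit i) 0"

definition u2H_k :: "qunit \<Rightarrow> quat^2^2"
  where "u2H_k i = (1/2) *\<^sub>R mat2 0 0 0 (quat_unit i)"

text \<open>The complexification of a real vector space \<open>V\<close> is \<open>V \<times> V\<close>, where \<open>(X, Y)\<close> stands for
  \<open>X + i Y\<close>.\<close>

definition cscale :: "complex \<Rightarrow> 'v::real_vector \<times> 'v \<Rightarrow> 'v \<times> 'v"
  where "cscale z Z =
    (Re z *\<^sub>R fst Z - Im z *\<^sub>R snd Z, Im z *\<^sub>R fst Z + Re z *\<^sub>R snd Z)"

definition cincl :: "'v::real_vector \<Rightarrow> 'v \<times> 'v"
  where "cincl X = (X, 0)"

text \<open>Indices \<open>\<alpha>\<close> (undotted) and \<open>\<alpha>'\<close> (dotted) both range over \<open>pm\<close>. Symmetric pairs of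
  indices are collected in \<open>sym\<close>, so that \<open>+-\<close> and \<open>-+\<close> are the same label \<open>PM\<close>.\<close>

datatype pm = Pl | Mi
datatype sym = PP | PM | MM

text \<open>\<open>Jb s\<close>, \<open>Pb \<alpha> \<alpha>'\<close> and \<open>Kb s\<close> label the ten basis vectors \<open>J\<close>, \<open>P\<close> (upper index \<open>\<alpha>\<close>, lower
  dotted index \<open>\<alpha>'\<close>) and \<open>K\<close> of the complexification.\<close>

datatype label = Jb sym | Pb pm pm | Kb sym

instance label :: finite
proof
  have "(UNIV :: sym set) \<subseteq> {PP, PM, MM}" "(UNIV :: pm set) \<subseteq> {Pl, Mi}"
    by (auto intro: sym.exhaust pm.exhaust)
  then have "finite (UNIV :: sym set)" "finite (UNIV :: pm set)"
    by (auto intro: finite_subset)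
  moreover have "(UNIV :: label set) \<subseteq>
      range Jb \<union> (\<lambda>(\<alpha>, \<alpha>'). Pb \<alpha> \<alpha>') ` (UNIV \<times> UNIV) \<union> range Kb"
    by (auto simp: image_iff) (metis label.exhaust)
  ultimately show "finite (UNIV :: label set)"
    by (meson finite_SigmaI finite_UnI finite_imageI finite_subset)
qed

fun cbasis :: "label \<Rightarrow> (quat^2^2) \<times> (quat^2^2)" where
  "cbasis (Jb PP) = cscale 2 (cscale \<i> (cincl (u2H_j E2)) - cincl (u2H_j E1))"
| "cbasis (Jb PM) = cscale (- 2) (cincl (u2H_j E3))"
| "cbasis (Jb MM) = cscale 2 (cincl (u2H_j E1) + cscale \<i> (cincl (u2H_j E2)))"
| "cbasis (Pb Pl Pl) = - cincl (u2H_p E3) - cscale \<i> (cincl u2H_p0)"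
| "cbasis (Pb Pl Mi) = - cincl (u2H_p E1) + cscale \<i> (cincl (u2H_p E2))"
| "cbasis (Pb Mi Pl) = cincl (u2H_p E1) + cscale \<i> (cincl (u2H_p E2))"
| "cbasis (Pb Mi Mi) = - cincl (u2H_p E3) + cscale \<i> (cincl u2H_p0)"
| "cbasis (Kb PP) = cscale 2 (cincl (u2H_k E1) + cscale \<i> (cincl (u2H_k E2)))"
| "cbasis (Kb PM) = cscale (- 2) (cincl (u2H_k E3))"
| "cbasis (Kb MM) = cscale 2 (cscale \<i> (cincl (u2H_k E2)) - cincl (u2H_k E1))"

text \<open>Coordinates of a vector \<open>v\<close> with respect to a linearly independent family \<open>e\<close> in a complex
  vector space with scalar multiplication \<open>smul\<close>. The linear map sending \<open>e b\<close> to \<open>f b\<close> is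
  \<open>v \<mapsto> \<Sum>b. coords smul e v b \<cdot> f b\<close>.\<close>

definition coords ::
    "(complex \<Rightarrow> 'v::comm_monoid_add \<Rightarrow> 'v) \<Rightarrow> ('b \<Rightarrow> 'v) \<Rightarrow> 'v \<Rightarrow> 'b \<Rightarrow> complex"
  where "coords smul e v = (THE c. v = (\<Sum>b\<in>UNIV. smul (c b) (e b)))"


section \<open>The Weyl algebra\<close>

text \<open>\<open>Mode \<alpha> \<alpha>'\<close> is the generator with upper index \<open>\<alpha>\<close> and lower dotted index \<open>\<alpha>'\<close>;
  \<open>heis_form g h\<close> is the scalar \<open>[g, h]\<close>.\<close>

datatype gen = Ann | Cre | Mode pm pm

fun heis_form :: "gen \<Rightarrow> gen \<Rightarrow> complex" where
  "heis_form Ann Cre = 1"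
| "heis_form Cre Ann = - 1"
| "heis_form (Mode Pl Pl) (Mode Mi Mi) = - 1"
| "heis_form (Mode Mi Mi) (Mode Pl Pl) = 1"
| "heis_form (Mode Pl Mi) (Mode Mi Pl) = - 1"
| "heis_form (Mode Mi Pl) (Mode Pl Mi) = 1"
| "heis_form _ _ = 0"

text \<open>With concatenation as addition of words, \<open>gen list \<Rightarrow>\<^sub>0 complex\<close> is the free unital complex
  algebra on \<open>gen\<close>.\<close>

instantiation list :: (type) monoid_add
begin
definition zero_list_def: "0 = []"
definition plus_list_def: "xs + ys = xs @ ys"
instance by standard (auto simp: zero_list_def plus_list_def)
end

type_synonym free_alg = "gen list \<Rightarrow>\<^sub>0 complex"

definition free_gen :: "gen \<Rightarrow> free_alg"
  where "free_gen g = Poly_Mapping.single [g] 1"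

definition free_const :: "complex \<Rightarrow> free_alg"
  where "free_const z = Poly_Mapping.single [] z"

definition weyl_relator :: "gen \<Rightarrow> gen \<Rightarrow> free_alg" where
  "weyl_relator g h =
    free_gen g * free_gen h - free_gen h * free_gen g - free_const (heis_form g h)"

inductive_set weyl_ideal :: "free_alg set" where
  zero: "0 \<in> weyl_ideal"
| step: "x \<in> weyl_ideal \<Longrightarrow> x + u * weyl_relator g h * v \<in> weyl_ideal"

lemma weyl_ideal_add: "x \<in> weyl_ideal \<Longrightarrow> y \<in> weyl_ideal \<Longrightarrow> x + y \<in> weyl_ideal"
proof (induction rule: weyl_ideal.induct)
  case (step x u g h v)
  have "x + u * weyl_relator g h * v + y = (x + y) + u * weyl_relator g h * v"
    by simp
  with step show ?case
    by (simp only: weyl_ideal.step)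
qed simp

lemma weyl_ideal_mult: "x \<in> weyl_ideal \<Longrightarrow> a * x * b \<in> weyl_ideal"
proof (induction rule: weyl_ideal.induct)
  case (step x u g h v)
  have "a * (x + u * weyl_relator g h * v) * b = a * x * b + (a * u) * weyl_relator g h * (v * b)"
    by (simp add: algebra_simps)
  with step show ?case
    by (simp only: weyl_ideal.step)
qed (simp add: weyl_ideal.zero)

lemma weyl_ideal_uminus: "x \<in> weyl_ideal \<Longrightarrow> - x \<in> weyl_ideal"
  using weyl_ideal_mult[of x "- 1" 1] by simp

lemma weyl_ideal_diff: "x \<in> weyl_ideal \<Longrightarrow> y \<in> weyl_ideal \<Longrightarrow> x - y \<in> weyl_ideal"
  using weyl_ideal_add[of x "- y"] weyl_ideal_uminus by simp

definition weyl_rel :: "free_alg \<Rightarrow> free_alg \<Rightarrow> bool"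
  where "weyl_rel x y \<longleftrightarrow> x - y \<in> weyl_ideal"

lemma equivp_weyl_rel: "equivp weyl_rel"
proof (rule equivpI)
  show "reflp weyl_rel"
    by (simp add: reflp_def weyl_rel_def weyl_ideal.zero)
  show "symp weyl_rel"
    by (metis minus_diff_eq sympI weyl_ideal_uminus weyl_rel_def)
  show "transp weyl_rel"
  proof (rule transpI)
    fix x y z
    assume "weyl_rel x y" "weyl_rel y z"
    then have "(x - y) + (y - z) \<in> weyl_ideal"
      unfolding weyl_rel_def by (rule weyl_ideal_add)
    then show "weyl_rel x z"
      by (simp add: weyl_rel_def)
  qed
qed

quotient_type weyl = free_alg / weyl_rel
  by (rule equivp_weyl_rel)

instantiation weyl :: "{ring, monoid_mult}"
begin

lift_definition zero_weyl :: weyl is 0 .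
lift_definition one_weyl :: weyl is 1 .
lift_definition plus_weyl :: "weyl \<Rightarrow> weyl \<Rightarrow> weyl" is "(+)"
  unfolding weyl_rel_def by (metis add_diff_add weyl_ideal_add)
lift_definition uminus_weyl :: "weyl \<Rightarrow> weyl" is uminus
  unfolding weyl_rel_def by (metis minus_diff_minus weyl_ideal_uminus)
lift_definition minus_weyl :: "weyl \<Rightarrow> weyl \<Rightarrow> weyl" is "(-)"
proof -
  fix a a' b b' :: free_alg
  assume "weyl_rel a a'" "weyl_rel b b'"
  then have "(a - a') - (b - b') \<in> weyl_ideal"
    unfolding weyl_rel_def by (rule weyl_ideal_diff)
  then show "weyl_rel (a - b) (a' - b')"
    by (simp add: weyl_rel_def algebra_simps)
qed
lift_definition times_weyl :: "weyl \<Rightarrow> weyl \<Rightarrow> weyl" is "(*)"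
proof -
  fix a a' b b' :: free_alg
  assume "weyl_rel a a'" "weyl_rel b b'"
  then have "1 * (a - a') * b + a' * (b - b') * 1 \<in> weyl_ideal"
    unfolding weyl_rel_def by (intro weyl_ideal_add weyl_ideal_mult)
  then show "weyl_rel (a * b) (a' * b')"
    by (simp add: weyl_rel_def algebra_simps)
qed

instance
proof
  fix a b c :: weyl
  have refl: "weyl_rel x x" for x
    by (simp add: weyl_rel_def weyl_ideal.zero)
  show "a + b + c = a + (b + c)"
    by transfer (simp add: add.assoc refl)
  show "a + b = b + a"
    by transfer (simp add: add.commute refl)
  show "0 + a = a" "- a + a = 0" "1 * a = a" "a * 1 = a"
    by (transfer, simp add: refl)+
  show "a - b = a + - b"
    by transfer (simp add: refl)
  show "a * b * c = a * (b * c)"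
    by transfer (simp add: mult.assoc refl)
  show "(a + b) * c = a * c + b * c"
    by transfer (simp add: distrib_right refl)
  show "a * (b + c) = a * b + a * c"
    by transfer (simp add: distrib_left refl)
qed

end

lift_definition wgen :: "gen \<Rightarrow> weyl" is free_gen .
lift_definition wconst :: "complex \<Rightarrow> weyl" is free_const .


section \<open>The formal embedding\<close>

text \<open>The defining formulas, in an algebra with scalars \<open>c\<close> and elements \<open>a g\<close> in place of the
  generators, \<open>S\<close> in place of the square root and \<open>hi\<close> in place of \<open>1/\<hbar>\<close>.\<close>

definition n_formula :: "(complex \<Rightarrow> 'r::ring) \<Rightarrow> (gen \<Rightarrow> 'r) \<Rightarrow> 'r"
  where "n_formula c a = c 2 * a Cre * a Ann"

definition N_formula :: "(gen \<Rightarrow> 'r::ring) \<Rightarrow> 'r"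
  where "N_formula a = a (Mode Pl Mi) * a (Mode Mi Pl) - a (Mode Pl Pl) * a (Mode Mi Mi)"

fun J_formula :: "(complex \<Rightarrow> 'r::ring) \<Rightarrow> (gen \<Rightarrow> 'r) \<Rightarrow> sym \<Rightarrow> 'r" where
  "J_formula c a PP = c (- 2 * \<i>) * a (Mode Pl Mi) * a (Mode Pl Pl)"
| "J_formula c a PM =
    c (- \<i>) * (a (Mode Pl Pl) * a (Mode Mi Mi) + a (Mode Mi Pl) * a (Mode Pl Mi))"
| "J_formula c a MM = c (- 2 * \<i>) * a (Mode Mi Pl) * a (Mode Mi Mi)"

fun formula ::
    "(complex \<Rightarrow> 'r::ring) \<Rightarrow> (gen \<Rightarrow> 'r) \<Rightarrow> 'r \<Rightarrow> 'r \<Rightarrow> label \<Rightarrow> 'r" where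
  "formula c a S hi (Jb s) = J_formula c a s"
| "formula c a S hi (Pb Pl Pl) = - (a (Mode Pl Mi) * a Ann) + S * a (Mode Pl Pl)"
| "formula c a S hi (Pb Pl Mi) = a Cre * a (Mode Pl Pl) + a (Mode Pl Mi) * S"
| "formula c a S hi (Pb Mi Pl) = - (a (Mode Mi Mi) * a Ann) + S * a (Mode Mi Pl)"
| "formula c a S hi (Pb Mi Mi) = a Cre * a (Mode Mi Pl) + a (Mode Mi Mi) * S"
| "formula c a S hi (Kb PP) = c (- 2 * \<i>) * S * a Ann"
| "formula c a S hi (Kb PM) = c \<i> * (hi - N_formula a - n_formula c a)"
| "formula c a S hi (Kb MM) = c (2 * \<i>) * a Cre * S"

definition b_coeff :: "nat \<Rightarrow> real"
  where "b_coeff k = (-1) ^ k * (\<Prod>l<k. 1 - 2 * real l) / (2 ^ k * fact k)"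

text \<open>\<open>S_coeff k\<close> is \<open>b\<^sub>k (N + n/2)\<close>.\<close>

definition S_coeff :: "nat \<Rightarrow> weyl" where
  "S_coeff k = wconst (of_real (b_coeff k)) *
    (N_formula wgen + wconst (1/2) * n_formula wconst wgen) ^ k"

text \<open>The indeterminate of \<open>weyl fls\<close> is the square root of \<open>\<hbar>\<close>, hence \<open>\<hbar>\<^sup>k\<close> has degree \<open>2 k\<close>;
  \<open>fls_shift 1\<close> divides by the indeterminate.\<close>

definition S_formal :: "weyl fls" where
  "S_formal =
    fls_shift 1 (fps_to_fls (Abs_fps (\<lambda>j. if even j then S_coeff (j div 2) else 0)))"

definition hconst :: "complex \<Rightarrow> weyl fls"
  where "hconst z = fls_const (wconst z)"

definition embed_basis :: "label \<Rightarrow> weyl fls" where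
  "embed_basis = formula hconst (\<lambda>g. fls_const (wgen g)) S_formal (fls_X_intpow (- 2))"

definition embed_u2H :: "quat^2^2 \<Rightarrow> weyl fls" where
  "embed_u2H X = (\<Sum>b\<in>UNIV. hconst (coords cscale cbasis (cincl X) b) * embed_basis b)"

text \<open>The elements of the Weyl algebra with \<open>S\<close> replaced by its partial sum up to \<open>l\<close> at the positive
  number \<open>h\<close>.\<close>

definition S_trunc :: "real \<Rightarrow> nat \<Rightarrow> weyl" where
  "S_trunc h l =
    wconst (of_real (1 / sqrt h)) * (\<Sum>k\<le>l. S_coeff k * wconst (of_real (h ^ k)))"

definition trunc :: "real \<Rightarrow> nat \<Rightarrow> label \<Rightarrow> weyl" where
  "trunc h l = formula wconst wgen (S_trunc h l) (wconst (of_real (1 / h)))"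


section \<open>The representation of the Weyl algebra on Schwartz functions\<close>

type_synonym wavefun = "real^3 \<Rightarrow> complex"

definition partial :: "3 \<Rightarrow> wavefun \<Rightarrow> wavefun"
  where "partial i f x = vector_derivative (\<lambda>t. f (x + t *\<^sub>R axis i 1)) (at 0)"

definition partials :: "3 list \<Rightarrow> wavefun \<Rightarrow> wavefun"
  where "partials ds = foldr partial ds"

definition schwartz :: "wavefun set" where
  "schwartz = {f. \<forall>ds. (\<forall>x. partials ds f differentiable (at x)) \<and>
    (\<forall>k. \<exists>C. \<forall>x. norm x ^ k * norm (partials ds f x) \<le> C)}"

definition lower :: "3 \<Rightarrow> wavefun \<Rightarrow> wavefun"
  where "lower i f x = of_real (1 / sqrt 2) * (of_real (x $ i) * f x + partial i f x)"

definition raise :: "3 \<Rightarrow> wavefun \<Rightarrow> wavefun"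
  where "raise i f x = of_real (1 / sqrt 2) * (of_real (x $ i) * f x - partial i f x)"

fun rho_gen :: "gen \<Rightarrow> wavefun \<Rightarrow> wavefun" where
  "rho_gen Ann f = lower 1 f"
| "rho_gen Cre f = raise 1 f"
| "rho_gen (Mode Pl Pl) f = (\<lambda>x. - lower 2 f x)"
| "rho_gen (Mode Mi Mi) f = raise 2 f"
| "rho_gen (Mode Mi Pl) f = lower 3 f"
| "rho_gen (Mode Pl Mi) f = raise 3 f"

definition linear_op :: "wavefun set \<Rightarrow> (wavefun \<Rightarrow> wavefun) \<Rightarrow> bool" where
  "linear_op D T \<longleftrightarrow> (\<forall>f\<in>D. \<forall>g\<in>D. \<forall>y z.
    T (\<lambda>x. y * f x + z * g x) = (\<lambda>x. y * T f x + z * T g x))"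

text \<open>Unital algebra homomorphisms from the Weyl algebra to the linear endomorphisms of the Schwartz
  space with the prescribed values on generators.\<close>

definition is_rho :: "(weyl \<Rightarrow> wavefun \<Rightarrow> wavefun) \<Rightarrow> bool" where
  "is_rho R \<longleftrightarrow>
    (\<forall>w. R w \<in> schwartz \<rightarrow>\<^sub>E schwartz \<and> linear_op schwartz (R w)) \<and>
    (\<forall>f\<in>schwartz.
      R 1 f = f \<and>
      (\<forall>v w. R (v + w) f = (\<lambda>x. R v f x + R w f x)) \<and>
      (\<forall>z w. R (wconst z * w) f = (\<lambda>x. z * R w f x)) \<and>
      (\<forall>v w. R (v * w) f = R v (R w f)) \<and>
      (\<forall>g. R (wgen g) f = rho_gen g f))"

definition rho :: "weyl \<Rightarrow> wavefun \<Rightarrow> wavefun"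
  where "rho = (THE R. is_rho R)"


section \<open>The truncated Hilbert space\<close>

definition l2_inner :: "wavefun \<Rightarrow> wavefun \<Rightarrow> complex"
  where "l2_inner f g = (LINT x|lborel. cnj (f x) * g x)"

definition l2_norm :: "wavefun \<Rightarrow> real"
  where "l2_norm f = sqrt (LINT x|lborel. (norm (f x))\<^sup>2)"

fun hermite_poly :: "nat \<Rightarrow> real \<Rightarrow> real" where
  "hermite_poly 0 t = 1"
| "hermite_poly (Suc 0) t = 2 * t"
| "hermite_poly (Suc (Suc n)) t =
    2 * t * hermite_poly (Suc n) t - 2 * real (Suc n) * hermite_poly n t"

definition hermite_fun :: "nat \<Rightarrow> real \<Rightarrow> real" where
  "hermite_fun n t = hermite_poly n t * exp (- t\<^sup>2 / 2) / sqrt (2 ^ n * fact n * sqrt pi)"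

fun hermite :: "nat \<times> nat \<times> nat \<Rightarrow> wavefun" where
  "hermite (n1, n2, n3) x =
    of_real (hermite_fun n1 (x $ 1) * hermite_fun n2 (x $ 2) * hermite_fun n3 (x $ 3))"

definition Hidx :: "nat \<Rightarrow> (nat \<times> nat \<times> nat) set"
  where "Hidx m = {(n1, n2, n3). n1 + n2 + n3 \<le> m - 1}"

definition Hm :: "nat \<Rightarrow> wavefun set"
  where "Hm m = {(\<lambda>x. \<Sum>n\<in>Hidx m. c n * hermite n x) | c. True}"

definition antihermitean_ops :: "nat \<Rightarrow> (wavefun \<Rightarrow> wavefun) set" where
  "antihermitean_ops m = {T \<in> Hm m \<rightarrow>\<^sub>E Hm m. linear_op (Hm m) T \<and>
    (\<forall>f\<in>Hm m. \<forall>g\<in>Hm m. l2_inner (T f) g = - l2_inner f (T g))}"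

text \<open>Limits are taken among Schwartz functions, where \<open>l2_norm\<close> is a genuine norm (no two distinct
  Schwartz functions agree almost everywhere, and all are square integrable).\<close>

definition strong_limit :: "wavefun set \<Rightarrow> (nat \<Rightarrow> wavefun \<Rightarrow> wavefun) \<Rightarrow> wavefun \<Rightarrow> wavefun"
  where "strong_limit D A = (THE T. T \<in> D \<rightarrow>\<^sub>E schwartz \<and>
    (\<forall>f\<in>D. (\<lambda>l. l2_norm (\<lambda>x. A l f x - T f x)) \<longlonglongrightarrow> 0))"


section \<open>The maps \<open>shorten\<close> and \<open>\<rho>\<^sup>1\<^sup>/\<^sup>m\<close>\<close>

fun shorten_basis :: "nat \<Rightarrow> label \<Rightarrow> wavefun \<Rightarrow> wavefun" where
  "shorten_basis m (Jb s) = restrict (rho (J_formula wconst wgen s)) (Hm m)"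
| "shorten_basis m b = strong_limit (Hm m) (\<lambda>l. rho (trunc (1 / real m) l b))"

text \<open>Only the values on the complex span of the range of \<open>embed_basis\<close>, which contains the image of
  \<open>embed_u2H\<close>, are meaningful. Operators on \<open>Hm m\<close> are functions that are \<open>undefined\<close> outside \<open>Hm m\<close>.\<close>

definition shorten :: "nat \<Rightarrow> weyl fls \<Rightarrow> wavefun \<Rightarrow> wavefun" where
  "shorten m Y = (\<lambda>f\<in>Hm m. \<lambda>x.
    \<Sum>b\<in>UNIV. coords (\<lambda>z y. hconst z * y) embed_basis Y b * shorten_basis m b f x)"

definition hermite_coeff :: "nat \<Rightarrow> wavefun \<Rightarrow> nat \<times> nat \<times> nat \<Rightarrow> complex" where
  "hermite_coeff m f = (THE c. (\<forall>n. n \<notin> Hidx m \<longrightarrow> c n = 0) \<and>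
    f = (\<lambda>x. \<Sum>n\<in>Hidx m. c n * hermite n x))"

definition rho_S :: "nat \<Rightarrow> wavefun \<Rightarrow> wavefun" where
  "rho_S m = (\<lambda>f\<in>Hm m. \<lambda>x. \<Sum>(n1, n2, n3)\<in>Hidx m.
    hermite_coeff m f (n1, n2, n3) *
    of_real (sqrt (real m - real n1 - real n2 - real n3 - 1)) * hermite (n1, n2, n3) x)"

definition gen_op :: "gen \<Rightarrow> wavefun \<Rightarrow> wavefun"
  where "gen_op g = rho (wgen g)"

text \<open>The same formulas as in \<open>formula\<close>, with products read as compositions of operators. The
  operator \<open>rho_S m\<close> is only ever applied to elements of \<open>Hm m\<close>: where it stands on the left, the
  generator to its right is a multiple of a lowering operator, which preserves \<open>Hm m\<close>.\<close>

fun rho_m_basis :: "nat \<Rightarrow> label \<Rightarrow> wavefun \<Rightarrow> wavefun" where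
  "rho_m_basis m (Jb s) = restrict (rho (J_formula wconst wgen s)) (Hm m)"
| "rho_m_basis m (Pb Pl Pl) = (\<lambda>f\<in>Hm m. \<lambda>x.
    - gen_op (Mode Pl Mi) (gen_op Ann f) x + rho_S m (gen_op (Mode Pl Pl) f) x)"
| "rho_m_basis m (Pb Pl Mi) = (\<lambda>f\<in>Hm m. \<lambda>x.
    gen_op Cre (gen_op (Mode Pl Pl) f) x + gen_op (Mode Pl Mi) (rho_S m f) x)"
| "rho_m_basis m (Pb Mi Pl) = (\<lambda>f\<in>Hm m. \<lambda>x.
    - gen_op (Mode Mi Mi) (gen_op Ann f) x + rho_S m (gen_op (Mode Mi Pl) f) x)"
| "rho_m_basis m (Pb Mi Mi) = (\<lambda>f\<in>Hm m. \<lambda>x.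
    gen_op Cre (gen_op (Mode Mi Pl) f) x + gen_op (Mode Mi Mi) (rho_S m f) x)"
| "rho_m_basis m (Kb PP) = (\<lambda>f\<in>Hm m. \<lambda>x. - 2 * \<i> * rho_S m (gen_op Ann f) x)"
| "rho_m_basis m (Kb PM) = (\<lambda>f\<in>Hm m. \<lambda>x. \<i> * (of_nat m * f x
    - (gen_op (Mode Pl Mi) (gen_op (Mode Mi Pl) f) x
       - gen_op (Mode Pl Pl) (gen_op (Mode Mi Mi) f) x)
    - 2 * gen_op Cre (gen_op Ann f) x))"
| "rho_m_basis m (Kb MM) = (\<lambda>f\<in>Hm m. \<lambda>x. 2 * \<i> * gen_op Cre (rho_S m f) x)"

definition rho_m :: "nat \<Rightarrow> quat^2^2 \<Rightarrow> wavefun \<Rightarrow> wavefun" where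
  "rho_m m X = (\<lambda>f\<in>Hm m. \<lambda>x.
    \<Sum>b\<in>UNIV. coords cscale cbasis (cincl X) b * rho_m_basis m b f x)"

end

theory Submission
  imports Defs
begin

text \<open>The operators \<open>shorten_basis m b\<close> and \<open>rho_m_basis m b\<close> differ only in how the square root
  \<open>S\<close> is read: as the limit of a power series in \<open>N + n/2\<close> or as the diagonal operator \<open>rho_S m\<close>.
  On the Hermite function with index \<open>(n1, n2, n3)\<close> the element \<open>N + n/2\<close> acts as the scalar
  \<open>n1 + n2 + n3 + 1\<close>, since \<open>N\<close> contains one product of ladder operators in antinormal order. At
  \<open>\<hbar> = 1/m\<close> the truncated series therefore acts as a partial sum of the binomial series of
  \<open>sqrt m * sqrt (1 - (n1 + n2 + n3 + 1) / m)\<close>. On \<open>Hm m\<close> the argument of the series stays in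
  \<open>{0..1}\<close>, where the series converges, including the end point 1 (\<open>b_coeff_series\<close>); the limit is the
  eigenvalue of \<open>rho_S m\<close>. Only finitely many Hermite functions are involved and every formula is
  affine in \<open>S\<close>, so the truncations converge strongly to \<open>rho_m_basis m b\<close> (\<open>shorten_basis_eq\<close>).

  Comparing the two maps on the whole Lie algebra requires that the objects given by descriptions are
  what they should be. The representation \<open>rho\<close> exists because the ladder operators satisfy the
  canonical commutation relations on the Schwartz space, which rests on the symmetry of second
  derivatives (\<open>is_rho_rho\<close>). Strong limits are unique because \<open>l2_norm\<close> is definite on Schwartz
  functions (\<open>l2_norm_limit_unique\<close>). Coordinates with respect to \<open>cbasis\<close> are computed by an explicit
  dual basis (\<open>coords_cbasis\<close>). The family \<open>embed_basis\<close> is linearly independent because its leading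
  terms in \<open>\<hbar>\<close> send a suitable Hermite function to independent functions (\<open>coords_embed_basis\<close>).
  Hence both maps have the same coordinates and the same values on basis vectors.

  For antihermiticity, \<open>lower i\<close> and \<open>raise i\<close> are adjoint by integration by parts and \<open>rho_S m\<close> is
  self-adjoint, as Hermite functions are orthogonal. The operators \<open>rho_m_basis m b\<close> are thus permuted
  by the adjoint up to sign (\<open>rho_m_basis_adjoint\<close>), and the coordinates of elements of \<open>u2H\<close> are
  antisymmetric under the corresponding conjugation (\<open>cdual_adj\<close>).\<close>

(* The infix dollar sign is to denote components of vectors only. *)
no_notation fps_nth (infixl \<open>$\<close> 75)


section \<open>Schwartz functions\<close>

text \<open>The Schwartz space is the largest set of differentiable functions of rapid decay that is closed
  under partial derivatives. Closure properties are proved by exhibiting such a set.\<close>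

lemma schwartz_coinduct:
  assumes "f \<in> M"
    and "\<And>f x. f \<in> M \<Longrightarrow> f differentiable (at x)"
    and "\<And>f k. f \<in> M \<Longrightarrow> \<exists>C. \<forall>x. norm x ^ k * norm (f x) \<le> C"
    and "\<And>f i. f \<in> M \<Longrightarrow> partial i f \<in> M"
  shows "f \<in> schwartz"
proof -
  have "partials ds f \<in> M" for ds
    by (induction ds) (auto simp: partials_def assms)
  then show ?thesis
    using assms(2,3) by (auto simp: schwartz_def)
qed

lemma schwartz_differentiable: "f \<in> schwartz \<Longrightarrow> f differentiable (at x)"
  unfolding schwartz_def partials_def by (metis (mono_tags, lifting) foldr.simps(1) id_apply mem_Collect_eq)

lemma schwartz_decay:
  assumes "f \<in> schwartz" shows "\<exists>C. \<forall>x. norm x ^ k * norm (f x) \<le> C"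
proof -
  have "\<exists>C. \<forall>x. norm x ^ k * norm (partials [] f x) \<le> C"
    using assms by (simp add: schwartz_def)
  then show ?thesis by (simp add: partials_def)
qed

lemma schwartz_partial: "f \<in> schwartz \<Longrightarrow> partial i f \<in> schwartz"
proof -
  assume "f \<in> schwartz"
  moreover have "partials ds (partial i f) = partials (ds @ [i]) f" for ds
    by (simp add: partials_def)
  ultimately show ?thesis
    by (auto simp: schwartz_def)
qed

lemma schwartz_continuous: "f \<in> schwartz \<Longrightarrow> continuous_on S f"
  by (meson continuous_at_imp_continuous_on differentiable_imp_continuous_within schwartz_differentiable)

lemma partial_eqI:
  assumes "((\<lambda>t. f (x + t *\<^sub>R axis i 1)) has_vector_derivative d) (at 0)"
  shows "partial i f x = d"
  unfolding partial_def using assms by (rule vector_derivative_at)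

lemma has_vector_derivative_line:
  assumes "f differentiable (at (x + t *\<^sub>R axis i 1))"
  shows "((\<lambda>t. f (x + t *\<^sub>R axis i 1)) has_vector_derivative partial i f (x + t *\<^sub>R axis i 1)) (at t)"
proof -
  obtain f' where f': "(f has_derivative f') (at (x + t *\<^sub>R axis i 1))"
    using assms by (auto simp: differentiable_def)
  have lin: "((\<lambda>s. f (y + s *\<^sub>R axis i 1)) has_vector_derivative f' (axis i 1)) (at s)"
    if "y + s *\<^sub>R axis i 1 = x + t *\<^sub>R axis i 1" for y s
  proof -
    have "((\<lambda>s. y + s *\<^sub>R axis i 1) has_derivative (\<lambda>s. s *\<^sub>R axis i 1)) (at s)"
      by (auto intro!: derivative_eq_intros)
    from diff_chain_at[OF this, of f f'] f' that
    have "((\<lambda>s. f (y + s *\<^sub>R axis i 1)) has_derivative (\<lambda>s. f' (s *\<^sub>R axis i 1))) (at s)"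
      by (simp add: o_def)
    moreover have "f' (s *\<^sub>R axis i 1) = s *\<^sub>R f' (axis i 1)" for s
      using f' has_derivative_linear linear_scale by blast
    ultimately show ?thesis
      by (simp add: has_vector_derivative_def)
  qed
  have "partial i f (x + t *\<^sub>R axis i 1) = f' (axis i 1)"
    by (rule partial_eqI, rule lin) simp
  with lin[of x t] show ?thesis by simp
qed

lemma has_vector_derivative_line0:
  assumes "f differentiable (at x)"
  shows "((\<lambda>t. f (x + t *\<^sub>R axis i 1)) has_vector_derivative partial i f x) (at 0)"
  using has_vector_derivative_line[of f x 0 i] assms by simp

lemma decay_linear:
  fixes f g :: wavefun
  assumes "\<exists>C. \<forall>x. norm x ^ k * norm (f x) \<le> C" "\<exists>C. \<forall>x. norm x ^ k * norm (g x) \<le> C"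
  shows "\<exists>C. \<forall>x. norm x ^ k * norm (c * f x + d * g x) \<le> C"
proof -
  obtain A B where A: "\<And>x. norm x ^ k * norm (f x) \<le> A" and B: "\<And>x. norm x ^ k * norm (g x) \<le> B"
    using assms by blast
  have "norm x ^ k * norm (c * f x + d * g x) \<le> norm c * A + norm d * B" for x
  proof -
    have "norm x ^ k * norm (c * f x + d * g x) \<le> norm x ^ k * (norm c * norm (f x) + norm d * norm (g x))"
      by (intro mult_left_mono) (metis norm_mult norm_triangle_ineq, simp)
    also have "\<dots> = norm c * (norm x ^ k * norm (f x)) + norm d * (norm x ^ k * norm (g x))"
      by (simp add: algebra_simps)
    also have "\<dots> \<le> norm c * A + norm d * B"
      by (intro add_mono mult_left_mono A B) auto
    finally show ?thesis .
  qed
  then show ?thesis by blast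
qed

lemma decay_coordinate:
  fixes f :: wavefun
  assumes "\<And>k. \<exists>C. \<forall>x. norm x ^ k * norm (f x) \<le> C"
  shows "\<exists>C. \<forall>x. norm x ^ k * norm (of_real (x $ i) * f x) \<le> C"
proof -
  obtain C where C: "\<And>x. norm x ^ Suc k * norm (f x) \<le> C"
    using assms by blast
  have "norm x ^ k * norm (of_real (x $ i) * f x) \<le> C" for x
  proof -
    have "norm x ^ k * norm (of_real (x $ i) * f x) = norm x ^ k * \<bar>x $ i\<bar> * norm (f x)"
      by (simp add: norm_mult)
    also have "\<dots> \<le> norm x ^ k * norm x * norm (f x)"
      using component_le_norm_cart[of x i] by (intro mult_right_mono mult_left_mono) auto
    also have "\<dots> \<le> C" using C[of x] by (simp add: mult.commute)
    finally show ?thesis .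
  qed
  then show ?thesis by blast
qed

lemma partial_linear:
  assumes "f differentiable (at x)" "g differentiable (at x)"
  shows "partial i (\<lambda>x. c * f x + d * g x) x = c * partial i f x + d * partial i g x"
  by (rule partial_eqI)
    (auto intro!: derivative_eq_intros has_vector_derivative_line0[OF assms(1)]
      has_vector_derivative_line0[OF assms(2)] has_vector_derivative_mult_right)

lemma partial_coordinate:
  assumes "f differentiable (at x)"
  shows "partial i (\<lambda>x. of_real (x $ j) * f x) x =
    (if i = j then f x else 0) + of_real (x $ j) * partial i f x"
proof -
  have "((\<lambda>t. of_real ((x + t *\<^sub>R axis i 1) $ j) :: complex) has_vector_derivative
      (if i = j then 1 else 0)) (at 0)"
  proof -
    have eq: "(\<lambda>t. of_real ((x + t *\<^sub>R axis i 1) $ j) :: complex) =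
        (\<lambda>t. of_real (x $ j) + t *\<^sub>R (if i = j then 1 else 0))"
      by (auto simp: axis_def of_real_def scaleR_add_left)
    show ?thesis unfolding eq by (auto intro!: derivative_eq_intros)
  qed
  from has_vector_derivative_mult[OF this has_vector_derivative_line0[OF assms, of i]]
  show ?thesis by (intro partial_eqI) (auto simp: algebra_simps)
qed

lemma coordinate_differentiable: "(\<lambda>x::real^3. complex_of_real (x $ i)) differentiable (at x)"
  by (intro bounded_linear_imp_differentiable bounded_linear_of_real bounded_linear_vec_nth
      bounded_linear_compose[OF bounded_linear_of_real])

text \<open>Linear combinations with fixed coefficients form a set to which coinduction applies, by
  linearity of partial derivatives.\<close>

lemma schwartz_linear:
  assumes "f \<in> schwartz" "g \<in> schwartz"
  shows "(\<lambda>x. c * f x + d * g x) \<in> schwartz"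
proof (rule schwartz_coinduct[where M = "{\<lambda>x. c * f x + d * g x | f g. f \<in> schwartz \<and> g \<in> schwartz}"])
  fix h i assume "h \<in> {\<lambda>x. c * f x + d * g x | f g. f \<in> schwartz \<and> g \<in> schwartz}"
  then obtain f g where h: "h = (\<lambda>x. c * f x + d * g x)" "f \<in> schwartz" "g \<in> schwartz" by blast
  show "h differentiable (at x)" for x
    unfolding h(1) by (rule differentiable_add; rule differentiable_mult)
      (rule differentiable_const schwartz_differentiable h)+
  show "\<exists>C. \<forall>x. norm x ^ k * norm (h x) \<le> C" for k
    unfolding h(1) by (intro decay_linear schwartz_decay h)
  have "partial i h = (\<lambda>x. c * partial i f x + d * partial i g x)"
    unfolding h(1) by (intro ext partial_linear schwartz_differentiable h)
  then show "partial i h \<in> {\<lambda>x. c * f x + d * g x | f g. f \<in> schwartz \<and> g \<in> schwartz}"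
    using schwartz_partial[OF h(2), of i] schwartz_partial[OF h(3), of i]
    by (intro CollectI exI[of _ "partial i f"] exI[of _ "partial i g"] conjI)
qed (use assms in blast)

lemma schwartz_cmult: "f \<in> schwartz \<Longrightarrow> (\<lambda>x. c * f x) \<in> schwartz"
  using schwartz_linear[of f f c 0] by simp

lemma schwartz_add: "f \<in> schwartz \<Longrightarrow> g \<in> schwartz \<Longrightarrow> (\<lambda>x. f x + g x) \<in> schwartz"
  using schwartz_linear[of f g 1 1] by simp

lemma schwartz_diff: "f \<in> schwartz \<Longrightarrow> g \<in> schwartz \<Longrightarrow> (\<lambda>x. f x - g x) \<in> schwartz"
  using schwartz_linear[of f g 1 "-1"] by simp

lemma schwartz_uminus: "f \<in> schwartz \<Longrightarrow> (\<lambda>x. - f x) \<in> schwartz"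
  using schwartz_linear[of f f "-1" 0] by simp

text \<open>The summand \<open>g\<close> absorbs the term \<open>f\<close> that the product rule produces; multiples of a coordinate
  alone are not closed under partial derivatives.\<close>

lemma schwartz_coordinate_aux:
  assumes "f \<in> schwartz" "g \<in> schwartz"
  shows "(\<lambda>x. of_real (x $ j) * f x + g x) \<in> schwartz"
proof (rule schwartz_coinduct[where
      M = "{\<lambda>x. of_real (x $ j) * f x + g x | f g. f \<in> schwartz \<and> g \<in> schwartz}"])
  fix h i assume "h \<in> {\<lambda>x. of_real (x $ j) * f x + g x | f g. f \<in> schwartz \<and> g \<in> schwartz}"
  then obtain f g where h: "h = (\<lambda>x. of_real (x $ j) * f x + g x)" "f \<in> schwartz" "g \<in> schwartz"
    by blast
  have d: "(\<lambda>x. of_real (x $ j) * f x) differentiable (at x)" for x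
    by (rule differentiable_mult[OF coordinate_differentiable schwartz_differentiable[OF h(2)]])
  show "h differentiable (at x)" for x
    unfolding h(1) by (intro differentiable_add d schwartz_differentiable h)
  show "\<exists>C. \<forall>x. norm x ^ k * norm (h x) \<le> C" for k
    using decay_linear[OF decay_coordinate[OF schwartz_decay[OF h(2)], of k j] schwartz_decay[OF h(3)],
        of 1 1] h(1)
    by simp
  have "partial i h = (\<lambda>x. of_real (x $ j) * partial i f x +
      ((if i = j then 1 else 0) * f x + partial i g x))"
    unfolding h(1) using partial_linear[OF d schwartz_differentiable, of g i 1 1] h(2,3)
    by (auto simp: partial_coordinate schwartz_differentiable)
  moreover have "(\<lambda>x. (if i = j then 1 else 0) * f x + partial i g x) \<in> schwartz"
    by (intro schwartz_add schwartz_cmult schwartz_partial h)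
  ultimately show "partial i h \<in>
      {\<lambda>x. of_real (x $ j) * f x + g x | f g. f \<in> schwartz \<and> g \<in> schwartz}"
    using schwartz_partial[OF h(2)]
    by (intro CollectI exI[of _ "partial i f"] exI conjI) auto
qed (use assms in blast)

lemma schwartz_coordinate:
  assumes "f \<in> schwartz" shows "(\<lambda>x. of_real (x $ j) * f x) \<in> schwartz"
  using schwartz_coordinate_aux[OF assms schwartz_cmult[OF assms, of 0], of j] by simp

lemma schwartz_sum:
  assumes "finite I" "\<And>i. i \<in> I \<Longrightarrow> f i \<in> schwartz" "f0 \<in> schwartz"
  shows "(\<lambda>x. \<Sum>i\<in>I. f i x) \<in> schwartz"
  using assms
proof (induction I rule: finite_induct)
  case empty
  then show ?case using schwartz_cmult[of f0 0] by simp
qed (simp add: schwartz_add)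

lemma lower_schwartz: "f \<in> schwartz \<Longrightarrow> lower i f \<in> schwartz"
  unfolding lower_def[abs_def]
  by (intro schwartz_cmult schwartz_add schwartz_coordinate schwartz_partial)

lemma raise_schwartz: "f \<in> schwartz \<Longrightarrow> raise i f \<in> schwartz"
  unfolding raise_def[abs_def]
  by (intro schwartz_cmult schwartz_diff schwartz_coordinate schwartz_partial)

lemma rho_gen_schwartz: "f \<in> schwartz \<Longrightarrow> rho_gen g f \<in> schwartz"
  by (cases "(g, f)" rule: rho_gen.cases) (auto intro: lower_schwartz raise_schwartz schwartz_uminus)


text \<open>Rapid decay as domination by a weight that is bounded at the origin and, for large \<open>k\<close>,
  integrable.\<close>

lemma schwartz_bound:
  assumes "f \<in> schwartz"
  obtains C where "C \<ge> 0" "\<And>x. norm (f x) \<le> C * (1 / (1 + norm x) ^ k)"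
proof -
  obtain A where A: "\<And>x. norm x ^ 0 * norm (f x) \<le> A"
    using schwartz_decay[OF assms, of 0] by blast
  obtain B where B: "\<And>x. norm x ^ k * norm (f x) \<le> B"
    using schwartz_decay[OF assms, of k] by blast
  have pw: "(1 + t) ^ k \<le> 2 ^ k * (1 + t ^ k)" if "t \<ge> 0" for t :: real
  proof (cases "t \<le> 1")
    case True
    then have "(1 + t) ^ k \<le> 2 ^ k * 1" using that power_mono[of "1 + t" 2 k] by simp
    also have "\<dots> \<le> 2 ^ k * (1 + t ^ k)" using that by (intro mult_left_mono) auto
    finally show ?thesis .
  next
    case False
    then have "(1 + t) ^ k \<le> (2 * t) ^ k" by (intro power_mono) auto
    also have "\<dots> \<le> 2 ^ k * (1 + t ^ k)" by (simp add: power_mult_distrib)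
    finally show ?thesis .
  qed
  have "norm (f x) \<le> 2 ^ k * (A + B) * (1 / (1 + norm x) ^ k)" for x
  proof -
    have "norm (f x) * (1 + norm x) ^ k \<le> norm (f x) * (2 ^ k * (1 + norm x ^ k))"
      by (intro mult_left_mono pw) auto
    also have "\<dots> = 2 ^ k * (norm x ^ 0 * norm (f x) + norm x ^ k * norm (f x))"
      by (simp add: algebra_simps)
    also have "\<dots> \<le> 2 ^ k * (A + B)" by (intro mult_left_mono add_mono A B) auto
    finally show ?thesis by (simp add: field_simps add_pos_nonneg)
  qed
  moreover have "0 \<le> 2 ^ k * (A + B)"
    using order_trans[OF _ A[of 0]] order_trans[OF _ B[of 0]] by simp
  ultimately show thesis by (rule that[rotated])
qed

text \<open>The shell \<open>n \<le> norm x < n + 1\<close> lies in a ball of volume of order \<open>n\<^sup>3\<close>. A weight of order five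
  bounds its contribution to the integral by a multiple of \<open>1 / n\<^sup>2\<close>, which is summable.\<close>

lemma integrable_weight: "integrable lborel (\<lambda>x::real^3. 1 / (1 + norm x) ^ 5)"
proof (rule integrableI_nonneg)
  define u where "u n = ennreal (1 / (real n + 1) ^ 5)" for n
  have le: "ennreal (1 / (1 + norm x) ^ 5) \<le> suminf (\<lambda>n. u n * indicator (cball 0 (real n + 1)) x)"
    for x :: "real^3"
  proof -
    define n where "n = nat \<lfloor>norm x\<rfloor>"
    have n: "real n \<le> norm x" "norm x \<le> real n + 1"
      unfolding n_def by (auto simp: of_nat_nat)
    have "1 / (1 + norm x) ^ 5 \<le> 1 / (real n + 1) ^ 5"
      using n by (intro divide_left_mono power_mono mult_pos_pos zero_less_power) (auto intro: add_nonneg_pos)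
    then have "ennreal (1 / (1 + norm x) ^ 5) \<le> u n * indicator (cball 0 (real n + 1)) x"
      using n by (simp add: u_def indicator_def ennreal_leI)
    also have "\<dots> \<le> suminf (\<lambda>n. u n * indicator (cball 0 (real n + 1)) x)"
    proof -
      define g where "g n = u n * indicator (cball 0 (real n + 1)) x" for n
      have "sum g {n} \<le> suminf g" by (rule sum_le_suminf) auto
      then have "g n \<le> suminf g" by simp
      then show ?thesis unfolding g_def[abs_def] .
    qed
    finally show ?thesis .
  qed
  define V where "V = unit_ball_vol 3"
  have V: "V \<ge> 0" by (simp add: V_def)
  have "nn_integral lborel (\<lambda>x::real^3. ennreal (1 / (1 + norm x) ^ 5))
      \<le> nn_integral lborel (\<lambda>x::real^3. suminf (\<lambda>n. u n * indicator (cball 0 (real n + 1)) x))"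
    by (intro nn_integral_mono le)
  also have "\<dots> = suminf (\<lambda>n. u n * emeasure lborel (cball (0::real^3) (real n + 1)))"
  proof (subst nn_integral_suminf)
    show "(\<lambda>x::real^3. u n * indicator (cball 0 (real n + 1)) x) \<in> borel_measurable lborel" for n
      by (intro borel_measurable_times_ennreal borel_measurable_const borel_measurable_indicator)
        (simp add: borel_closed)
  qed (simp add: nn_integral_cmult_indicator)
  also have "\<dots> = suminf (\<lambda>n. ennreal (V * (1 / (real n + 1) ^ 2)))"
  proof (intro arg_cong[where f=suminf] ext)
    fix n
    have "1 / a ^ 5 * (V * a ^ 3) = V * (1 / a ^ 2)" if "a > 0" for a :: real
      using that by (simp add: field_simps flip: power_add)
    from this[of "real n + 1"]
    have "1 / (real n + 1) ^ 5 * (V * (real n + 1) ^ 3) = V * (1 / (real n + 1) ^ 2)"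
      by simp
    then show "u n * emeasure lborel (cball (0::real^3) (real n + 1)) = ennreal (V * (1 / (real n + 1) ^ 2))"
      using V by (simp add: u_def emeasure_cball V_def flip: ennreal_mult)
  qed
  also have "\<dots> < \<infinity>"
  proof -
    have "summable (\<lambda>n. V * (1 / (real n + 1) ^ 2))"
      using inverse_squares_sums by (intro summable_mult) (simp add: sums_iff add.commute)
    then show ?thesis
      using V by (subst suminf_ennreal2) auto
  qed
  finally show "nn_integral lborel (\<lambda>x::real^3. ennreal (1 / (1 + norm x) ^ 5)) < \<infinity>" .
qed auto

lemma integrable_by_weight:
  fixes f :: wavefun
  assumes "f \<in> borel_measurable borel" "\<And>x. norm (f x) \<le> C * (1 / (1 + norm x) ^ 5)"
  shows "integrable lborel f"
proof (rule Bochner_Integration.integrable_bound)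
  show "integrable lborel (\<lambda>x::real^3. C * (1 / (1 + norm x) ^ 5))"
    by (rule integrable_mult_right) (rule integrable_weight)
  show "AE x in lborel. norm (f x) \<le> norm (C * (1 / (1 + norm x) ^ 5))"
    using order_trans[OF assms(2) abs_ge_self] by simp
qed (use assms in simp)

lemma schwartz_mult_bound:
  assumes "f \<in> schwartz" "g \<in> schwartz"
  obtains C where "\<And>x. norm (cnj (f x) * g x) \<le> C * (1 / (1 + norm x) ^ 5)"
proof -
  obtain A where A: "A \<ge> 0" "\<And>x. norm (f x) \<le> A * (1 / (1 + norm x) ^ 0)"
    using schwartz_bound[OF assms(1)] by blast
  obtain B where B: "B \<ge> 0" "\<And>x. norm (g x) \<le> B * (1 / (1 + norm x) ^ 5)"
    using schwartz_bound[OF assms(2)] by blast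
  have "norm (cnj (f x) * g x) \<le> A * B * (1 / (1 + norm x) ^ 5)" for x
    using mult_mono[OF A(2) B(2), of x x] A(1) by (simp add: norm_mult)
  then show thesis by (rule that)
qed

lemma schwartz_mult_integrable:
  assumes "f \<in> schwartz" "g \<in> schwartz"
  shows "integrable lborel (\<lambda>x. cnj (f x) * g x)"
proof -
  obtain C where "\<And>x. norm (cnj (f x) * g x) \<le> C * (1 / (1 + norm x) ^ 5)"
    using schwartz_mult_bound[OF assms] by blast
  moreover have "(\<lambda>x. cnj (f x) * g x) \<in> borel_measurable borel"
    using assms by (intro borel_measurable_continuous_onI continuous_intros schwartz_continuous)
  ultimately show ?thesis by (intro integrable_by_weight)
qed

text \<open>The integral of a difference quotient vanishes by translation invariance of Lebesgue measure;
  dominated convergence carries this over to the derivative.\<close>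

lemma integral_partial_eq_0:
  fixes F :: wavefun
  assumes diff: "\<And>x. F differentiable (at x)" and int: "integrable lborel F"
    and meas: "partial i F \<in> borel_measurable borel"
    and bound: "\<And>x. norm (partial i F x) \<le> C * (1 / (1 + norm x) ^ 5)"
  shows "(LINT x|lborel. partial i F x) = 0"
proof -
  define e :: "real^3" where "e = axis i 1"
  define h where "h n = 1 / (real n + 1)" for n
  have h: "0 < h n" "h n \<le> 1" for n by (auto simp: h_def)
  have h0: "h \<longlonglongrightarrow> 0"
    using LIMSEQ_inverse_real_of_nat
    unfolding h_def[abs_def] inverse_eq_divide of_nat_Suc by (simp only: add.commute)
  define q where "q n x = (F (x + h n *\<^sub>R e) - F x) /\<^sub>R h n" for n x
  have Fm: "F \<in> borel_measurable borel" using int by auto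
  have C: "C \<ge> 0" using order_trans[OF norm_ge_zero bound[of 0]] by simp
  have int_shift: "integrable lborel (\<lambda>x. F (x + a))"
    and integral_shift: "(LINT x|lborel. F (x + a)) = (LINT x|lborel. F x)" for a
  proof -
    show "integrable lborel (\<lambda>x. F (x + a))"
      using int integrable_distr_eq[of "(+) a" lborel borel F] Fm
      unfolding lborel_distr_plus add.commute[of a] by simp
    show "(LINT x|lborel. F (x + a)) = (LINT x|lborel. F x)"
      using integral_distr[of "(+) a" lborel borel F] Fm
      unfolding lborel_distr_plus add.commute[of a] by simp
  qed
  have q0: "(LINT x|lborel. q n x) = 0" for n
    unfolding q_def using int int_shift integral_shift by simp
  have "(\<lambda>n. LINT x|lborel. q n x) \<longlonglongrightarrow> (LINT x|lborel. partial i F x)"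
  proof (rule integral_dominated_convergence)
    show "partial i F \<in> borel_measurable lborel" using meas by simp
    show "q n \<in> borel_measurable lborel" for n
      unfolding q_def[abs_def]
      by (intro borel_measurable_scaleR borel_measurable_diff borel_measurable_const
          borel_measurable_integrable int int_shift)
    show "integrable lborel (\<lambda>x::real^3. C * 2 ^ 5 * (1 / (1 + norm x) ^ 5))"
      by (rule integrable_mult_right) (rule integrable_weight)
    show "AE x in lborel. (\<lambda>n. q n x) \<longlonglongrightarrow> partial i F x"
    proof (rule AE_I2)
      fix x
      have "((\<lambda>t. norm (F (x + t *\<^sub>R e) - F x - t *\<^sub>R partial i F x) / norm t) \<longlongrightarrow> 0) (at 0)"
        using has_vector_derivative_line0[OF diff, of x i]
        by (simp add: has_vector_derivative_def has_derivative_at e_def)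
      then have "((\<lambda>t. norm ((F (x + t *\<^sub>R e) - F x) /\<^sub>R t - partial i F x)) \<longlongrightarrow> 0) (at 0)"
      proof (rule Lim_transform_eventually)
        have "norm (F (x + t *\<^sub>R e) - F x - t *\<^sub>R partial i F x) / norm t
            = norm ((F (x + t *\<^sub>R e) - F x) /\<^sub>R t - partial i F x)" if "t \<noteq> 0" for t
        proof -
          have "F (x + t *\<^sub>R e) - F x - t *\<^sub>R partial i F x
              = t *\<^sub>R ((F (x + t *\<^sub>R e) - F x) /\<^sub>R t - partial i F x)"
            using that by (simp add: scaleR_right_diff_distrib)
          then show ?thesis using that by simp
        qed
        then show "\<forall>\<^sub>F t in at 0. norm (F (x + t *\<^sub>R e) - F x - t *\<^sub>R partial i F x) / norm t
            = norm ((F (x + t *\<^sub>R e) - F x) /\<^sub>R t - partial i F x)"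
          by (auto simp: eventually_at_filter)
      qed
      then have "((\<lambda>t. (F (x + t *\<^sub>R e) - F x) /\<^sub>R t) \<longlongrightarrow> partial i F x) (at 0)"
        by (rule LIM_zero_cancel[OF tendsto_norm_zero_cancel])
      moreover have "filterlim h (at 0) sequentially"
        using h0 h(1) by (intro filterlim_atI) (auto simp: less_imp_neq[symmetric])
      ultimately show "(\<lambda>n. q n x) \<longlonglongrightarrow> partial i F x"
        unfolding q_def by (rule filterlim_compose)
    qed
    show "AE x in lborel. norm (q n x) \<le> C * 2 ^ 5 * (1 / (1 + norm x) ^ 5)" for n
    proof (rule AE_I2)
      fix x
      have vd: "((\<lambda>t. F (x + t *\<^sub>R e)) has_derivative (\<lambda>s. s *\<^sub>R partial i F (x + t *\<^sub>R e))) (at t)" for t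
        using has_vector_derivative_line[OF diff, of x i t] by (simp add: has_vector_derivative_def e_def)
      have "\<exists>t\<in>{0<..<h n}. norm (F (x + h n *\<^sub>R e) - F (x + 0 *\<^sub>R e))
          \<le> norm ((h n - 0) *\<^sub>R partial i F (x + t *\<^sub>R e))"
        by (rule mvt_general)
          (use h vd in \<open>auto intro!: continuous_at_imp_continuous_on has_derivative_continuous\<close>)
      then obtain t where t: "0 < t" "t < h n"
        and le: "norm (F (x + h n *\<^sub>R e) - F x) \<le> h n * norm (partial i F (x + t *\<^sub>R e))"
        using h(1)[of n] by auto
      have "norm (q n x) \<le> norm (partial i F (x + t *\<^sub>R e))"
      proof -
        have "norm (q n x) = norm (F (x + h n *\<^sub>R e) - F x) / h n"
          using h(1)[of n] by (simp add: q_def divide_inverse mult.commute)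
        with le h(1)[of n] show ?thesis by (simp add: divide_le_eq mult.commute)
      qed
      also have "\<dots> \<le> C * (1 / (1 + norm (x + t *\<^sub>R e)) ^ 5)" by (rule bound)
      (* A shift by at most 1 changes 1 + norm x at most by the factor 2. *)
      also have "\<dots> \<le> C * (2 ^ 5 * (1 / (1 + norm x) ^ 5))"
      proof (rule mult_left_mono[OF _ C])
        have "norm (t *\<^sub>R e) \<le> 1" using t h(2)[of n] by (simp add: e_def)
        then have "norm x \<le> norm (x + t *\<^sub>R e) + 1"
          using norm_triangle_ineq4[of "x + t *\<^sub>R e" "t *\<^sub>R e"] by simp
        then have "(1 + norm x) ^ 5 \<le> (2 * (1 + norm (x + t *\<^sub>R e))) ^ 5"
        proof (intro power_mono)
          define a where "a = norm x"
          define b where "b = norm (x + t *\<^sub>R e)"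
          assume "norm x \<le> norm (x + t *\<^sub>R e) + 1"
          then have "a \<le> b + 1" "0 \<le> b" by (simp_all add: a_def b_def)
          then have "1 + a \<le> 2 * (1 + b)" by simp
          then show "1 + norm x \<le> 2 * (1 + norm (x + t *\<^sub>R e))" by (simp only: a_def b_def)
        qed auto
        then show "1 / (1 + norm (x + t *\<^sub>R e)) ^ 5 \<le> 2 ^ 5 * (1 / (1 + norm x) ^ 5)"
          unfolding power_mult_distrib by (simp add: field_simps add_pos_nonneg)
      qed
      finally show "norm (q n x) \<le> C * 2 ^ 5 * (1 / (1 + norm x) ^ 5)" by simp
    qed
  qed
  then show ?thesis
    unfolding q0 by (simp add: LIMSEQ_const_iff)
qed

text \<open>Integration by parts: the integral of the derivative of \<open>cnj f * g\<close> vanishes.\<close>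

lemma l2_inner_partial:
  assumes "f \<in> schwartz" "g \<in> schwartz"
  shows "l2_inner (partial i f) g = - l2_inner f (partial i g)"
proof -
  define F where "F = (\<lambda>x. cnj (f x) * g x)"
  have fd: "f differentiable (at x)" and gd: "g differentiable (at x)" for x
    using assms by (auto intro: schwartz_differentiable)
  have cf: "(\<lambda>x. cnj (f x)) differentiable (at x)" for x
    using fd[of x] bounded_linear.has_derivative[OF bounded_linear_cnj]
    unfolding differentiable_def by blast
  have part: "partial i F x = cnj (partial i f x) * g x + cnj (f x) * partial i g x" for x
    unfolding F_def
    using has_vector_derivative_mult[OF
        bounded_linear.has_vector_derivative[OF bounded_linear_cnj has_vector_derivative_line0[OF fd]]
        has_vector_derivative_line0[OF gd], of x i x i]
    by (intro partial_eqI) (simp add: add.commute)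
  have int: "integrable lborel (\<lambda>x. cnj (partial i f x) * g x)"
    "integrable lborel (\<lambda>x. cnj (f x) * partial i g x)" "integrable lborel F"
    unfolding F_def by (intro schwartz_mult_integrable schwartz_partial assms)+
  obtain A where A: "\<And>x. norm (cnj (partial i f x) * g x) \<le> A * (1 / (1 + norm x) ^ 5)"
    using schwartz_mult_bound[OF schwartz_partial[OF assms(1)] assms(2)] by blast
  obtain B where B: "\<And>x. norm (cnj (f x) * partial i g x) \<le> B * (1 / (1 + norm x) ^ 5)"
    using schwartz_mult_bound[OF assms(1) schwartz_partial[OF assms(2)]] by blast
  have "(LINT x|lborel. partial i F x) = 0"
  proof (rule integral_partial_eq_0[where C = "A + B"])
    show "F differentiable (at x)" for x
      unfolding F_def by (rule differentiable_mult[OF cf gd])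
    have "partial i F = (\<lambda>x. cnj (partial i f x) * g x + cnj (f x) * partial i g x)"
      using part by auto
    also have "\<dots> \<in> borel_measurable borel"
      using int(1,2) by simp
    finally show "partial i F \<in> borel_measurable borel" .
    show "norm (partial i F x) \<le> (A + B) * (1 / (1 + norm x) ^ 5)" for x
      unfolding part distrib_right using A B by (intro norm_triangle_le add_mono)
  qed (rule int)
  moreover have "(LINT x|lborel. partial i F x) = l2_inner (partial i f) g + l2_inner f (partial i g)"
    unfolding part l2_inner_def using int by simp
  ultimately show ?thesis by (simp add: eq_neg_iff_add_eq_0)
qed


lemma l2_inner_linear_right:
  assumes "f \<in> schwartz" "g \<in> schwartz" "h \<in> schwartz"
  shows "l2_inner f (\<lambda>x. c * g x + d * h x) = c * l2_inner f g + d * l2_inner f h"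
proof -
  have "l2_inner f (\<lambda>x. c * g x + d * h x)
      = (LINT x|lborel. c * (cnj (f x) * g x) + d * (cnj (f x) * h x))"
    unfolding l2_inner_def by (simp add: algebra_simps)
  also have "\<dots> = c * l2_inner f g + d * l2_inner f h"
    unfolding l2_inner_def using assms by (simp add: schwartz_mult_integrable)
  finally show ?thesis .
qed

lemma l2_inner_commute: "l2_inner g f = cnj (l2_inner f g)"
  using Bochner_Integration.integral_cnj[of lborel "\<lambda>x. cnj (f x) * g x"]
  by (simp add: l2_inner_def mult.commute)

lemma l2_inner_linear_left:
  assumes "f \<in> schwartz" "g \<in> schwartz" "h \<in> schwartz"
  shows "l2_inner (\<lambda>x. c * g x + d * h x) f = cnj c * l2_inner g f + cnj d * l2_inner h f"
  unfolding l2_inner_commute[of _ f] l2_inner_linear_right[OF assms] by simp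

text \<open>The coordinate is a symmetric operator and the derivative an antisymmetric one.\<close>

lemma l2_inner_lower:
  assumes "f \<in> schwartz" "g \<in> schwartz"
  shows "l2_inner (lower i f) g = l2_inner f (raise i g)"
proof -
  define X where "X h = (\<lambda>x::real^3. of_real (x $ i) * h x)" for h :: wavefun
  have X: "X f \<in> schwartz" "X g \<in> schwartz"
    unfolding X_def by (intro schwartz_coordinate assms)+
  define r where "r = complex_of_real (1 / sqrt 2)"
  have r: "cnj r = r" by (simp add: r_def)
  have "lower i f = (\<lambda>x. r * X f x + r * partial i f x)"
    by (auto simp: lower_def[abs_def] X_def r_def algebra_simps)
  moreover have "raise i g = (\<lambda>x. r * X g x + (- r) * partial i g x)"
    by (auto simp: raise_def[abs_def] X_def r_def algebra_simps)
  moreover have "l2_inner (X f) g = l2_inner f (X g)"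
    unfolding l2_inner_def X_def by (simp add: mult_ac)
  ultimately show ?thesis
    using l2_inner_linear_left[OF assms(2) X(1) schwartz_partial[OF assms(1)], of r r i]
      l2_inner_linear_right[OF assms(1) X(2) schwartz_partial[OF assms(2)], of r "- r" i]
    by (simp only: l2_inner_partial[OF assms] r) simp
qed

lemma l2_inner_raise:
  assumes "f \<in> schwartz" "g \<in> schwartz"
  shows "l2_inner (raise i f) g = l2_inner f (lower i g)"
  using l2_inner_lower[OF assms(2,1)] l2_inner_commute by metis

lemma l2_inner_sum_right:
  assumes "finite I" "f \<in> schwartz" "\<And>i. i \<in> I \<Longrightarrow> g i \<in> schwartz"
  shows "l2_inner f (\<lambda>x. \<Sum>i\<in>I. c i * g i x) = (\<Sum>i\<in>I. c i * l2_inner f (g i))"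
  using assms(1,3)
proof (induction I rule: finite_induct)
  case empty
  then show ?case by (simp add: l2_inner_def)
next
  case (insert i I)
  have "(\<lambda>x. \<Sum>i\<in>I. c i * g i x) \<in> schwartz"
    using insert assms(2) by (intro schwartz_sum schwartz_cmult) auto
  with insert show ?case
    using l2_inner_linear_right[OF assms(2), of "g i" "\<lambda>x. \<Sum>i\<in>I. c i * g i x" "c i" 1] by simp
qed

lemma l2_inner_sum_left:
  assumes "finite I" "f \<in> schwartz" "\<And>i. i \<in> I \<Longrightarrow> g i \<in> schwartz"
  shows "l2_inner (\<lambda>x. \<Sum>i\<in>I. c i * g i x) f = (\<Sum>i\<in>I. cnj (c i) * l2_inner (g i) f)"
  using arg_cong[where f = cnj, OF l2_inner_sum_right[OF assms, where c = c]]
  by (simp add: l2_inner_commute[symmetric])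

lemma l2_norm_integrable: "f \<in> schwartz \<Longrightarrow> integrable lborel (\<lambda>x. (norm (f x))\<^sup>2)"
  using integrable_norm[OF schwartz_mult_integrable[of f f]]
  by (simp add: norm_mult power2_eq_square)

lemma l2_norm_square: "(l2_norm f)\<^sup>2 = (LINT x|lborel. (norm (f x))\<^sup>2)"
  by (simp add: l2_norm_def integral_nonneg_AE)

lemma l2_norm_nonneg: "0 \<le> l2_norm f"
  by (simp add: l2_norm_def integral_nonneg_AE)

lemma l2_inner_self: "l2_inner f f = of_real ((l2_norm f)\<^sup>2)"
proof -
  have "(\<lambda>x. cnj (f x) * f x) = (\<lambda>x. complex_of_real ((norm (f x))\<^sup>2))"
    using complex_norm_square by (simp add: fun_eq_iff mult.commute)
  then show ?thesis
    unfolding l2_norm_square l2_inner_def by (metis integral_complex_of_real)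
qed

text \<open>The set where a continuous function does not vanish is open, and a nonempty open set has
  positive measure.\<close>

lemma l2_norm_eq_0_imp:
  assumes "f \<in> schwartz" "l2_norm f = 0"
  shows "f = (\<lambda>x. 0)"
proof -
  have "(LINT x|lborel. (norm (f x))\<^sup>2) = 0"
    using assms(2) l2_norm_square[of f] by simp
  then have "AE x in lborel. (norm (f x))\<^sup>2 = 0"
    using integral_nonneg_eq_0_iff_AE[OF l2_norm_integrable[OF assms(1)]] by simp
  then have "AE x in lborel. f x = 0" by simp
  moreover have "open {x. f x \<noteq> 0}"
    using schwartz_continuous[OF assms(1)] by (intro open_Collect_neq continuous_intros) auto
  ultimately have "{x. f x \<noteq> 0} \<in> null_sets lborel"
    by (subst AE_iff_null_sets) (auto simp: borel_open)
  then have "negligible {x. f x \<noteq> 0}"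
    by (simp add: negligible_iff_null_sets null_sets_completionI)
  moreover have "open {x. f x \<noteq> 0}"
    using schwartz_continuous[OF assms(1)] by (intro open_Collect_neq continuous_intros) auto
  ultimately have "{x. f x \<noteq> 0} = {}"
    using open_not_negligible by blast
  then show ?thesis by auto
qed

lemma l2_norm_cmult: "l2_norm (\<lambda>x. c * f x) = norm c * l2_norm f"
  by (simp add: l2_norm_def norm_mult power_mult_distrib real_sqrt_mult)

text \<open>A crude substitute for the triangle inequality that suffices for limits.\<close>

lemma l2_norm_add_square:
  assumes "f \<in> schwartz" "g \<in> schwartz"
  shows "(l2_norm (\<lambda>x. f x + g x))\<^sup>2 \<le> 2 * (l2_norm f)\<^sup>2 + 2 * (l2_norm g)\<^sup>2"
proof -
  have "(norm (a + b))\<^sup>2 \<le> 2 * (norm a)\<^sup>2 + 2 * (norm b)\<^sup>2" for a b :: complex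
  proof -
    have "(norm (a + b))\<^sup>2 \<le> (norm a + norm b)\<^sup>2"
      by (intro power_mono norm_triangle_ineq) auto
    also have "\<dots> \<le> 2 * (norm a)\<^sup>2 + 2 * (norm b)\<^sup>2"
      using sum_squares_bound[of "norm a" "norm b"] by (simp add: power2_sum)
    finally show ?thesis .
  qed
  then have "(LINT x|lborel. (norm (f x + g x))\<^sup>2)
      \<le> (LINT x|lborel. 2 * (norm (f x))\<^sup>2 + 2 * (norm (g x))\<^sup>2)"
    using assms by (intro integral_mono l2_norm_integrable schwartz_add Bochner_Integration.integrable_add
        integrable_mult_right)
  also have "\<dots> = 2 * (l2_norm f)\<^sup>2 + 2 * (l2_norm g)\<^sup>2"
    using assms by (simp add: l2_norm_square l2_norm_integrable)
  finally show ?thesis by (simp add: l2_norm_square)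
qed

lemma l2_norm_tendsto_add:
  assumes "\<And>l. f l \<in> schwartz" "\<And>l. g l \<in> schwartz"
    and "(\<lambda>l. l2_norm (f l)) \<longlonglongrightarrow> 0" "(\<lambda>l. l2_norm (g l)) \<longlonglongrightarrow> 0"
  shows "(\<lambda>l. l2_norm (\<lambda>x. f l x + g l x)) \<longlonglongrightarrow> 0"
proof -
  have "(\<lambda>l. (l2_norm (\<lambda>x. f l x + g l x))\<^sup>2) \<longlonglongrightarrow> 0"
  proof (rule tendsto_sandwich[where f = "\<lambda>_. 0"])
    show "(\<lambda>l. 2 * (l2_norm (f l))\<^sup>2 + 2 * (l2_norm (g l))\<^sup>2) \<longlonglongrightarrow> 0"
      using assms(3,4) by (auto intro!: tendsto_eq_intros)
  qed (auto intro!: always_eventually l2_norm_add_square assms)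
  then have "(\<lambda>l. sqrt ((l2_norm (\<lambda>x. f l x + g l x))\<^sup>2)) \<longlonglongrightarrow> sqrt 0"
    by (rule tendsto_real_sqrt)
  then show ?thesis by (simp add: l2_norm_nonneg)
qed

lemma l2_norm_tendsto_sum:
  assumes "finite I" "\<And>i. i \<in> I \<Longrightarrow> \<phi> i \<in> schwartz"
    and "\<And>i. i \<in> I \<Longrightarrow> (\<lambda>l. c l i) \<longlonglongrightarrow> (0::complex)"
  shows "(\<lambda>l. l2_norm (\<lambda>x. \<Sum>i\<in>I. c l i * \<phi> i x)) \<longlonglongrightarrow> 0"
  using assms
proof (induction I rule: finite_induct)
  case empty
  then show ?case by (simp add: l2_norm_def)
next
  case (insert i I)
  have "(\<lambda>l. norm (c l i) * l2_norm (\<phi> i)) \<longlonglongrightarrow> 0"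
    using insert.prems(2)[of i] by (intro tendsto_mult_left_zero tendsto_norm_zero) auto
  then have "(\<lambda>l. l2_norm (\<lambda>x. c l i * \<phi> i x + (\<Sum>i\<in>I. c l i * \<phi> i x))) \<longlonglongrightarrow> 0"
    using insert by (intro l2_norm_tendsto_add schwartz_cmult schwartz_sum[where ?f0.0 = "\<phi> i"])
      (auto simp: l2_norm_cmult)
  then show ?case using insert by simp
qed

text \<open>Makes \<open>strong_limit\<close> well defined.\<close>

lemma l2_norm_limit_unique:
  assumes "\<And>l. A l \<in> schwartz" "f \<in> schwartz" "g \<in> schwartz"
    and "(\<lambda>l. l2_norm (\<lambda>x. A l x - f x)) \<longlonglongrightarrow> 0" "(\<lambda>l. l2_norm (\<lambda>x. A l x - g x)) \<longlonglongrightarrow> 0"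
  shows "f = g"
proof -
  have minus: "l2_norm (\<lambda>x. - h x) = l2_norm h" for h by (simp add: l2_norm_def)
  have "(\<lambda>l. l2_norm (\<lambda>x. (A l x - f x) + - (A l x - g x))) \<longlonglongrightarrow> 0"
    using assms minus[of "\<lambda>x. A _ x - g x"]
    by (intro l2_norm_tendsto_add schwartz_diff schwartz_uminus) auto
  then have "l2_norm (\<lambda>x. g x - f x) = 0"
    by (simp add: LIMSEQ_const_iff)
  then have "(\<lambda>x. g x - f x) = (\<lambda>x. 0)"
    by (intro l2_norm_eq_0_imp schwartz_diff assms)
  then show ?thesis by (auto simp: fun_eq_iff)
qed


section \<open>The canonical commutation relations on the Schwartz space\<close>

text \<open>Differentiate \<open>f (x + t e\<^sub>j) - f x\<close>, the integral of \<open>\<partial>\<^sub>j f\<close> along a segment, in direction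
  \<open>e\<^sub>i\<close> under the integral sign, and then in \<open>t\<close>.\<close>

lemma partial_commute:
  assumes f: "f \<in> schwartz"
  shows "partial i (partial j f) = partial j (partial i f)"
proof
  fix x
  define e :: "real^3" where "e = axis i 1"
  define d :: "real^3" where "d = axis j 1"
  have line: "((\<lambda>t. h (y + t *\<^sub>R axis k 1)) has_vector_derivative
      partial k h (y + t *\<^sub>R axis k 1)) (at t)" if "h \<in> schwartz" for h y t k
    using that by (intro has_vector_derivative_line schwartz_differentiable)
  define g where "g s = partial i (partial j f) (x + s *\<^sub>R d)" for s
  have g_cont: "continuous_on S g" for S
    unfolding g_def
    by (intro continuous_on_compose2[OF schwartz_continuous[of "partial i (partial j f)" UNIV]]
        schwartz_partial f continuous_intros) auto
  have key: "partial i f (x + t *\<^sub>R d) - partial i f x = integral {0..t} g" if t: "0 \<le> t" for t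
  proof -
    have ftc: "integral (cbox 0 t) (\<lambda>s. partial j f (x + u *\<^sub>R e + s *\<^sub>R d))
        = f (x + u *\<^sub>R e + t *\<^sub>R d) - f (x + u *\<^sub>R e)" for u
    proof -
      have "((\<lambda>s. partial j f (x + u *\<^sub>R e + s *\<^sub>R d)) has_integral
          f (x + u *\<^sub>R e + t *\<^sub>R d) - f (x + u *\<^sub>R e + 0 *\<^sub>R d)) {0..t}"
        using t line[OF f, of "x + u *\<^sub>R e" j]
        by (intro fundamental_theorem_of_calculus) (auto simp: d_def intro: has_vector_derivative_at_within)
      then show ?thesis by (simp add: integral_unique)
    qed
    have "((\<lambda>u. integral (cbox 0 t) (\<lambda>s. partial j f (x + u *\<^sub>R e + s *\<^sub>R d))) has_vector_derivative
        integral (cbox 0 t) (\<lambda>s. partial i (partial j f) (x + 0 *\<^sub>R e + s *\<^sub>R d))) (at 0 within UNIV)"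
    proof (rule leibniz_rule_vector_derivative)
      fix u s
      have "((\<lambda>u. partial j f ((x + s *\<^sub>R d) + u *\<^sub>R e)) has_vector_derivative
          partial i (partial j f) ((x + s *\<^sub>R d) + u *\<^sub>R e)) (at u)"
        unfolding e_def by (intro line schwartz_partial f)
      then show "((\<lambda>u. partial j f (x + u *\<^sub>R e + s *\<^sub>R d)) has_vector_derivative
          partial i (partial j f) (x + u *\<^sub>R e + s *\<^sub>R d)) (at u within UNIV)"
        by (simp add: add_ac)
    next
      show "(\<lambda>s. partial j f (x + u *\<^sub>R e + s *\<^sub>R d)) integrable_on cbox 0 t" for u
        by (intro integrable_continuous continuous_intros
            continuous_on_compose2[OF schwartz_continuous[of "partial j f" UNIV]] schwartz_partial f) auto
      show "continuous_on (UNIV \<times> cbox 0 t) (\<lambda>(u, s). partial i (partial j f) (x + u *\<^sub>R e + s *\<^sub>R d))"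
        unfolding split_beta
        by (intro continuous_intros
            continuous_on_compose2[OF schwartz_continuous[of "partial i (partial j f)" UNIV]]
            schwartz_partial f) auto
    qed auto
    then have "((\<lambda>u. f (x + u *\<^sub>R e + t *\<^sub>R d) - f (x + u *\<^sub>R e)) has_vector_derivative
        integral {0..t} g) (at 0)"
      unfolding ftc by (simp add: g_def[abs_def])
    moreover have "((\<lambda>u. f (x + u *\<^sub>R e + t *\<^sub>R d) - f (x + u *\<^sub>R e)) has_vector_derivative
        partial i f (x + t *\<^sub>R d) - partial i f x) (at 0)"
      using has_vector_derivative_diff[OF line[OF f, of "x + t *\<^sub>R d" i 0] line[OF f, of x i 0]]
      by (simp add: e_def add_ac)
    ultimately show ?thesis
      by (rule vector_derivative_unique_at[symmetric])
  qed
  have "((\<lambda>t. integral {0..t} g) has_vector_derivative g 0) (at 0 within {0..1})"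
    by (intro integral_has_vector_derivative g_cont) auto
  then have "((\<lambda>t. partial i f (x + t *\<^sub>R d) - partial i f x) has_vector_derivative g 0)
      (at 0 within {0..1})"
  proof (rule has_vector_derivative_transform[rotated 2])
    show "partial i f (x + t *\<^sub>R d) - partial i f x = integral {0..t} g" if "t \<in> {0..1}" for t
      by (rule key) (use that in simp)
  qed simp
  moreover have "((\<lambda>t. partial i f (x + t *\<^sub>R d) - partial i f x) has_vector_derivative
      partial j (partial i f) x - 0) (at 0 within {0..1})"
  proof (rule has_vector_derivative_diff[OF has_vector_derivative_at_within has_vector_derivative_const])
    show "((\<lambda>t. partial i f (x + t *\<^sub>R d)) has_vector_derivative partial j (partial i f) x) (at 0)"
      using line[OF schwartz_partial[OF f], of i x j 0] unfolding d_def by simp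
  qed
  ultimately have "g 0 = partial j (partial i f) x - 0"
    by (intro vector_derivative_unique_within_closed_interval[of 0 1 0 _ "g 0"]) simp_all
  then show "partial i (partial j f) x = partial j (partial i f) x"
    by (simp add: g_def)
qed


lemma lower_linear:
  assumes "f \<in> schwartz" "g \<in> schwartz"
  shows "lower i (\<lambda>x. y * f x + z * g x) = (\<lambda>x. y * lower i f x + z * lower i g x)"
  using assms by (auto simp: lower_def[abs_def] partial_linear schwartz_differentiable algebra_simps
      add_divide_distrib diff_divide_distrib)

lemma raise_linear:
  assumes "f \<in> schwartz" "g \<in> schwartz"
  shows "raise i (\<lambda>x. y * f x + z * g x) = (\<lambda>x. y * raise i f x + z * raise i g x)"
  using assms by (auto simp: raise_def[abs_def] partial_linear schwartz_differentiable algebra_simps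
      add_divide_distrib diff_divide_distrib)

lemma linear_op_rho_gen: "linear_op schwartz (rho_gen g)"
proof -
  have "rho_gen g (\<lambda>x. y * f x + z * h x) = (\<lambda>x. y * rho_gen g f x + z * rho_gen g h x)"
    if "f \<in> schwartz" "h \<in> schwartz" for f h y z
    using that
    by (cases "(g, f)" rule: rho_gen.cases)
      (auto simp: lower_linear raise_linear algebra_simps)
  then show ?thesis by (simp add: linear_op_def)
qed

lemma linear_opD:
  assumes "linear_op D T" "f \<in> D" "g \<in> D"
  shows "T (\<lambda>x. y * f x + z * g x) = (\<lambda>x. y * T f x + z * T g x)"
  using assms by (simp add: linear_op_def)

lemma linear_op_cmult:
  assumes "linear_op schwartz T" "f \<in> schwartz"
  shows "T (\<lambda>x. c * f x) = (\<lambda>x. c * T f x)"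
  using linear_opD[OF assms assms(2), of c 0] by simp

lemma linear_op_sum:
  assumes T: "linear_op schwartz T" and f0: "f0 \<in> schwartz"
    and "finite I" "\<And>i. i \<in> I \<Longrightarrow> \<phi> i \<in> schwartz"
  shows "T (\<lambda>x. \<Sum>i\<in>I. c i * \<phi> i x) = (\<lambda>x. \<Sum>i\<in>I. c i * T (\<phi> i) x)"
  using assms(3,4)
proof (induction I rule: finite_induct)
  case empty
  then show ?case using linear_op_cmult[OF T f0, of 0] by simp
next
  case (insert i I)
  have "(\<lambda>x. \<Sum>i\<in>I. c i * \<phi> i x) \<in> schwartz"
    using insert f0 by (intro schwartz_sum schwartz_cmult) auto
  from linear_opD[OF T _ this, of "\<phi> i" "c i" 1] insert show ?case by simp
qed

lemma sqrt2_inverse_square: "complex_of_real (1 / sqrt 2) * (complex_of_real (1 / sqrt 2) * z) = z / 2"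
proof -
  have "complex_of_real (1 / sqrt 2) * (complex_of_real (1 / sqrt 2) * z)
      = complex_of_real (1 / sqrt 2 * (1 / sqrt 2)) * z"
    by (simp only: of_real_mult mult.assoc)
  also have "1 / sqrt 2 * (1 / sqrt 2) = (1 / 2 :: real)" by simp
  finally show ?thesis by simp
qed

lemma partial_lower:
  assumes "f \<in> schwartz"
  shows "partial i (lower j f) x = of_real (1 / sqrt 2) *
    ((if i = j then f x else 0) + of_real (x $ j) * partial i f x + partial i (partial j f) x)"
proof -
  define r where "r = complex_of_real (1 / sqrt 2)"
  have eq: "lower j f = (\<lambda>x. r * (of_real (x $ j) * f x) + r * partial j f x)"
    unfolding lower_def[abs_def] r_def[symmetric] by (simp add: algebra_simps)
  show ?thesis
    unfolding eq r_def[symmetric] partial_linear[OF schwartz_differentiable[OF schwartz_coordinate[OF assms]]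
        schwartz_differentiable[OF schwartz_partial[OF assms]]]
      partial_coordinate[OF schwartz_differentiable[OF assms]]
    by (simp add: algebra_simps)
qed

lemma partial_raise:
  assumes "f \<in> schwartz"
  shows "partial i (raise j f) x = of_real (1 / sqrt 2) *
    ((if i = j then f x else 0) + of_real (x $ j) * partial i f x - partial i (partial j f) x)"
proof -
  define r where "r = complex_of_real (1 / sqrt 2)"
  have eq: "raise j f = (\<lambda>x. r * (of_real (x $ j) * f x) + (- r) * partial j f x)"
    unfolding raise_def[abs_def] r_def[symmetric] by (simp add: algebra_simps)
  show ?thesis
    unfolding eq r_def[symmetric] partial_linear[OF schwartz_differentiable[OF schwartz_coordinate[OF assms]]
        schwartz_differentiable[OF schwartz_partial[OF assms]]]
      partial_coordinate[OF schwartz_differentiable[OF assms]]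
    by (simp add: algebra_simps)
qed

lemma lower_lower_commute:
  assumes "f \<in> schwartz" shows "lower i (lower j f) x = lower j (lower i f) x"
  unfolding lower_def[of _ "lower _ f"] partial_lower[OF assms] partial_commute[OF assms, of i j]
  by (simp add: lower_def algebra_simps)

lemma raise_raise_commute:
  assumes "f \<in> schwartz" shows "raise i (raise j f) x = raise j (raise i f) x"
  unfolding raise_def[of _ "raise _ f"] partial_raise[OF assms] partial_commute[OF assms, of i j]
  by (simp add: raise_def algebra_simps)

text \<open>All terms cancel in pairs by \<open>partial_commute\<close> except those in which the derivative hits the
  coordinate.\<close>

lemma lower_raise_commute:
  assumes "f \<in> schwartz"
  shows "lower i (raise j f) x = raise j (lower i f) x + (if i = j then f x else 0)"
proof -
  define r where "r = complex_of_real (1 / sqrt 2)"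
  have r: "r * (r * z) = z / 2" for z
    unfolding r_def by (rule sqrt2_inverse_square)
  show ?thesis
    unfolding lower_def[of _ "raise _ f"] raise_def[of _ "lower _ f"] partial_lower[OF assms]
      partial_raise[OF assms] partial_commute[OF assms, of i j] r_def[symmetric]
    unfolding lower_def raise_def r_def[symmetric]
    by (simp add: algebra_simps r)
qed

lemma lower_uminus: "f \<in> schwartz \<Longrightarrow> lower i (\<lambda>x. - f x) = (\<lambda>x. - lower i f x)"
  using lower_linear[of f f i "-1" 0] by simp

lemma raise_uminus: "f \<in> schwartz \<Longrightarrow> raise i (\<lambda>x. - f x) = (\<lambda>x. - raise i f x)"
  using raise_linear[of f f i "-1" 0] by simp

lemma rho_gen_commutator:
  assumes "f \<in> schwartz"
  shows "rho_gen g (rho_gen h f) x - rho_gen h (rho_gen g f) x = heis_form g h * f x"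
proof -
  note [simp] = lower_uminus raise_uminus lower_schwartz raise_schwartz assms
    lower_raise_commute[OF assms]
  have *: "lower i (lower j f) x - lower j (lower i f) x = 0" for i j
    using lower_lower_commute[OF assms] by simp
  have **: "raise i (raise j f) x - raise j (raise i f) x = 0" for i j
    using raise_raise_commute[OF assms] by simp
  have rho: "rho_gen Ann = lower 1" "rho_gen Cre = raise 1"
    "rho_gen (Mode Pl Pl) = (\<lambda>f x. - lower 2 f x)" "rho_gen (Mode Mi Mi) = raise 2"
    "rho_gen (Mode Mi Pl) = lower 3" "rho_gen (Mode Pl Mi) = raise 3"
    by (auto simp: fun_eq_iff)
  have gens: "g \<in> {Ann, Cre, Mode Pl Pl, Mode Pl Mi, Mode Mi Pl, Mode Mi Mi}" for g
    by (metis (full_types) gen.exhaust insert_iff pm.exhaust)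
  show ?thesis
    using gens[of g] gens[of h] *[of 1 2] *[of 1 3] *[of 2 3] **[of 1 2] **[of 1 3] **[of 2 3]
    by (auto simp: rho algebra_simps)
qed


section \<open>The representation of the Weyl algebra\<close>

text \<open>The free algebra acts by composing the operators of the letters of a word. The action passes to
  the Weyl algebra because \<open>weyl_relator g h\<close> acts as zero (\<open>rho_gen_commutator\<close>).\<close>

definition word_op :: "gen list \<Rightarrow> wavefun \<Rightarrow> wavefun"
  where "word_op ws f = foldr rho_gen ws f"

definition free_op :: "free_alg \<Rightarrow> wavefun \<Rightarrow> wavefun"
  where "free_op p f x = (\<Sum>ws\<in>Poly_Mapping.keys p. Poly_Mapping.lookup p ws * word_op ws f x)"

lemma word_op_schwartz: "f \<in> schwartz \<Longrightarrow> word_op ws f \<in> schwartz"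
  unfolding word_op_def by (induction ws) (auto intro: rho_gen_schwartz)

lemma linear_op_word_op: "linear_op schwartz (word_op ws)"
proof (induction ws)
  case (Cons g ws)
  then show ?case
    using linear_op_rho_gen[of g] word_op_schwartz[of _ ws]
    unfolding linear_op_def word_op_def by simp
qed (simp add: word_op_def linear_op_def)

lemma free_op_eq_sum:
  assumes "finite K" "Poly_Mapping.keys p \<subseteq> K"
  shows "free_op p f x = (\<Sum>ws\<in>K. Poly_Mapping.lookup p ws * word_op ws f x)"
  unfolding free_op_def by (intro sum.mono_neutral_left assms) (auto simp: in_keys_iff)

lemma free_op_add: "free_op (p + q) f = (\<lambda>x. free_op p f x + free_op q f x)"
proof
  fix x
  have K: "finite (Poly_Mapping.keys p \<union> Poly_Mapping.keys q)" "Poly_Mapping.keys (p + q) \<subseteq> Poly_Mapping.keys p \<union> Poly_Mapping.keys q"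
    using Poly_Mapping.keys_add[of p q] by auto
  show "free_op (p + q) f x = free_op p f x + free_op q f x"
    by (simp add: free_op_eq_sum[OF K] free_op_eq_sum[OF K(1), of p] free_op_eq_sum[OF K(1), of q]
        lookup_add distrib_right sum.distrib)
qed

lemma free_op_single: "free_op (Poly_Mapping.single ws c) f = (\<lambda>x. c * word_op ws f x)"
  by (rule ext, subst free_op_eq_sum[of "{ws}"]) auto

lemma free_op_zero: "free_op 0 f = (\<lambda>x. 0)"
  by (auto simp: free_op_def)

lemma free_op_uminus: "free_op (- p) f = (\<lambda>x. - free_op p f x)"
  using free_op_add[of p "- p" f] free_op_zero[of f] by (auto simp: fun_eq_iff eq_neg_iff_add_eq_0 add.commute)

lemma free_op_schwartz: "f \<in> schwartz \<Longrightarrow> free_op p f \<in> schwartz"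
  unfolding free_op_def[abs_def]
  by (intro schwartz_sum[of _ _ f] schwartz_cmult word_op_schwartz) auto

lemma linear_op_free_op: "linear_op schwartz (free_op p)"
  using linear_op_word_op unfolding linear_op_def free_op_def[abs_def]
  by (simp add: algebra_simps sum.distrib sum_distrib_left)

lemma free_alg_induct [case_names zero single add]:
  fixes p :: free_alg
  assumes "P 0" "\<And>ws c. P (Poly_Mapping.single ws c)" "\<And>p q. P p \<Longrightarrow> P q \<Longrightarrow> P (p + q)"
  shows "P p"
proof (induction p rule: update_induct)
  case (update p ws c)
  have "Poly_Mapping.update ws c p = p + Poly_Mapping.single ws c"
    using update(1) by (intro poly_mapping_eqI) (auto simp: lookup_update lookup_add lookup_single in_keys_iff when_def)
  then show ?case using assms update by simp
qed (rule assms)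

lemma free_op_mult:
  assumes "f \<in> schwartz" shows "free_op (p * q) f = free_op p (free_op q f)"
proof (induction p rule: free_alg_induct)
  case (single ws c)
  show ?case
  proof (induction q rule: free_alg_induct)
    case (single vs d)
    have "word_op ws (\<lambda>x. d * word_op vs f x) = (\<lambda>x. d * word_op ws (word_op vs f) x)"
      by (intro linear_op_cmult linear_op_word_op word_op_schwartz assms)
    then show ?case
      by (simp add: mult_single free_op_single plus_list_def word_op_def mult.assoc)
  next
    case (add p q)
    have "free_op r (\<lambda>x. 1 * free_op p f x + 1 * free_op q f x)
        = (\<lambda>x. 1 * free_op r (free_op p f) x + 1 * free_op r (free_op q f) x)" for r
      by (rule linear_opD[OF linear_op_free_op free_op_schwartz[OF assms] free_op_schwartz[OF assms]])
    with add show ?case by (simp add: distrib_left free_op_add)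
  next
    case zero
    have "free_op r (\<lambda>x. 0 * f x) = (\<lambda>x. 0 * free_op r f x)" for r
      by (intro linear_op_cmult linear_op_free_op assms)
    then show ?case by (simp add: free_op_zero)
  qed
qed (simp_all add: free_op_zero free_op_add distrib_right)

lemma free_op_relator:
  assumes "f \<in> schwartz" shows "free_op (weyl_relator g h) f = (\<lambda>x. 0)"
proof -
  have "free_op (weyl_relator g h) f = (\<lambda>x. rho_gen g (rho_gen h f) x - rho_gen h (rho_gen g f) x
      - heis_form g h * f x)"
    unfolding weyl_relator_def free_gen_def free_const_def diff_conv_add_uminus
      free_op_add free_op_uminus mult_single
    by (simp add: free_op_single word_op_def plus_list_def)
  then show ?thesis using rho_gen_commutator[OF assms] by simp
qed

lemma free_op_weyl_ideal:
  assumes "p \<in> weyl_ideal" "f \<in> schwartz" shows "free_op p f = (\<lambda>x. 0)"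
  using assms(1)
proof induction
  case (step p u g h v)
  have zero: "free_op r (\<lambda>x. 0) = (\<lambda>x. 0)" for r
    using linear_op_cmult[OF linear_op_free_op assms(2), of r 0] by simp
  have "free_op (u * weyl_relator g h * v) f = (\<lambda>x. 0)"
    by (simp add: free_op_mult free_op_relator free_op_schwartz assms(2) zero)
  with step show ?case by (simp add: free_op_add)
qed (rule free_op_zero)

lift_definition weyl_act :: "weyl \<Rightarrow> wavefun \<Rightarrow> wavefun" is "\<lambda>p. restrict (free_op p) schwartz"
proof
  fix p q f
  assume "weyl_rel p q"
  then have "free_op (p - q) f = (\<lambda>x. 0)" if "f \<in> schwartz"
    using free_op_weyl_ideal that by (simp add: weyl_rel_def)
  then show "restrict (free_op p) schwartz f = restrict (free_op q) schwartz f"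
    unfolding diff_conv_add_uminus free_op_add free_op_uminus by (auto simp: fun_eq_iff restrict_def)
qed

lemma is_rho_weyl_act: "is_rho weyl_act"
proof -
  have ext: "weyl_act w \<in> schwartz \<rightarrow>\<^sub>E schwartz" for w
    by transfer (auto simp: free_op_schwartz)
  moreover have "linear_op schwartz (weyl_act w)" for w
    using linear_op_free_op by transfer (auto simp: linear_op_def schwartz_linear)
  moreover have "weyl_act 1 f = f" if "f \<in> schwartz" for f
    using that by transfer (simp add: single_one[symmetric] free_op_single word_op_def zero_list_def del: single_one)
  moreover have "weyl_act (v + w) f = (\<lambda>x. weyl_act v f x + weyl_act w f x)" if "f \<in> schwartz" for f v w
    using that by transfer (simp add: free_op_add)
  moreover have "weyl_act (v * w) f = weyl_act v (weyl_act w f)" if "f \<in> schwartz" for f v w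
    using that by transfer (simp add: free_op_mult free_op_schwartz)
  moreover have "weyl_act (wconst z * w) f = (\<lambda>x. z * weyl_act w f x)" if "f \<in> schwartz" for f z w
    using that
    by transfer (simp add: free_op_mult free_op_schwartz free_const_def free_op_single word_op_def)
  moreover have "weyl_act (wgen g) f = rho_gen g f" if "f \<in> schwartz" for f g
    using that by transfer (simp add: free_gen_def free_op_single word_op_def)
  ultimately show ?thesis
    unfolding is_rho_def by simp
qed

text \<open>The Weyl algebra is generated by its scalars and generators, which gives the uniqueness of the
  representation.\<close>

lemma weyl_induct [case_names const gen add mult]:
  assumes const: "\<And>z. P (wconst z)" and gen: "\<And>g. P (wgen g)"
    and add: "\<And>v w. P v \<Longrightarrow> P w \<Longrightarrow> P (v + w)" and mult: "\<And>v w. P v \<Longrightarrow> P w \<Longrightarrow> P (v * w)"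
  shows "P w"
proof -
  have single: "P (abs_weyl (Poly_Mapping.single ws c))" for ws c
  proof (induction ws)
    case Nil
    then show ?case using const[of c] by (simp add: wconst.abs_eq free_const_def)
  next
    case (Cons g ws)
    have "abs_weyl (Poly_Mapping.single (g # ws) c) = wgen g * abs_weyl (Poly_Mapping.single ws c)"
      by (simp add: wgen.abs_eq times_weyl.abs_eq free_gen_def mult_single plus_list_def)
    then show ?case using mult gen Cons by simp
  qed
  have "P (abs_weyl p)" for p
  proof (induction p rule: free_alg_induct)
    case zero
    show ?case using single[of "[]" 0] by simp
  qed (use single add in \<open>auto simp: plus_weyl.abs_eq[symmetric]\<close>)
  moreover obtain p where "w = abs_weyl p"
    by (metis Quotient3_abs_rep Quotient3_weyl)
  ultimately show ?thesis by simp
qed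

lemma
  assumes "is_rho R"
  shows is_rho_extensional: "R w \<in> schwartz \<rightarrow>\<^sub>E schwartz"
    and is_rho_linear: "linear_op schwartz (R w)"
    and is_rho_one: "f \<in> schwartz \<Longrightarrow> R 1 f = f"
    and is_rho_add: "f \<in> schwartz \<Longrightarrow> R (v + w) f = (\<lambda>x. R v f x + R w f x)"
    and is_rho_const_mult: "f \<in> schwartz \<Longrightarrow> R (wconst z * w) f = (\<lambda>x. z * R w f x)"
    and is_rho_mult: "f \<in> schwartz \<Longrightarrow> R (v * w) f = R v (R w f)"
    and is_rho_wgen: "f \<in> schwartz \<Longrightarrow> R (wgen g) f = rho_gen g f"
  using assms unfolding is_rho_def by blast+

lemma is_rho_unique:
  assumes R: "is_rho R" and R': "is_rho R'" shows "R = R'"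
proof -
  have eq: "R w f = R' w f" if "f \<in> schwartz" for w f
    using that
  proof (induction w arbitrary: f rule: weyl_induct)
    case (const z)
    then show ?case
      using is_rho_const_mult[OF R, of f z 1] is_rho_const_mult[OF R', of f z 1]
        is_rho_one[OF R] is_rho_one[OF R'] by simp
  next
    case (mult v w)
    then have "R' w f \<in> schwartz"
      using is_rho_extensional[OF R', of w] by auto
    then show ?case using mult by (simp add: is_rho_mult[OF R] is_rho_mult[OF R'])
  qed (simp_all add: is_rho_add[OF R] is_rho_add[OF R'] is_rho_wgen[OF R] is_rho_wgen[OF R'])
  show ?thesis
  proof (rule ext)
    fix w
    have "R w \<in> extensional schwartz" "R' w \<in> extensional schwartz"
      using is_rho_extensional[OF R] is_rho_extensional[OF R'] by (auto simp: PiE_def)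
    then show "R w = R' w" by (rule extensionalityI) (rule eq)
  qed
qed

lemma is_rho_rho: "is_rho rho"
  unfolding rho_def
  by (rule theI[of is_rho weyl_act]) (auto intro: is_rho_weyl_act is_rho_unique)

lemma rho_schwartz: "f \<in> schwartz \<Longrightarrow> rho w f \<in> schwartz"
  using is_rho_extensional[OF is_rho_rho, of w] by auto

lemmas linear_op_rho = is_rho_linear[OF is_rho_rho]
  and rho_one = is_rho_one[OF is_rho_rho]
  and rho_add = is_rho_add[OF is_rho_rho]
  and rho_const_mult = is_rho_const_mult[OF is_rho_rho]
  and rho_mult = is_rho_mult[OF is_rho_rho]
  and rho_wgen = is_rho_wgen[OF is_rho_rho]

lemma rho_const: "f \<in> schwartz \<Longrightarrow> rho (wconst z) f = (\<lambda>x. z * f x)"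
  using rho_const_mult[of f z 1] rho_one by simp

lemma rho_zero: "f \<in> schwartz \<Longrightarrow> rho 0 f = (\<lambda>x. 0)"
  using rho_add[of f 0 0] by (auto simp: fun_eq_iff)

lemma rho_uminus: "f \<in> schwartz \<Longrightarrow> rho (- w) f = (\<lambda>x. - rho w f x)"
  using rho_add[of f w "- w"] rho_zero[of f] by (auto simp: fun_eq_iff eq_neg_iff_add_eq_0 add.commute)

lemma rho_diff: "f \<in> schwartz \<Longrightarrow> rho (v - w) f = (\<lambda>x. rho v f x - rho w f x)"
  using rho_add[of f v "- w"] by (simp add: rho_uminus)


section \<open>Hermite functions\<close>

lemma hermite_poly_Suc:
  "hermite_poly (Suc n) t = 2 * t * hermite_poly n t - 2 * real n * hermite_poly (n - 1) t"
  by (cases n) auto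

lemma hermite_poly_deriv:
  "(hermite_poly n has_real_derivative 2 * real n * hermite_poly (n - 1) t) (at t)"
proof (induction n arbitrary: t rule: induct_nat_012)
  case 0
  have "hermite_poly 0 = (\<lambda>t. 1)" by auto
  then show ?case by simp
next
  case 1
  have "hermite_poly (Suc 0) = (\<lambda>t. 2 * t)" by auto
  then show ?case by (auto intro!: derivative_eq_intros)
next
  case (ge2 n)
  have eq: "hermite_poly (Suc (Suc n)) = (\<lambda>t. 2 * t * hermite_poly (Suc n) t - 2 * real (Suc n) * hermite_poly n t)"
    by auto
  have "2 * hermite_poly (Suc n) t + 2 * t * (2 * real (Suc n) * hermite_poly n t)
      - 2 * real (Suc n) * (2 * real n * hermite_poly (n - 1) t)
    = 2 * real (Suc (Suc n)) * hermite_poly (Suc n) t"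
    unfolding hermite_poly_Suc[of n] by (simp add: algebra_simps)
  moreover have "((\<lambda>t. 2 * t * hermite_poly (Suc n) t - 2 * real (Suc n) * hermite_poly n t) has_real_derivative
      2 * hermite_poly (Suc n) t + 2 * t * (2 * real (Suc n) * hermite_poly n t)
      - 2 * real (Suc n) * (2 * real n * hermite_poly (n - 1) t)) (at t)"
    using ge2[of t] by (auto intro!: derivative_eq_intros simp del: hermite_poly.simps of_nat_Suc)
  ultimately show ?case unfolding eq by simp
qed

text \<open>The two recursions for Hermite polynomials, in the normalization of Hermite functions.\<close>

lemma hermite_fun_deriv:
  "(hermite_fun n has_real_derivative
    sqrt 2 * sqrt (real n) * hermite_fun (n - 1) t - t * hermite_fun n t) (at t)"
proof -
  define c where "c n = sqrt (2 ^ n * fact n * sqrt pi)" for n :: nat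
  have c: "c n > 0" for n by (simp add: c_def)
  have eq: "hermite_fun n = (\<lambda>t. hermite_poly n t * exp (- t\<^sup>2 / 2) / c n)" for n
    by (auto simp: hermite_fun_def c_def)
  have "2 * real n / c n = sqrt 2 * sqrt (real n) / c (n - 1)"
  proof (cases n)
    case (Suc k)
    have "c (Suc k) = c k * (sqrt 2 * sqrt (real (Suc k)))"
      by (simp add: c_def real_sqrt_mult flip: real_sqrt_mult)
    moreover have "2 * real (Suc k) = (sqrt 2 * sqrt (real (Suc k))) * (sqrt 2 * sqrt (real (Suc k)))"
      by (simp add: mult_ac)
    ultimately show ?thesis using c[of k] Suc by simp
  qed simp
  moreover have "((\<lambda>t. hermite_poly n t * exp (- t\<^sup>2 / 2) / c n) has_real_derivative
      (2 * real n / c n) * (hermite_poly (n - 1) t * exp (- t\<^sup>2 / 2)) - t * (hermite_poly n t * exp (- t\<^sup>2 / 2) / c n)) (at t)"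
    using c[of n] by (auto intro!: derivative_eq_intros hermite_poly_deriv simp: field_simps)
  ultimately show ?thesis unfolding eq by simp
qed

lemma hermite_fun_Suc:
  "sqrt 2 * t * hermite_fun n t = sqrt (real n) * hermite_fun (n - 1) t + sqrt (real (Suc n)) * hermite_fun (Suc n) t"
proof -
  define c where "c n = sqrt (2 ^ n * fact n * sqrt pi)" for n :: nat
  define E where "E = exp (- t\<^sup>2 / 2)"
  have c: "c n > 0" for n by (simp add: c_def)
  have eq: "hermite_fun n t = hermite_poly n t * E / c n" for n
    by (auto simp: hermite_fun_def c_def E_def)
  have cS: "c (Suc k) = c k * (sqrt 2 * sqrt (real (Suc k)))" for k
    by (simp add: c_def flip: real_sqrt_mult)
  have 1: "sqrt (real (Suc n)) * hermite_fun (Suc n) t = hermite_poly (Suc n) t * E / (sqrt 2 * c n)"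
    unfolding eq cS using c[of n] by (simp add: field_simps)
  have 2: "sqrt (real n) * hermite_fun (n - 1) t = 2 * real n * hermite_poly (n - 1) t * E / (sqrt 2 * c n)"
  proof (cases n)
    case (Suc k)
    have "2 * real (Suc k) = (sqrt 2 * sqrt (real (Suc k))) * (sqrt 2 * sqrt (real (Suc k)))"
      by (simp add: mult_ac)
    with c[of k] Suc show ?thesis unfolding eq Suc cS by (simp add: field_simps)
  qed simp
  have s2: "sqrt 2 * sqrt 2 = (2::real)" by simp
  show ?thesis
    unfolding 1 2 unfolding hermite_poly_Suc eq using c[of n] s2 by (simp add: field_simps)
qed

lemma partial_product:
  fixes x :: "real^3"
  assumes "(u has_real_derivative d) (at (x $ i))"
    and "\<And>t. v (x + t *\<^sub>R axis i 1) = v x"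
  shows "partial i (\<lambda>x. of_real (u (x $ i) * v x)) x = of_real (d * v x)"
proof (rule partial_eqI)
  have "((\<lambda>t. u (x $ i + t)) has_real_derivative d) (at 0)"
    using assms(1) DERIV_at_within_shift[of u d "x $ i" 0 UNIV] by (simp add: add.commute)
  then have "((\<lambda>t. u (x $ i + t) * v x) has_real_derivative d * v x) (at 0)"
    by (rule DERIV_cmult_right)
  then have "((\<lambda>t. of_real (u (x $ i + t) * v x) :: complex) has_vector_derivative of_real (d * v x)) (at 0)"
    by (intro has_vector_derivative_of_real) (simp add: has_real_derivative_iff_has_vector_derivative)
  then show "((\<lambda>t. of_real (u ((x + t *\<^sub>R axis i 1) $ i) * v (x + t *\<^sub>R axis i 1)) :: complex)
      has_vector_derivative of_real (d * v x)) (at 0)"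
    by (simp add: assms(2) vector_add_component axis_nth)
qed

text \<open>The functions \<open>v\<close> that are constant in direction \<open>i\<close> stand for the other two factors of a
  three-dimensional Hermite function.\<close>

lemma ladder_product:
  fixes v :: "real^3 \<Rightarrow> real"
  assumes "\<And>x t. v (x + t *\<^sub>R axis i 1) = v x"
  shows "lower i (\<lambda>x. of_real (hermite_fun n (x $ i) * v x))
      = (\<lambda>x. of_real (sqrt (real n)) * of_real (hermite_fun (n - 1) (x $ i) * v x))"
    and "raise i (\<lambda>x. of_real (hermite_fun n (x $ i) * v x))
      = (\<lambda>x. of_real (sqrt (real (Suc n))) * of_real (hermite_fun (Suc n) (x $ i) * v x))"
proof -
  have s: "sqrt 2 * (sqrt 2 * a) = 2 * a" for a :: real
    by (simp flip: mult.assoc)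
  have d: "partial i (\<lambda>x. of_real (hermite_fun n (x $ i) * v x)) x =
      of_real ((sqrt 2 * sqrt (real n) * hermite_fun (n - 1) (x $ i) - x $ i * hermite_fun n (x $ i)) * v x)" for x
    by (rule partial_product[OF hermite_fun_deriv assms])
  show "lower i (\<lambda>x. of_real (hermite_fun n (x $ i) * v x))
      = (\<lambda>x. of_real (sqrt (real n)) * of_real (hermite_fun (n - 1) (x $ i) * v x))"
    unfolding lower_def[abs_def] d of_real_mult[symmetric] of_real_add[symmetric] of_real_eq_iff fun_eq_iff
    by (simp add: algebra_simps)
  have "x $ i * hermite_fun n (x $ i) - (sqrt 2 * sqrt (real n) * hermite_fun (n - 1) (x $ i) - x $ i * hermite_fun n (x $ i))
      = sqrt 2 * (sqrt (real (Suc n)) * hermite_fun (Suc n) (x $ i))" for x :: "real^3"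
    using arg_cong[OF hermite_fun_Suc[of "x $ i" n], of "\<lambda>z. sqrt 2 * z"]
    by (simp add: distrib_left s mult.assoc)
  then have *: "1 / sqrt 2 * (x $ i * (hermite_fun n (x $ i) * v x) - (sqrt 2 * sqrt (real n) * hermite_fun (n - 1) (x $ i) - x $ i * hermite_fun n (x $ i)) * v x)
      = sqrt (real (Suc n)) * (hermite_fun (Suc n) (x $ i) * v x)" for x :: "real^3"
    by (simp add: mult.assoc[symmetric] left_diff_distrib[symmetric])
  show "raise i (\<lambda>x. of_real (hermite_fun n (x $ i) * v x))
      = (\<lambda>x. of_real (sqrt (real (Suc n))) * of_real (hermite_fun (Suc n) (x $ i) * v x))"
    unfolding raise_def[abs_def] d of_real_mult[symmetric] of_real_diff[symmetric] * ..
qed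

lemma lower_hermite:
  "lower 1 (hermite (n1, n2, n3)) = (\<lambda>x. of_real (sqrt (real n1)) * hermite (n1 - 1, n2, n3) x)"
  "lower 2 (hermite (n1, n2, n3)) = (\<lambda>x. of_real (sqrt (real n2)) * hermite (n1, n2 - 1, n3) x)"
  "lower 3 (hermite (n1, n2, n3)) = (\<lambda>x. of_real (sqrt (real n3)) * hermite (n1, n2, n3 - 1) x)"
  and raise_hermite:
  "raise 1 (hermite (n1, n2, n3)) = (\<lambda>x. of_real (sqrt (real (Suc n1))) * hermite (Suc n1, n2, n3) x)"
  "raise 2 (hermite (n1, n2, n3)) = (\<lambda>x. of_real (sqrt (real (Suc n2))) * hermite (n1, Suc n2, n3) x)"
  "raise 3 (hermite (n1, n2, n3)) = (\<lambda>x. of_real (sqrt (real (Suc n3))) * hermite (n1, n2, Suc n3) x)"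
proof -
  have h: "hermite (k1, k2, k3) = (\<lambda>x. of_real (hermite_fun k1 (x $ 1) * (hermite_fun k2 (x $ 2) * hermite_fun k3 (x $ 3))))"
    "hermite (k1, k2, k3) = (\<lambda>x. of_real (hermite_fun k2 (x $ 2) * (hermite_fun k1 (x $ 1) * hermite_fun k3 (x $ 3))))"
    "hermite (k1, k2, k3) = (\<lambda>x. of_real (hermite_fun k3 (x $ 3) * (hermite_fun k1 (x $ 1) * hermite_fun k2 (x $ 2))))"
    for k1 k2 k3 by (simp_all add: fun_eq_iff mult_ac)
  show "lower 1 (hermite (n1, n2, n3)) = (\<lambda>x. of_real (sqrt (real n1)) * hermite (n1 - 1, n2, n3) x)"
    "raise 1 (hermite (n1, n2, n3)) = (\<lambda>x. of_real (sqrt (real (Suc n1))) * hermite (Suc n1, n2, n3) x)"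
    unfolding h(1) by (rule ladder_product; simp add: axis_def)+
  show "lower 2 (hermite (n1, n2, n3)) = (\<lambda>x. of_real (sqrt (real n2)) * hermite (n1, n2 - 1, n3) x)"
    "raise 2 (hermite (n1, n2, n3)) = (\<lambda>x. of_real (sqrt (real (Suc n2))) * hermite (n1, Suc n2, n3) x)"
    unfolding h(2) by (rule ladder_product; simp add: axis_def)+
  show "lower 3 (hermite (n1, n2, n3)) = (\<lambda>x. of_real (sqrt (real n3)) * hermite (n1, n2, n3 - 1) x)"
    "raise 3 (hermite (n1, n2, n3)) = (\<lambda>x. of_real (sqrt (real (Suc n3))) * hermite (n1, n2, Suc n3) x)"
    unfolding h(3) by (rule ladder_product; simp add: axis_def)+
qed

text \<open>Hermite functions arise from the Gaussian by raising, so it suffices to show that the Gaussian is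
  a Schwartz function. Its polynomial multiples are closed under partial derivatives and decay rapidly.\<close>

definition gaussian :: wavefun
  where "gaussian x = of_real (exp (- (x \<bullet> x) / 2))"

inductive_set gaussian_poly :: "wavefun set" where
  gaussian: "gaussian \<in> gaussian_poly"
| linear: "f \<in> gaussian_poly \<Longrightarrow> g \<in> gaussian_poly \<Longrightarrow> (\<lambda>x. c * f x + d * g x) \<in> gaussian_poly"
| coordinate: "f \<in> gaussian_poly \<Longrightarrow> (\<lambda>x. of_real (x $ i) * f x) \<in> gaussian_poly"

lemma gaussian_differentiable: "gaussian differentiable (at x)"
proof -
  have "((\<lambda>x. exp (- (x \<bullet> x) / 2)) has_derivative (\<lambda>h. - (x \<bullet> h) * exp (- (x \<bullet> x) / 2))) (at x)"
    by (auto intro!: derivative_eq_intros simp: inner_commute)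
  from has_derivative_of_real[OF this] show ?thesis
    unfolding differentiable_def gaussian_def[abs_def] by blast
qed

lemma partial_gaussian: "partial i gaussian x = - of_real (x $ i) * gaussian x"
proof (rule partial_eqI)
  have e: "(x + t *\<^sub>R axis i 1) \<bullet> (x + t *\<^sub>R axis i 1) = x \<bullet> x + 2 * t * x $ i + t\<^sup>2" for t
    by (simp add: inner_add_left inner_add_right inner_axis inner_axis' power2_eq_square inner_axis_axis distrib_left)
  have "((\<lambda>t. exp (- (x \<bullet> x + 2 * t * x $ i + t\<^sup>2) / 2)) has_real_derivative - (x $ i) * exp (- (x \<bullet> x) / 2)) (at 0)"
    by (auto intro!: derivative_eq_intros)
  then have "((\<lambda>t. of_real (exp (- (x \<bullet> x + 2 * t * x $ i + t\<^sup>2) / 2)) :: complex) has_vector_derivative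
      of_real (- (x $ i) * exp (- (x \<bullet> x) / 2))) (at 0)"
    by (intro has_vector_derivative_of_real) (simp add: has_real_derivative_iff_has_vector_derivative)
  then show "((\<lambda>t. gaussian (x + t *\<^sub>R axis i 1)) has_vector_derivative - of_real (x $ i) * gaussian x) (at 0)"
    unfolding gaussian_def e by simp
qed

lemma gaussian_decay: "\<exists>C. \<forall>x. norm x ^ k * norm (gaussian x) \<le> C"
proof -
  have "u ^ k * exp (- (u * u) / 2) \<le> fact k * exp (1 / 2)" if u: "0 \<le> u" for u :: real
  proof -
    have "sum (\<lambda>n. u ^ n /\<^sub>R fact n) {k} \<le> suminf (\<lambda>n. u ^ n /\<^sub>R fact n)"
      using exp_converges[of u] u by (intro sum_le_suminf) (auto simp: sums_iff)
    then have "sum (\<lambda>n. u ^ n /\<^sub>R fact n) {k} \<le> exp u"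
      using exp_converges[of u] by (simp add: sums_iff)
    then have "u ^ k \<le> fact k * exp u" by (simp add: field_simps)
    then have "u ^ k * exp (- (u * u) / 2) \<le> fact k * exp u * exp (- (u * u) / 2)"
      by (intro mult_right_mono) auto
    also have "\<dots> = fact k * exp (u - u * u / 2)" by (simp add: mult.assoc flip: exp_add)
    (* Completing the square: u - u^2/2 is at most 1/2. *)
    also have "\<dots> \<le> fact k * exp (1 / 2)"
      using zero_le_square[of "u - 1"] by (simp add: algebra_simps)
    finally show ?thesis .
  qed
  from this[of "norm x" for x :: "real^3"] show ?thesis
    by (auto simp: gaussian_def norm_mult power2_eq_square simp flip: power2_norm_eq_inner)
qed

lemma gaussian_schwartz: "gaussian \<in> schwartz"
proof (rule schwartz_coinduct[OF gaussian_poly.gaussian])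
  fix f assume "f \<in> gaussian_poly"
  then have *: "(\<forall>x. f differentiable (at x)) \<and> (\<forall>k. \<exists>C. \<forall>x. norm x ^ k * norm (f x) \<le> C) \<and>
      (\<forall>i. partial i f \<in> gaussian_poly)"
  proof induction
    case gaussian
    have "partial i gaussian \<in> gaussian_poly" for i
      using gaussian_poly.linear[OF gaussian_poly.coordinate gaussian_poly.gaussian, of gaussian "-1" i 0]
      by (simp add: partial_gaussian[abs_def] gaussian_poly.gaussian)
    then show ?case using gaussian_differentiable gaussian_decay by blast
  next
    case (linear f g c d)
    have "partial i (\<lambda>x. c * f x + d * g x) = (\<lambda>x. c * partial i f x + d * partial i g x)" for i
      using linear by (auto simp: partial_linear)
    then have "partial i (\<lambda>x. c * f x + d * g x) \<in> gaussian_poly" for i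
      using linear gaussian_poly.linear by simp
    moreover have "(\<lambda>x. c * f x + d * g x) differentiable (at x)" for x
      by (rule differentiable_add; rule differentiable_mult) (use linear in auto)
    ultimately show ?case using linear decay_linear by simp
  next
    case (coordinate f j)
    have "partial i (\<lambda>x. of_real (x $ j) * f x) =
        (\<lambda>x. (if i = j then 1 else 0) * f x + 1 * (of_real (x $ j) * partial i f x))" for i
      using coordinate by (auto simp: partial_coordinate)
    moreover have "(\<lambda>x. (if i = j then 1 else 0) * f x + 1 * (of_real (x $ j) * partial i f x)) \<in> gaussian_poly" for i
      by (intro gaussian_poly.linear gaussian_poly.coordinate) (use coordinate in auto)
    ultimately have "partial i (\<lambda>x. of_real (x $ j) * f x) \<in> gaussian_poly" for i
      by simp
    moreover have "(\<lambda>x. of_real (x $ j) * f x) differentiable (at x)" for x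
      by (rule differentiable_mult[OF coordinate_differentiable]) (use coordinate in auto)
    ultimately show ?case using coordinate decay_coordinate[of f] by simp
  qed
  show "f differentiable (at x)" "\<exists>C. \<forall>x. norm x ^ k * norm (f x) \<le> C" "partial i f \<in> gaussian_poly" for x k i
    using * by blast+
qed

lemma hermite_0: "hermite (0, 0, 0) = (\<lambda>x. of_real (1 / sqrt (sqrt pi) ^ 3) * gaussian x)"
proof
  fix x :: "real^3"
  have e: "exp (- (x $ 1)\<^sup>2 / 2) * (exp (- (x $ 2)\<^sup>2 / 2) * exp (- (x $ 3)\<^sup>2 / 2)) = exp (- (x \<bullet> x) / 2)"
    unfolding exp_add[symmetric] by (simp add: inner_vec_def sum_3 power2_eq_square field_simps)
  have h0: "hermite_fun 0 t = 1 / sqrt (sqrt pi) * exp (- t\<^sup>2 / 2)" for t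
    by (simp add: hermite_fun_def)
  have "hermite_fun 0 (x $ 1) * hermite_fun 0 (x $ 2) * hermite_fun 0 (x $ 3)
      = 1 / sqrt (sqrt pi) ^ 3 * exp (- (x \<bullet> x) / 2)"
    unfolding h0 e[symmetric] by (simp add: power3_eq_cube)
  then show "hermite (0, 0, 0) x = of_real (1 / sqrt (sqrt pi) ^ 3) * gaussian x"
    unfolding gaussian_def hermite.simps of_real_mult[symmetric] by simp
qed

lemma raise_hermite_inverse:
  "hermite (Suc n1, n2, n3) = (\<lambda>x. inverse (of_real (sqrt (real (Suc n1)))) * raise 1 (hermite (n1, n2, n3)) x)"
  "hermite (n1, Suc n2, n3) = (\<lambda>x. inverse (of_real (sqrt (real (Suc n2)))) * raise 2 (hermite (n1, n2, n3)) x)"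
  "hermite (n1, n2, Suc n3) = (\<lambda>x. inverse (of_real (sqrt (real (Suc n3)))) * raise 3 (hermite (n1, n2, n3)) x)"
  unfolding raise_hermite by (simp_all add: fun_eq_iff del: of_nat_Suc hermite.simps)

lemma hermite_schwartz: "hermite n \<in> schwartz"
proof -
  have h3: "hermite (0, 0, n3) \<in> schwartz" for n3
  proof (induction n3)
    case 0
    show ?case unfolding hermite_0 by (rule schwartz_cmult[OF gaussian_schwartz])
  next
    case (Suc n3)
    show ?case unfolding raise_hermite_inverse(3) by (rule schwartz_cmult[OF raise_schwartz[OF Suc]])
  qed
  have h2: "hermite (0, n2, n3) \<in> schwartz" for n2 n3
  proof (induction n2)
    case 0
    show ?case by (rule h3)
  next
    case (Suc n2)
    show ?case unfolding raise_hermite_inverse(2) by (rule schwartz_cmult[OF raise_schwartz[OF Suc]])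
  qed
  have h1: "hermite (n1, n2, n3) \<in> schwartz" for n1 n2 n3
  proof (induction n1)
    case 0
    show ?case by (rule h2)
  next
    case (Suc n1)
    show ?case unfolding raise_hermite_inverse(1) by (rule schwartz_cmult[OF raise_schwartz[OF Suc]])
  qed
  show ?thesis by (cases n) (simp only: h1)
qed


section \<open>The truncated Hilbert space\<close>

text \<open>Nonvanishing propagates upwards from the Gaussian, since lowering maps each Hermite function to
  a nonzero multiple of the one below.\<close>

lemma neq_0_by_lower:
  assumes "lower i h = (\<lambda>x. of_real (sqrt (real (Suc k))) * f x)" "f \<noteq> (\<lambda>x. 0)"
  shows "h \<noteq> (\<lambda>x. 0)"
proof
  assume "h = (\<lambda>x. 0)"
  moreover have "lower i (\<lambda>x. 0) = (\<lambda>x. 0)"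
    using lower_linear[OF gaussian_schwartz gaussian_schwartz, of i 0 0] by simp
  ultimately have "of_real (sqrt (real (Suc k))) * f x = 0" for x
    using assms(1) by (metis (no_types, lifting))
  then show False using assms(2) by (auto simp: fun_eq_iff simp del: of_nat_Suc)
qed

lemma hermite_neq_0: "hermite n \<noteq> (\<lambda>x. 0)"
proof -
  have h3: "hermite (0, 0, n3) \<noteq> (\<lambda>x. 0)" for n3
  proof (induction n3)
    case 0
    have "hermite (0, 0, 0) 0 \<noteq> 0" unfolding hermite_0 gaussian_def by simp
    then show ?case by (auto simp del: hermite.simps)
  next
    case (Suc n3)
    then show ?case by (rule neq_0_by_lower[OF lower_hermite(3)[of 0 0 "Suc n3", simplified diff_Suc_1]])
  qed
  have h2: "hermite (0, n2, n3) \<noteq> (\<lambda>x. 0)" for n2 n3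
  proof (induction n2)
    case 0
    show ?case by (rule h3)
  next
    case (Suc n2)
    then show ?case by (rule neq_0_by_lower[OF lower_hermite(2)[of 0 "Suc n2", simplified diff_Suc_1]])
  qed
  have h1: "hermite (n1, n2, n3) \<noteq> (\<lambda>x. 0)" for n1 n2 n3
  proof (induction n1)
    case 0
    show ?case by (rule h2)
  next
    case (Suc n1)
    then show ?case by (rule neq_0_by_lower[OF lower_hermite(1)[of "Suc n1", simplified diff_Suc_1]])
  qed
  show ?thesis by (cases n) (simp only: h1 not_False_eq_True)
qed

declare hermite.simps [simp del]

lemma hermite_inner_self: "l2_inner (hermite n) (hermite n) \<noteq> 0"
  using l2_norm_eq_0_imp[OF hermite_schwartz[of n]] hermite_neq_0[of n] by (auto simp: l2_inner_self)

lemma lower_cmult: "f \<in> schwartz \<Longrightarrow> lower i (\<lambda>x. c * f x) = (\<lambda>x. c * lower i f x)"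
  using lower_linear[of f f i c 0] by simp

lemma raise_cmult: "f \<in> schwartz \<Longrightarrow> raise i (\<lambda>x. c * f x) = (\<lambda>x. c * raise i f x)"
  using raise_linear[of f f i c 0] by simp

lemma sqrt_mult_cancel: "complex_of_real (sqrt (real n)) * (complex_of_real (sqrt (real n)) * z) = of_nat n * z"
proof -
  have "complex_of_real (sqrt (real n)) * complex_of_real (sqrt (real n)) = of_nat n"
    unfolding of_real_mult[symmetric] by simp
  then show ?thesis by (simp only: mult.assoc[symmetric])
qed

lemma number_hermite:
  "raise 1 (lower 1 (hermite (n1, n2, n3))) = (\<lambda>x. of_nat n1 * hermite (n1, n2, n3) x)"
  "raise 2 (lower 2 (hermite (n1, n2, n3))) = (\<lambda>x. of_nat n2 * hermite (n1, n2, n3) x)"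
  "raise 3 (lower 3 (hermite (n1, n2, n3))) = (\<lambda>x. of_nat n3 * hermite (n1, n2, n3) x)"
proof -
  show "raise 1 (lower 1 (hermite (n1, n2, n3))) = (\<lambda>x. of_nat n1 * hermite (n1, n2, n3) x)"
    unfolding lower_hermite raise_cmult[OF hermite_schwartz] raise_hermite
    by (cases n1) (simp_all only: sqrt_mult_cancel diff_Suc_1, simp)
  show "raise 2 (lower 2 (hermite (n1, n2, n3))) = (\<lambda>x. of_nat n2 * hermite (n1, n2, n3) x)"
    unfolding lower_hermite raise_cmult[OF hermite_schwartz] raise_hermite
    by (cases n2) (simp_all only: sqrt_mult_cancel diff_Suc_1, simp)
  show "raise 3 (lower 3 (hermite (n1, n2, n3))) = (\<lambda>x. of_nat n3 * hermite (n1, n2, n3) x)"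
    unfolding lower_hermite raise_cmult[OF hermite_schwartz] raise_hermite
    by (cases n3) (simp_all only: sqrt_mult_cancel diff_Suc_1, simp)
qed

lemma number_orthogonal:
  assumes f: "f \<in> schwartz" "raise i (lower i f) = (\<lambda>x. of_nat a * f x)"
    and g: "g \<in> schwartz" "raise i (lower i g) = (\<lambda>x. of_nat b * g x)"
    and "a \<noteq> b"
  shows "l2_inner f g = 0"
proof -
  have "of_nat a * l2_inner f g = l2_inner (raise i (lower i f)) g"
    using l2_inner_linear_left[OF g(1) f(1) f(1), of "of_nat a" 0] f(2) by simp
  also have "\<dots> = l2_inner (lower i f) (lower i g)"
    by (intro l2_inner_raise lower_schwartz f(1) g(1))
  also have "\<dots> = l2_inner f (raise i (lower i g))"
    by (intro l2_inner_lower lower_schwartz f(1) g(1))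
  also have "\<dots> = of_nat b * l2_inner f g"
    using l2_inner_linear_right[OF f(1) g(1) g(1), of "of_nat b" 0] g(2) by simp
  finally show ?thesis using \<open>a \<noteq> b\<close> by simp
qed

text \<open>Distinct Hermite functions have different eigenvalues for one of the three symmetric operators
  \<open>raise i \<circ> lower i\<close>.\<close>

lemma hermite_orthogonal:
  assumes "n \<noteq> k" shows "l2_inner (hermite n) (hermite k) = 0"
proof -
  obtain n1 n2 n3 where n: "n = (n1, n2, n3)" by (cases n)
  obtain k1 k2 k3 where k: "k = (k1, k2, k3)" by (cases k)
  consider "n1 \<noteq> k1" | "n2 \<noteq> k2" | "n3 \<noteq> k3" using assms n k by auto
  then show ?thesis
    unfolding n k
    by cases (rule number_orthogonal[OF hermite_schwartz number_hermite(1) hermite_schwartz number_hermite(1)]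
        number_orthogonal[OF hermite_schwartz number_hermite(2) hermite_schwartz number_hermite(2)]
        number_orthogonal[OF hermite_schwartz number_hermite(3) hermite_schwartz number_hermite(3)]; assumption)+
qed

lemma hermite_inner_sum:
  assumes "finite I"
  shows "l2_inner (hermite k) (\<lambda>x. \<Sum>n\<in>I. c n * hermite n x)
    = (if k \<in> I then c k * l2_inner (hermite k) (hermite k) else 0)"
proof -
  have "l2_inner (hermite k) (\<lambda>x. \<Sum>n\<in>I. c n * hermite n x)
      = (\<Sum>n\<in>I. c n * l2_inner (hermite k) (hermite n))"
    by (intro l2_inner_sum_right assms hermite_schwartz)
  also have "\<dots> = (\<Sum>n\<in>I. if k = n then c n * l2_inner (hermite k) (hermite n) else 0)"
    by (intro sum.cong) (auto simp: hermite_orthogonal)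
  finally show ?thesis using assms by simp
qed

lemma finite_Hidx: "finite (Hidx m)"
proof (rule finite_subset)
  show "Hidx m \<subseteq> {..m} \<times> {..m} \<times> {..m}" by (auto simp: Hidx_def)
qed simp

text \<open>Names the linear combination of Hermite functions with given coefficients, so that operators
  on \<open>Hm m\<close> become operators on coefficients.\<close>

definition comb :: "nat \<Rightarrow> (nat \<times> nat \<times> nat \<Rightarrow> complex) \<Rightarrow> wavefun"
  where "comb m c x = (\<Sum>n\<in>Hidx m. c n * hermite n x)"

lemma Hm_eq: "Hm m = range (comb m)"
  unfolding Hm_def comb_def[abs_def] by auto

lemma comb_Hm: "comb m c \<in> Hm m"
  by (simp add: Hm_eq)

lemma Hm_cases:
  assumes "f \<in> Hm m" obtains c where "f = comb m c"
  using assms by (auto simp: Hm_eq)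

lemma Hm_schwartz: "f \<in> Hm m \<Longrightarrow> f \<in> schwartz"
  unfolding Hm_eq comb_def[abs_def]
  by (auto intro!: schwartz_sum[OF finite_Hidx _ hermite_schwartz] schwartz_cmult hermite_schwartz)

lemma Hm_linear:
  assumes "f \<in> Hm m" "g \<in> Hm m"
  shows "(\<lambda>x. y * f x + z * g x) \<in> Hm m"
proof -
  obtain c d where f: "f = comb m c" and g: "g = comb m d" using assms by (meson Hm_cases)
  have "(\<lambda>x. y * f x + z * g x) = comb m (\<lambda>n. y * c n + z * d n)"
    unfolding f g comb_def by (auto simp: sum_distrib_left sum.distrib algebra_simps)
  then show ?thesis by (simp add: comb_Hm)
qed

lemma Hm_zero: "(\<lambda>x. 0) \<in> Hm m"
proof -
  have "(\<lambda>x. 0) = comb m (\<lambda>_. 0)" by (auto simp: comb_def)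
  then show ?thesis by (simp add: comb_Hm)
qed

lemma Hm_cmult: "f \<in> Hm m \<Longrightarrow> (\<lambda>x. z * f x) \<in> Hm m"
  using Hm_linear[of f m f z 0] by simp

lemma Hm_add: "f \<in> Hm m \<Longrightarrow> g \<in> Hm m \<Longrightarrow> (\<lambda>x. f x + g x) \<in> Hm m"
  using Hm_linear[of f m g 1 1] by simp

lemma Hm_sum: "finite I \<Longrightarrow> (\<And>i. i \<in> I \<Longrightarrow> f i \<in> Hm m) \<Longrightarrow> (\<lambda>x. \<Sum>i\<in>I. f i x) \<in> Hm m"
  by (induction I rule: finite_induct) (auto intro: Hm_zero Hm_add)

lemma hermite_Hm: "n \<in> Hidx m \<Longrightarrow> hermite n \<in> Hm m"
proof -
  assume "n \<in> Hidx m"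
  then have "hermite n = comb m (\<lambda>k. if k = n then 1 else 0)"
    unfolding comb_def using finite_Hidx by (auto simp: if_distrib[of "\<lambda>z. z * _"] sum.delta cong: if_cong)
  then show ?thesis by (simp add: comb_Hm)
qed

lemma linear_op_comb:
  assumes "linear_op schwartz T"
  shows "T (comb m c) = (\<lambda>x. \<Sum>n\<in>Hidx m. c n * T (hermite n) x)"
  unfolding comb_def[abs_def]
  by (intro linear_op_sum[OF assms hermite_schwartz finite_Hidx] hermite_schwartz)

lemma linear_op_Hm:
  assumes "linear_op schwartz T" "\<And>n. n \<in> Hidx m \<Longrightarrow> T (hermite n) \<in> Hm m" "f \<in> Hm m"
  shows "T f \<in> Hm m"
proof -
  obtain c where f: "f = comb m c" using assms(3) by (rule Hm_cases)
  show ?thesis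
    unfolding f linear_op_comb[OF assms(1)] by (intro Hm_sum finite_Hidx Hm_cmult assms(2))
qed

text \<open>Hermite functions are linearly independent, being orthogonal and nonzero.\<close>

lemma comb_inject:
  assumes "comb m c = comb m d" "n \<in> Hidx m" shows "c n = d n"
proof -
  have "l2_inner (hermite n) (comb m c) = l2_inner (hermite n) (comb m d)" using assms(1) by simp
  then show ?thesis
    using assms(2) hermite_inner_self[of n] hermite_inner_sum[OF finite_Hidx]
    unfolding comb_def[abs_def] by simp
qed

lemma hermite_coeff_comb:
  assumes "n \<in> Hidx m" shows "hermite_coeff m (comb m c) n = c n"
proof -
  define c' where "c' n = (if n \<in> Hidx m then c n else 0)" for n
  have eq: "comb m c = comb m c'"
    unfolding comb_def c'_def by (intro ext sum.cong) auto
  have "hermite_coeff m (comb m c) = c'"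
    unfolding hermite_coeff_def
  proof (rule the_equality)
    show "(\<forall>n. n \<notin> Hidx m \<longrightarrow> c' n = 0) \<and> comb m c = (\<lambda>x. \<Sum>n\<in>Hidx m. c' n * hermite n x)"
      using eq by (auto simp: c'_def comb_def[abs_def])
    fix d assume d: "(\<forall>n. n \<notin> Hidx m \<longrightarrow> d n = 0) \<and> comb m c = (\<lambda>x. \<Sum>n\<in>Hidx m. d n * hermite n x)"
    then have "comb m c' = comb m d" using eq by (simp add: comb_def[abs_def])
    then show "d = c'" using comb_inject d by (fastforce simp: c'_def)
  qed
  then show ?thesis using assms by (simp add: c'_def)
qed

text \<open>The eigenvalues of \<open>rho_S m\<close>; for an index in \<open>Hidx m\<close> and \<open>m > 0\<close> the argument of the square root is
  nonnegative.\<close>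

fun S_eig :: "nat \<Rightarrow> nat \<times> nat \<times> nat \<Rightarrow> real"
  where "S_eig m (n1, n2, n3) = sqrt (real m - real n1 - real n2 - real n3 - 1)"

lemma rho_S_comb: "rho_S m (comb m c) = comb m (\<lambda>n. of_real (S_eig m n) * c n)"
proof -
  have "rho_S m (comb m c) = (\<lambda>x. \<Sum>n\<in>Hidx m. hermite_coeff m (comb m c) n * of_real (S_eig m n) * hermite n x)"
    unfolding rho_S_def using comb_Hm by (auto intro!: sum.cong simp: split_beta)
  also have "\<dots> = comb m (\<lambda>n. of_real (S_eig m n) * c n)"
    unfolding comb_def[of m "\<lambda>n. of_real (S_eig m n) * c n", abs_def]
    by (intro ext sum.cong) (auto simp: hermite_coeff_comb)
  finally show ?thesis .
qed

lemma rho_S_Hm: "f \<in> Hm m \<Longrightarrow> rho_S m f \<in> Hm m"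
  by (auto elim!: Hm_cases simp: rho_S_comb comb_Hm)

lemma linear_op_rho_S: "linear_op (Hm m) (rho_S m)"
  unfolding linear_op_def
proof (intro ballI allI)
  fix f g y z assume "f \<in> Hm m" "g \<in> Hm m"
  then obtain c d where f: "f = comb m c" and g: "g = comb m d" by (meson Hm_cases)
  have "(\<lambda>x. y * comb m c x + z * comb m d x) = comb m (\<lambda>n. y * c n + z * d n)" for c d
    unfolding comb_def by (auto simp: sum_distrib_left sum.distrib algebra_simps)
  then show "rho_S m (\<lambda>x. y * f x + z * g x) = (\<lambda>x. y * rho_S m f x + z * rho_S m g x)"
    by (simp add: f g rho_S_comb algebra_simps)
qed

lemma comb_inner:
  "l2_inner (comb m c) (comb m d) = (\<Sum>n\<in>Hidx m. cnj (c n) * d n * l2_inner (hermite n) (hermite n))"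
proof -
  have "l2_inner (comb m c) (comb m d) = (\<Sum>n\<in>Hidx m. cnj (c n) * l2_inner (hermite n) (comb m d))"
    unfolding comb_def[of m c, abs_def]
    by (intro l2_inner_sum_left finite_Hidx hermite_schwartz Hm_schwartz[OF comb_Hm])
  also have "\<dots> = (\<Sum>n\<in>Hidx m. cnj (c n) * d n * l2_inner (hermite n) (hermite n))"
    unfolding comb_def[of m d, abs_def] hermite_inner_sum[OF finite_Hidx] by (intro sum.cong) auto
  finally show ?thesis .
qed

lemma rho_S_selfadjoint:
  assumes "f \<in> Hm m" "g \<in> Hm m"
  shows "l2_inner (rho_S m f) g = l2_inner f (rho_S m g)"
proof -
  obtain c d where f: "f = comb m c" and g: "g = comb m d" using assms by (meson Hm_cases)
  show ?thesis unfolding f g rho_S_comb comb_inner by (intro sum.cong) auto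
qed

lemma lower_Hm:
  assumes "f \<in> Hm m" shows "lower i f \<in> Hm m"
proof (rule linear_op_Hm[OF _ _ assms])
  show "linear_op schwartz (lower i)" by (simp add: linear_op_def lower_linear)
  fix n assume n: "n \<in> Hidx m"
  obtain n1 n2 n3 where [simp]: "n = (n1, n2, n3)" by (cases n)
  have "(n1 - 1, n2, n3) \<in> Hidx m" "(n1, n2 - 1, n3) \<in> Hidx m" "(n1, n2, n3 - 1) \<in> Hidx m"
    using n by (auto simp: Hidx_def)
  then show "lower i (hermite n) \<in> Hm m"
    using exhaust_3[of i] by (auto simp: lower_hermite simp del: hermite.simps intro!: Hm_cmult hermite_Hm)
qed

text \<open>A lowering operator makes room for the raising operator that follows it.\<close>

lemma raise_lower_Hm:
  assumes "f \<in> Hm m" shows "raise i (lower j f) \<in> Hm m"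
proof (rule linear_op_Hm[OF _ _ assms])
  show "linear_op schwartz (\<lambda>f. raise i (lower j f))"
    by (simp add: linear_op_def lower_linear raise_linear lower_schwartz)
  fix n assume n: "n \<in> Hidx m"
  obtain n1 n2 n3 where n': "n = (n1, n2, n3)" by (cases n)
  have ih: "n1 + n2 + n3 \<le> m - 1" using n n' by (auto simp: Hidx_def)
  have raise_Hm: "raise i (hermite (k1, k2, k3)) \<in> Hm m" if "Suc (k1 + k2 + k3) \<le> m - 1" for k1 k2 k3
    using exhaust_3[of i] that
    by (auto simp: raise_hermite Hidx_def simp del: hermite.simps of_nat_Suc intro!: Hm_cmult hermite_Hm)
  have *: "raise i (\<lambda>x. of_real (sqrt (real a)) * hermite (k1, k2, k3) x) \<in> Hm m"
    if "a \<noteq> 0 \<Longrightarrow> Suc (k1 + k2 + k3) \<le> m - 1" for a k1 k2 k3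
    unfolding raise_cmult[OF hermite_schwartz]
    by (cases "a = 0") (auto simp: Hm_zero intro!: Hm_cmult raise_Hm that)
  show "raise i (lower j (hermite n)) \<in> Hm m"
    using exhaust_3[of j] ih unfolding n'
    by (elim disjE) (auto simp: lower_hermite simp del: hermite.simps intro!: *)
qed

lemma S_eig_top: "n \<in> Hidx m \<Longrightarrow> m > 0 \<Longrightarrow> n = (n1, n2, n3) \<Longrightarrow> \<not> Suc (n1 + n2 + n3) \<le> m - 1 \<Longrightarrow> S_eig m n = 0"
proof -
  assume "n \<in> Hidx m" "m > 0" and n: "n = (n1, n2, n3)" and "\<not> Suc (n1 + n2 + n3) \<le> m - 1"
  then have "m = n1 + n2 + n3 + 1" by (auto simp: Hidx_def)
  then show ?thesis by (simp add: n)
qed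

text \<open>Raising may leave \<open>Hm m\<close> only from the top level, on which \<open>rho_S m\<close> vanishes.\<close>

lemma raise_rho_S_Hm:
  assumes "m > 0" "f \<in> Hm m" shows "raise i (rho_S m f) \<in> Hm m"
proof -
  obtain c where f: "f = comb m c" using assms(2) by (rule Hm_cases)
  have lin: "linear_op schwartz (raise i)" by (simp add: linear_op_def raise_linear)
  have "(\<lambda>x. of_real (S_eig m n) * c n * raise i (hermite n) x) \<in> Hm m" if n: "n \<in> Hidx m" for n
  proof -
    obtain n1 n2 n3 where n': "n = (n1, n2, n3)" by (cases n)
    show ?thesis
    proof (cases "Suc (n1 + n2 + n3) \<le> m - 1")
      case True
      then have "raise i (hermite n) \<in> Hm m"
        using exhaust_3[of i] unfolding n'
        by (auto simp: raise_hermite Hidx_def simp del: hermite.simps of_nat_Suc intro!: Hm_cmult hermite_Hm)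
      then show ?thesis by (rule Hm_cmult)
    next
      case False
      then show ?thesis using S_eig_top[OF n assms(1) n'] by (simp add: Hm_zero)
    qed
  qed
  then show ?thesis
    unfolding f rho_S_comb linear_op_comb[OF lin] by (intro Hm_sum finite_Hidx)
qed


section \<open>The binomial series of the square root\<close>

lemma b_coeff_gbinomial: "b_coeff k = (1 / 2 gchoose k) * (- 1) ^ k"
proof -
  have "(\<Prod>l<k. 1 - 2 * real l) = (\<Prod>l<k. 2 * (1 / 2 - real l))"
    by (intro prod.cong) auto
  also have "\<dots> = 2 ^ k * (\<Prod>l<k. 1 / 2 - real l)"
    unfolding prod.distrib by simp
  finally show ?thesis
    by (simp add: b_coeff_def gbinomial_prod_rev atLeast0LessThan)
qed

lemma gbinomial_minus_half_tendsto: "(\<lambda>k. (- 1) ^ k * ((- 1 / 2 :: real) gchoose k)) \<longlonglongrightarrow> 0"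
proof -
  define q where "q k = (- 1) ^ k * ((- 1 / 2 :: real) gchoose k)" for k :: nat
  (* q k is the central binomial coefficient (2k choose k) divided by 4^k. *)
  have rec: "q (Suc k) = q k * ((2 * real k + 1) / (2 * real k + 2))" for k
    by (simp add: q_def gbinomial_Suc_rec field_simps)
  have "q 0 = 1" by (simp add: q_def)
  have bound: "(q k)\<^sup>2 \<le> 1 / (2 * real k + 1)" for k
  proof (induction k)
    case 0
    show ?case using \<open>q 0 = 1\<close> by simp
  next
    case (Suc k)
    have "(q (Suc k))\<^sup>2 = (q k)\<^sup>2 * ((2 * real k + 1) / (2 * real k + 2))\<^sup>2"
      by (simp only: rec power_mult_distrib)
    also have "\<dots> \<le> 1 / (2 * real k + 1) * ((2 * real k + 1) / (2 * real k + 2))\<^sup>2"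
      by (intro mult_right_mono Suc) auto
    also have "\<dots> = (2 * real k + 1) / (2 * real k + 2)\<^sup>2"
      by (simp add: power2_eq_square)
    also have "\<dots> \<le> 1 / (2 * real (Suc k) + 1)"
    proof -
      have "(2 * a + 1) / (2 * a + 2)\<^sup>2 \<le> 1 / (2 * a + 3)" if "a \<ge> 0" for a :: real
      proof -
        have "(2 * a + 1) * (2 * a + 3) \<le> (2 * a + 2)\<^sup>2" by (simp add: power2_eq_square algebra_simps)
        moreover have "0 < 2 * a + 3" "0 < (2 * a + 2)\<^sup>2" using that by auto
        ultimately show ?thesis by (simp only: divide_le_eq le_divide_eq times_divide_eq_left mult_1_left if_True)
      qed
      from this[of "real k"] show ?thesis by (simp add: algebra_simps)
    qed
    finally show ?case .
  qed
  have "(\<lambda>k. (q k)\<^sup>2) \<longlonglongrightarrow> 0"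
  proof (rule tendsto_sandwich[OF _ _ tendsto_const LIMSEQ_inverse_real_of_nat])
    have "1 / (2 * real k + 1) \<le> inverse (real (Suc k))" for k
      by (simp add: inverse_eq_divide frac_le)
    then show "\<forall>\<^sub>F k in sequentially. (q k)\<^sup>2 \<le> inverse (real (Suc k))"
      using order_trans[OF bound] by (intro always_eventually allI) blast
  qed simp
  then have "(\<lambda>k. sqrt ((q k)\<^sup>2)) \<longlonglongrightarrow> sqrt 0" by (rule tendsto_real_sqrt)
  then have "q \<longlonglongrightarrow> 0" by (simp add: tendsto_rabs_zero_iff)
  then show ?thesis by (simp add: q_def[abs_def])
qed

text \<open>The boundary point \<open>x = 1\<close> belongs to the top level of the truncated space. There the radius of
  convergence is reached, and the partial sums are evaluated in closed form instead.\<close>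

lemma b_coeff_series:
  assumes "0 \<le> x" "x \<le> 1"
  shows "(\<lambda>l. \<Sum>k\<le>l. b_coeff k * x ^ k) \<longlonglongrightarrow> sqrt (1 - x)"
proof (cases "x = 1")
  case True
  have "(\<Sum>k\<le>l. b_coeff k * x ^ k) = (- 1) ^ l * ((- 1 / 2) gchoose l)" for l
    using gbinomial_sum_lower_neg[of "1 / 2 :: real" l] by (simp add: True b_coeff_gbinomial)
  then show ?thesis using gbinomial_minus_half_tendsto by (simp add: True)
next
  case False
  then have "(\<lambda>k. (1 / 2 gchoose k) * (- x) ^ k) sums (1 + (- x)) powr (1 / 2)"
    using assms by (intro gen_binomial_real) auto
  moreover have "(1 / 2 gchoose k) * (- x) ^ k = b_coeff k * x ^ k" for k
    using power_mult_distrib[of "-1" x k] by (simp add: b_coeff_gbinomial)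
  ultimately show ?thesis
    using assms by (simp add: sums_def_le powr_half_sqrt)
qed


section \<open>Convergence of the truncations\<close>

lemma rho_sum:
  assumes "finite I" "f \<in> schwartz"
  shows "rho (\<Sum>i\<in>I. w i) f = (\<lambda>x. \<Sum>i\<in>I. rho (w i) f x)"
  using assms(1) by (induction I rule: finite_induct) (simp_all add: rho_zero rho_add assms(2))

lemma rho_power_eigen:
  assumes "f \<in> schwartz" "rho w f = (\<lambda>x. z * f x)"
  shows "rho (w ^ k) f = (\<lambda>x. z ^ k * f x)"
proof (induction k)
  case (Suc k)
  have "rho (w ^ Suc k) f = rho w (\<lambda>x. z ^ k * f x)"
    using Suc by (simp add: rho_mult assms(1))
  also have "\<dots> = (\<lambda>x. z ^ Suc k * f x)"
    unfolding linear_op_cmult[OF linear_op_rho assms(1)] assms(2) by (simp add: mult_ac)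
  finally show ?case .
qed (simp add: rho_one assms(1))

text \<open>The product \<open>lower 2 \<circ> raise 2\<close> in antinormal order contributes the summand \<open>f\<close>, which shifts the
  eigenvalue of \<open>N + n/2\<close> to \<open>level n + 1\<close>.\<close>

lemma rho_N:
  assumes "f \<in> schwartz"
  shows "rho (N_formula wgen) f = (\<lambda>x. raise 3 (lower 3 f) x + raise 2 (lower 2 f) x + f x)"
  using assms
  by (simp add: N_formula_def rho_diff rho_mult rho_wgen lower_schwartz raise_schwartz lower_raise_commute
      algebra_simps)

lemma rho_n:
  assumes "f \<in> schwartz"
  shows "rho (n_formula wconst wgen) f = (\<lambda>x. 2 * raise 1 (lower 1 f) x)"
  using assms
  unfolding n_formula_def mult.assoc rho_const_mult[OF assms]
  by (simp add: rho_mult rho_wgen lower_schwartz)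

fun level :: "nat \<times> nat \<times> nat \<Rightarrow> nat" where "level (n1, n2, n3) = n1 + n2 + n3"

lemma rho_S_coeff_hermite:
  "rho (S_coeff k) (hermite n) = (\<lambda>x. of_real (b_coeff k * (real (level n) + 1) ^ k) * hermite n x)"
proof -
  obtain n1 n2 n3 where n: "n = (n1, n2, n3)" by (cases n)
  have "rho (N_formula wgen + wconst (1 / 2) * n_formula wconst wgen) (hermite n)
      = (\<lambda>x. of_real (real (level n) + 1) * hermite n x)"
    using hermite_schwartz[of n]
    by (simp add: rho_add rho_const_mult rho_N rho_n) (simp add: n number_hermite algebra_simps)
  from rho_power_eigen[OF hermite_schwartz this, of k] show ?thesis
    by (simp add: S_coeff_def rho_const_mult hermite_schwartz mult.assoc)
qed

text \<open>The eigenvalue of \<open>S_trunc (1/m) l\<close> on a Hermite function: \<open>sqrt m\<close> is the prefactor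
  \<open>1 / sqrt \<hbar>\<close>.\<close>

definition S_partial :: "nat \<Rightarrow> nat \<Rightarrow> nat \<times> nat \<times> nat \<Rightarrow> real"
  where "S_partial m l n = sqrt (real m) * (\<Sum>k\<le>l. b_coeff k * ((real (level n) + 1) / real m) ^ k)"

lemma rho_S_trunc_hermite:
  "rho (S_trunc (1 / real m) l) (hermite n) = (\<lambda>x. of_real (S_partial m l n) * hermite n x)"
proof
  fix x
  have c: "rho (S_coeff k * wconst (of_real ((1 / real m) ^ k))) (hermite n) =
      (\<lambda>x. of_real (b_coeff k * ((real (level n) + 1) / real m) ^ k) * hermite n x)" for k
    unfolding rho_mult[OF hermite_schwartz] rho_const[OF hermite_schwartz]
      linear_op_cmult[OF linear_op_rho hermite_schwartz] rho_S_coeff_hermite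
    by (simp add: power_divide)
  have s: "1 / sqrt (1 / real m) = sqrt (real m)" by (simp add: real_sqrt_divide)
  show "rho (S_trunc (1 / real m) l) (hermite n) x = of_real (S_partial m l n) * hermite n x"
    unfolding S_trunc_def S_partial_def rho_const_mult[OF hermite_schwartz] s
      rho_sum[OF finite_atMost hermite_schwartz] c of_real_mult of_real_sum
    by (simp only: sum_distrib_right mult.assoc)
qed

lemma S_partial_tendsto:
  assumes "m > 0" "n \<in> Hidx m"
  shows "(\<lambda>l. S_partial m l n) \<longlonglongrightarrow> S_eig m n"
proof -
  obtain n1 n2 n3 where n: "n = (n1, n2, n3)" by (cases n)
  have le: "real (level n) + 1 \<le> real m" using assms by (auto simp: Hidx_def n)
  have "(\<lambda>l. S_partial m l n) \<longlonglongrightarrow> sqrt (real m) * sqrt (1 - (real (level n) + 1) / real m)"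
    unfolding S_partial_def by (intro tendsto_mult_left b_coeff_series) (use assms(1) le in auto)
  also have "sqrt (real m) * sqrt (1 - (real (level n) + 1) / real m) = S_eig m n"
    using assms(1) by (simp add: n right_diff_distrib diff_diff_eq flip: real_sqrt_mult)
  finally show ?thesis .
qed

text \<open>The error is a finite combination of Hermite functions with coefficients tending to zero. The
  factor \<open>w\<close> accounts for the raising operators that stand to the left of \<open>S\<close> in some of the formulas; being
  fixed and linear, it preserves such limits.\<close>

lemma S_trunc_tendsto:
  assumes "m > 0" "f \<in> Hm m"
  shows "(\<lambda>l. l2_norm (rho w (\<lambda>x. rho (S_trunc (1 / real m) l) f x - rho_S m f x))) \<longlonglongrightarrow> 0"
proof -
  obtain c where f: "f = comb m c" using assms(2) by (rule Hm_cases)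
  have err: "(\<lambda>x. rho (S_trunc (1 / real m) l) f x - rho_S m f x)
      = comb m (\<lambda>n. of_real (S_partial m l n - S_eig m n) * c n)" for l
    unfolding f linear_op_comb[OF linear_op_rho] rho_S_comb rho_S_trunc_hermite comb_def
    by (simp add: sum_subtractf[symmetric] algebra_simps)
  have lim: "(\<lambda>l. of_real (S_partial m l n - S_eig m n) * c n) \<longlonglongrightarrow> 0" if "n \<in> Hidx m" for n
  proof (rule tendsto_mult_left_zero)
    have "(\<lambda>l. S_partial m l n - S_eig m n) \<longlonglongrightarrow> 0"
      using tendsto_diff[OF S_partial_tendsto[OF assms(1) that] tendsto_const, of "S_eig m n"] by simp
    then show "(\<lambda>l. complex_of_real (S_partial m l n - S_eig m n)) \<longlonglongrightarrow> 0"
      using tendsto_of_real by fastforce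
  qed
  show ?thesis
    unfolding err linear_op_comb[OF linear_op_rho]
    by (intro l2_norm_tendsto_sum finite_Hidx rho_schwartz hermite_schwartz lim)
qed


lemma rho_J_formula:
  assumes "f \<in> schwartz"
  shows "rho (J_formula wconst wgen PP) f = (\<lambda>x. 2 * \<i> * raise 3 (lower 2 f) x)"
    and "rho (J_formula wconst wgen PM) f = (\<lambda>x. \<i> * (raise 2 (lower 2 f) x - raise 3 (lower 3 f) x))"
    and "rho (J_formula wconst wgen MM) f = (\<lambda>x. - 2 * \<i> * raise 2 (lower 3 f) x)"
proof -
  note [simp] = rho_mult[OF assms] rho_wgen rho_add[OF assms] assms lower_schwartz raise_schwartz
    raise_uminus schwartz_uminus lower_raise_commute[OF assms]
  show "rho (J_formula wconst wgen PP) f = (\<lambda>x. 2 * \<i> * raise 3 (lower 2 f) x)"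
    unfolding J_formula.simps mult.assoc rho_const_mult[OF assms] by simp
  show "rho (J_formula wconst wgen PM) f = (\<lambda>x. \<i> * (raise 2 (lower 2 f) x - raise 3 (lower 3 f) x))"
    unfolding J_formula.simps rho_const_mult[OF assms] by (simp add: algebra_simps)
  show "rho (J_formula wconst wgen MM) f = (\<lambda>x. - 2 * \<i> * raise 2 (lower 3 f) x)"
    unfolding J_formula.simps mult.assoc rho_const_mult[OF assms] by (simp add: fun_eq_iff)
qed

lemma gen_op_eq: "f \<in> schwartz \<Longrightarrow> gen_op g f = rho_gen g f"
  by (simp add: gen_op_def rho_wgen)

lemma rho_S_uminus: "f \<in> Hm m \<Longrightarrow> rho_S m (\<lambda>x. - f x) = (\<lambda>x. - rho_S m f x)"
  using linear_opD[OF linear_op_rho_S, of f m f "-1" 0] by simp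

text \<open>In terms of ladder operators, the operators \<open>rho_m_basis\<close> visibly come in adjoint pairs.\<close>

lemma rho_m_basis_ladder:
  assumes f: "f \<in> Hm m"
  shows "rho_m_basis m (Jb PP) f = (\<lambda>x. 2 * \<i> * raise 3 (lower 2 f) x)"
    and "rho_m_basis m (Jb PM) f = (\<lambda>x. \<i> * (raise 2 (lower 2 f) x - raise 3 (lower 3 f) x))"
    and "rho_m_basis m (Jb MM) f = (\<lambda>x. - 2 * \<i> * raise 2 (lower 3 f) x)"
    and "rho_m_basis m (Pb Pl Pl) f = (\<lambda>x. - raise 3 (lower 1 f) x - rho_S m (lower 2 f) x)"
    and "rho_m_basis m (Pb Pl Mi) f = (\<lambda>x. raise 3 (rho_S m f) x - raise 1 (lower 2 f) x)"
    and "rho_m_basis m (Pb Mi Pl) f = (\<lambda>x. rho_S m (lower 3 f) x - raise 2 (lower 1 f) x)"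
    and "rho_m_basis m (Pb Mi Mi) f = (\<lambda>x. raise 1 (lower 3 f) x + raise 2 (rho_S m f) x)"
    and "rho_m_basis m (Kb PP) f = (\<lambda>x. - 2 * \<i> * rho_S m (lower 1 f) x)"
    and "rho_m_basis m (Kb PM) f = (\<lambda>x. \<i> * (of_nat m * f x - f x - raise 3 (lower 3 f) x
      - raise 2 (lower 2 f) x - 2 * raise 1 (lower 1 f) x))"
    and "rho_m_basis m (Kb MM) f = (\<lambda>x. 2 * \<i> * raise 1 (rho_S m f) x)"
proof -
  have s: "f \<in> schwartz" by (rule Hm_schwartz[OF f])
  note [simp] = f s gen_op_eq lower_schwartz raise_schwartz schwartz_uminus raise_uminus lower_uminus
    rho_S_uminus lower_Hm lower_raise_commute[OF s] Hm_schwartz[OF rho_S_Hm[OF f]]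
    rho_J_formula[OF s]
  show "rho_m_basis m (Jb PP) f = (\<lambda>x. 2 * \<i> * raise 3 (lower 2 f) x)"
    "rho_m_basis m (Jb PM) f = (\<lambda>x. \<i> * (raise 2 (lower 2 f) x - raise 3 (lower 3 f) x))"
    "rho_m_basis m (Jb MM) f = (\<lambda>x. - 2 * \<i> * raise 2 (lower 3 f) x)"
    "rho_m_basis m (Pb Pl Pl) f = (\<lambda>x. - raise 3 (lower 1 f) x - rho_S m (lower 2 f) x)"
    "rho_m_basis m (Pb Pl Mi) f = (\<lambda>x. raise 3 (rho_S m f) x - raise 1 (lower 2 f) x)"
    "rho_m_basis m (Pb Mi Pl) f = (\<lambda>x. rho_S m (lower 3 f) x - raise 2 (lower 1 f) x)"
    "rho_m_basis m (Pb Mi Mi) f = (\<lambda>x. raise 1 (lower 3 f) x + raise 2 (rho_S m f) x)"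
    "rho_m_basis m (Kb PP) f = (\<lambda>x. - 2 * \<i> * rho_S m (lower 1 f) x)"
    "rho_m_basis m (Kb MM) f = (\<lambda>x. 2 * \<i> * raise 1 (rho_S m f) x)"
    by (simp_all add: fun_eq_iff del: J_formula.simps)
  show "rho_m_basis m (Kb PM) f = (\<lambda>x. \<i> * (of_nat m * f x - f x - raise 3 (lower 3 f) x
      - raise 2 (lower 2 f) x - 2 * raise 1 (lower 1 f) x))"
    by (simp add: fun_eq_iff algebra_simps)
qed

lemma label_cases:
  "b \<in> {Jb PP, Jb PM, Jb MM, Pb Pl Pl, Pb Pl Mi, Pb Mi Pl, Pb Mi Mi, Kb PP, Kb PM, Kb MM}"
proof (cases b)
  case (Jb s) then show ?thesis by (cases s) auto
next
  case (Pb a c) then show ?thesis by (cases a; cases c) auto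
next
  case (Kb s) then show ?thesis by (cases s) auto
qed

lemma UNIV_label:
  "(UNIV :: label set) = {Jb PP, Jb PM, Jb MM, Pb Pl Pl, Pb Pl Mi, Pb Mi Pl, Pb Mi Mi, Kb PP, Kb PM, Kb MM}"
  using label_cases by blast

lemma rho_m_basis_Hm:
  assumes "m > 0" "f \<in> Hm m" shows "rho_m_basis m b f \<in> Hm m"
proof -
  note rules = raise_lower_Hm[OF assms(2)] raise_rho_S_Hm[OF assms] rho_S_Hm[OF lower_Hm[OF assms(2)]]
  have diff: "(\<lambda>x. g x - h x) \<in> Hm m" if "g \<in> Hm m" "h \<in> Hm m" for g h
    using Hm_linear[OF that, of 1 "-1"] by simp
  have uminus: "(\<lambda>x. - g x) \<in> Hm m" if "g \<in> Hm m" for g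
    using Hm_cmult[OF that, of "-1"] by simp
  have "rho_m_basis m (Jb PP) f \<in> Hm m" "rho_m_basis m (Jb PM) f \<in> Hm m" "rho_m_basis m (Jb MM) f \<in> Hm m"
    "rho_m_basis m (Pb Pl Pl) f \<in> Hm m" "rho_m_basis m (Pb Pl Mi) f \<in> Hm m"
    "rho_m_basis m (Pb Mi Pl) f \<in> Hm m" "rho_m_basis m (Pb Mi Mi) f \<in> Hm m"
    "rho_m_basis m (Kb PP) f \<in> Hm m" "rho_m_basis m (Kb PM) f \<in> Hm m" "rho_m_basis m (Kb MM) f \<in> Hm m"
    unfolding rho_m_basis_ladder[OF assms(2)]
    by ((rule diff uminus Hm_cmult Hm_add rules assms(2))+)
  then show ?thesis using label_cases[of b] by auto
qed

lemma rho_m_basis_extensional: "rho_m_basis m b \<in> extensional (Hm m)"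
  by (cases "(m, b)" rule: rho_m_basis.cases) auto

text \<open>The formulas are affine in \<open>S\<close>. The difference of the two operators is therefore the error of
  \<open>S\<close>, applied to \<open>f\<close> or to a lowering of \<open>f\<close> in \<open>Hm m\<close>, and followed by a fixed element \<open>w\<close> of the Weyl
  algebra.\<close>

lemma trunc_tendsto:
  assumes m: "m > 0" and f: "f \<in> Hm m" and b: "\<And>s. b \<noteq> Jb s"
  shows "(\<lambda>l. l2_norm (\<lambda>x. rho (trunc (1 / real m) l b) f x - rho_m_basis m b f x)) \<longlonglongrightarrow> 0"
proof -
  have s: "f \<in> schwartz" by (rule Hm_schwartz[OF f])
  define R where "R l = rho (S_trunc (1 / real m) l)" for l
  have R: "R l g \<in> schwartz" if "g \<in> schwartz" for l g
    unfolding R_def by (rule rho_schwartz[OF that])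
  note [simp] = f s R lower_schwartz raise_schwartz schwartz_uminus lower_Hm Hm_schwartz[OF rho_S_Hm]
    rho_mult rho_wgen rho_add rho_diff rho_uminus R_def[symmetric]
  have R_uminus: "R l (\<lambda>x. - g x) = (\<lambda>x. - R l g x)" if "g \<in> schwartz" for l g
    using linear_op_cmult[OF linear_op_rho that, of "S_trunc (1 / real m) l" "-1"] by simp
  have lim: "(\<lambda>l. l2_norm (\<lambda>x. c * rho w (\<lambda>x. R l g x - rho_S m g x) x)) \<longlonglongrightarrow> 0" if "g \<in> Hm m" for g w c
    unfolding l2_norm_cmult R_def by (rule tendsto_mult_right_zero[OF S_trunc_tendsto[OF m that]])
  have rho_diff_arg: "rho w (\<lambda>x. g x - h x) = (\<lambda>x. rho w g x - rho w h x)"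
    if "g \<in> schwartz" "h \<in> schwartz" for w g h
    using linear_opD[OF linear_op_rho that, of w 1 "-1"] by simp
  have "b = Pb Pl Pl \<or> b = Pb Pl Mi \<or> b = Pb Mi Pl \<or> b = Pb Mi Mi \<or> b = Kb PP \<or> b = Kb PM \<or> b = Kb MM"
    using label_cases[of b] b by auto
  then have "\<exists>g w c. g \<in> Hm m \<and> (\<forall>l. (\<lambda>x. rho (trunc (1 / real m) l b) f x - rho_m_basis m b f x)
      = (\<lambda>x. c * rho w (\<lambda>x. R l g x - rho_S m g x) x))"
  proof (elim disjE)
    assume [simp]: "b = Pb Pl Pl"
    show ?thesis
      by (rule exI[of _ "lower 2 f"], rule exI[of _ 1], rule exI[of _ "-1"])
        (simp add: trunc_def rho_m_basis_ladder R_uminus rho_one schwartz_diff fun_eq_iff del: rho_m_basis.simps)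
  next
    assume [simp]: "b = Pb Pl Mi"
    show ?thesis
      by (rule exI[of _ f], rule exI[of _ "wgen (Mode Pl Mi)"], rule exI[of _ 1])
        (simp add: trunc_def rho_m_basis_ladder rho_diff_arg raise_uminus fun_eq_iff del: rho_m_basis.simps)
  next
    assume [simp]: "b = Pb Mi Pl"
    show ?thesis
      by (rule exI[of _ "lower 3 f"], rule exI[of _ 1], rule exI[of _ 1])
        (simp add: trunc_def rho_m_basis_ladder rho_one schwartz_diff fun_eq_iff del: rho_m_basis.simps)
  next
    assume [simp]: "b = Pb Mi Mi"
    show ?thesis
      by (rule exI[of _ f], rule exI[of _ "wgen (Mode Mi Mi)"], rule exI[of _ 1])
        (simp add: trunc_def rho_m_basis_ladder rho_diff_arg fun_eq_iff del: rho_m_basis.simps)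
  next
    assume [simp]: "b = Kb PP"
    show ?thesis
      by (rule exI[of _ "lower 1 f"], rule exI[of _ 1], rule exI[of _ "- 2 * \<i>"])
        (simp add: trunc_def mult.assoc rho_const_mult[OF s] rho_m_basis_ladder rho_one schwartz_diff
          fun_eq_iff algebra_simps del: rho_m_basis.simps)
  next
    assume [simp]: "b = Kb PM"
    have "rho (trunc (1 / real m) l b) f = rho_m_basis m b f" for l
      by (simp add: trunc_def rho_const_mult[OF s] rho_N rho_n rho_const rho_m_basis_ladder fun_eq_iff
          algebra_simps del: rho_m_basis.simps)
    then show ?thesis
      by (intro exI[of _ f] exI[of _ 1] exI[of _ 0]) simp
  next
    assume [simp]: "b = Kb MM"
    show ?thesis
      by (rule exI[of _ f], rule exI[of _ "wgen Cre"], rule exI[of _ "2 * \<i>"])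
        (simp add: trunc_def mult.assoc rho_const_mult[OF s] rho_m_basis_ladder rho_diff_arg
          fun_eq_iff algebra_simps del: rho_m_basis.simps)
  qed
  then show ?thesis using lim by auto
qed

lemma shorten_basis_eq:
  assumes m: "m > 0" shows "shorten_basis m b = rho_m_basis m b"
proof -
  have "strong_limit (Hm m) (\<lambda>l. rho (trunc (1 / real m) l b)) = rho_m_basis m b" if b: "\<And>s. b \<noteq> Jb s"
    unfolding strong_limit_def
  proof (rule the_equality)
    show "rho_m_basis m b \<in> Hm m \<rightarrow>\<^sub>E schwartz \<and>
        (\<forall>f\<in>Hm m. (\<lambda>l. l2_norm (\<lambda>x. rho (trunc (1 / real m) l b) f x - rho_m_basis m b f x)) \<longlonglongrightarrow> 0)"
      using Hm_schwartz[OF rho_m_basis_Hm[OF m]] rho_m_basis_extensional[of m b] trunc_tendsto[OF m _ b]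
      by (auto simp: PiE_def)
    fix T assume T: "T \<in> Hm m \<rightarrow>\<^sub>E schwartz \<and>
        (\<forall>f\<in>Hm m. (\<lambda>l. l2_norm (\<lambda>x. rho (trunc (1 / real m) l b) f x - T f x)) \<longlonglongrightarrow> 0)"
    show "T = rho_m_basis m b"
    proof (rule extensionalityI[where A = "Hm m"])
      fix f assume f: "f \<in> Hm m"
      show "T f = rho_m_basis m b f"
      proof (rule l2_norm_limit_unique)
        show "rho (trunc (1 / real m) l b) f \<in> schwartz" for l
          by (rule rho_schwartz[OF Hm_schwartz[OF f]])
        show "T f \<in> schwartz" using T f by auto
        show "rho_m_basis m b f \<in> schwartz" by (rule Hm_schwartz[OF rho_m_basis_Hm[OF m f]])
      qed (use T f trunc_tendsto[OF m f b] in auto)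
    qed (use T rho_m_basis_extensional in \<open>auto simp: PiE_def\<close>)
  qed
  then show ?thesis by (cases b) auto
qed


section \<open>Antihermitean operators\<close>

lemma rho_S_linear:
  assumes "f \<in> Hm m" "g \<in> Hm m"
  shows "rho_S m (\<lambda>x. y * f x + z * g x) = (\<lambda>x. y * rho_S m f x + z * rho_S m g x)"
  by (rule linear_opD[OF linear_op_rho_S assms])

lemma linear_op_rho_m_basis: "linear_op (Hm m) (rho_m_basis m b)"
  unfolding linear_op_def
proof (intro ballI allI)
  fix f g y z assume f: "f \<in> Hm m" and g: "g \<in> Hm m"
  note [simp] = f g Hm_linear[OF f g] Hm_schwartz[OF f] Hm_schwartz[OF g] lower_schwartz raise_schwartz
    Hm_schwartz[OF rho_S_Hm] lower_linear raise_linear rho_S_linear lower_Hm rho_S_Hm rho_m_basis_ladder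
  show "rho_m_basis m b (\<lambda>x. y * f x + z * g x) = (\<lambda>x. y * rho_m_basis m b f x + z * rho_m_basis m b g x)"
    using label_cases[of b]
    by (auto simp del: rho_m_basis.simps simp: fun_eq_iff algebra_simps)
qed

text \<open>The adjoint of \<open>rho_m_basis m b\<close> is \<open>rho_m_basis m (label_adj b)\<close> up to the sign
  \<open>adj_sign b\<close>.\<close>

fun label_adj :: "label \<Rightarrow> label" where
  "label_adj (Jb PP) = Jb MM"
| "label_adj (Jb PM) = Jb PM"
| "label_adj (Jb MM) = Jb PP"
| "label_adj (Pb Pl Pl) = Pb Mi Mi"
| "label_adj (Pb Pl Mi) = Pb Mi Pl"
| "label_adj (Pb Mi Pl) = Pb Pl Mi"
| "label_adj (Pb Mi Mi) = Pb Pl Pl"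
| "label_adj (Kb PP) = Kb MM"
| "label_adj (Kb PM) = Kb PM"
| "label_adj (Kb MM) = Kb PP"

definition adj_sign :: "label \<Rightarrow> complex"
  where "adj_sign b = (if b \<in> {Jb PM, Kb PM, Pb Pl Pl, Pb Mi Mi} then - 1 else 1)"

lemma l2_inner_cmult_right: "f \<in> schwartz \<Longrightarrow> g \<in> schwartz \<Longrightarrow> l2_inner f (\<lambda>x. c * g x) = c * l2_inner f g"
  using l2_inner_linear_right[of f g g c 0] by simp

lemma l2_inner_cmult_left: "f \<in> schwartz \<Longrightarrow> g \<in> schwartz \<Longrightarrow> l2_inner (\<lambda>x. c * g x) f = cnj c * l2_inner g f"
  using l2_inner_linear_left[of f g g c 0] by simp

lemma l2_inner_add_right: "f \<in> schwartz \<Longrightarrow> g \<in> schwartz \<Longrightarrow> h \<in> schwartz \<Longrightarrow>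
    l2_inner f (\<lambda>x. g x + h x) = l2_inner f g + l2_inner f h"
  using l2_inner_linear_right[of f g h 1 1] by simp

lemma l2_inner_add_left: "f \<in> schwartz \<Longrightarrow> g \<in> schwartz \<Longrightarrow> h \<in> schwartz \<Longrightarrow>
    l2_inner (\<lambda>x. g x + h x) f = l2_inner g f + l2_inner h f"
  using l2_inner_linear_left[of f g h 1 1] by simp

lemma l2_inner_diff_right: "f \<in> schwartz \<Longrightarrow> g \<in> schwartz \<Longrightarrow> h \<in> schwartz \<Longrightarrow>
    l2_inner f (\<lambda>x. g x - h x) = l2_inner f g - l2_inner f h"
  using l2_inner_linear_right[of f g h 1 "-1"] by simp

lemma l2_inner_diff_left: "f \<in> schwartz \<Longrightarrow> g \<in> schwartz \<Longrightarrow> h \<in> schwartz \<Longrightarrow>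
    l2_inner (\<lambda>x. g x - h x) f = l2_inner g f - l2_inner h f"
  using l2_inner_linear_left[of f g h 1 "-1"] by simp

lemma l2_inner_uminus_right: "f \<in> schwartz \<Longrightarrow> g \<in> schwartz \<Longrightarrow> l2_inner f (\<lambda>x. - g x) = - l2_inner f g"
  using l2_inner_cmult_right[of f g "-1"] by simp

lemma l2_inner_uminus_left: "f \<in> schwartz \<Longrightarrow> g \<in> schwartz \<Longrightarrow> l2_inner (\<lambda>x. - g x) f = - l2_inner g f"
  using l2_inner_cmult_left[of f g "-1"] by simp

lemma rho_m_basis_adjoint:
  assumes f: "f \<in> Hm m" and g: "g \<in> Hm m"
  shows "l2_inner (rho_m_basis m b f) g = adj_sign b * l2_inner f (rho_m_basis m (label_adj b) g)"
proof -
  note [simp] = f g Hm_schwartz[OF f] Hm_schwartz[OF g] lower_schwartz raise_schwartz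
    Hm_schwartz[OF rho_S_Hm] rho_S_selfadjoint lower_Hm rho_S_Hm
    rho_m_basis_ladder l2_inner_lower l2_inner_raise l2_inner_cmult_right l2_inner_cmult_left
    l2_inner_add_right l2_inner_add_left l2_inner_diff_right l2_inner_diff_left
    l2_inner_uminus_right l2_inner_uminus_left
    schwartz_cmult schwartz_add schwartz_diff schwartz_uminus
  show ?thesis
    using label_cases[of b]
    by (auto simp del: rho_m_basis.simps simp: adj_sign_def algebra_simps)
qed


section \<open>Coordinates\<close>

lemma coords_eqI:
  assumes "v = (\<Sum>b\<in>UNIV. smul (c b) (e b))"
    and "\<And>d. v = (\<Sum>b\<in>UNIV. smul (d b) (e b)) \<Longrightarrow> d = c"
  shows "coords smul e v = c"
  unfolding coords_def using assms by (intro the_equality)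

lemma quat_component_simps [simp]:
  "q0 (x + y) = q0 x + q0 y" "q1 (x + y) = q1 x + q1 y" "q2 (x + y) = q2 x + q2 y" "q3 (x + y) = q3 x + q3 y"
  "q0 (x - y) = q0 x - q0 y" "q1 (x - y) = q1 x - q1 y" "q2 (x - y) = q2 x - q2 y" "q3 (x - y) = q3 x - q3 y"
  "q0 (- x) = - q0 x" "q1 (- x) = - q1 x" "q2 (- x) = - q2 x" "q3 (- x) = - q3 x"
  "q0 (r *\<^sub>R x) = r * q0 x" "q1 (r *\<^sub>R x) = r * q1 x" "q2 (r *\<^sub>R x) = r * q2 x" "q3 (r *\<^sub>R x) = r * q3 x"
  "q0 0 = 0" "q1 0 = 0" "q2 0 = 0" "q3 0 = 0"
  "q0 1 = 1" "q1 1 = 0" "q2 1 = 0" "q3 1 = 0"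
  by (simp_all add: plus_quat_def minus_quat_def uminus_quat_def scaleR_quat_def zero_quat_def one_quat_def)

text \<open>The complex-linear extension of a real component of a matrix entry.\<close>

definition entry :: "(quat \<Rightarrow> real) \<Rightarrow> 2 \<Rightarrow> 2 \<Rightarrow> (quat^2^2) \<times> (quat^2^2) \<Rightarrow> complex"
  where "entry q r s Z = Complex (q (fst Z $ r $ s)) (q (snd Z $ r $ s))"

lemma linear_quat_component: "linear q0" "linear q1" "linear q2" "linear q3"
  by (auto intro!: linearI)

lemma
  assumes "linear q"
  shows entry_add: "entry q r s (Y + Z) = entry q r s Y + entry q r s Z"
    and entry_diff: "entry q r s (Y - Z) = entry q r s Y - entry q r s Z"
    and entry_uminus: "entry q r s (- Z) = - entry q r s Z"
    and entry_cscale: "entry q r s (cscale z Z) = z * entry q r s Z"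
  using assms
  by (simp_all add: entry_def cscale_def complex_eq_iff linear_add linear_diff linear_neg linear_scale)

lemma entry_cincl: "q 0 = 0 \<Longrightarrow> entry q r s (cincl X) = of_real (q (X $ r $ s))"
  by (simp add: entry_def cincl_def complex_eq_iff)

lemma entry_eqI:
  assumes "\<And>r s. entry q0 r s Y = entry q0 r s Z" "\<And>r s. entry q1 r s Y = entry q1 r s Z"
    "\<And>r s. entry q2 r s Y = entry q2 r s Z" "\<And>r s. entry q3 r s Y = entry q3 r s Z"
  shows "Y = Z"
  using assms by (auto simp: entry_def prod_eq_iff vec_eq_iff quat_eq_iff)

lemma mat2_nth [simp]: "mat2 a b c d $ 1 $ 1 = a" "mat2 a b c d $ 1 $ 2 = b"
  "mat2 a b c d $ 2 $ 1 = c" "mat2 a b c d $ 2 $ 2 = d"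
  by (simp_all add: mat2_def)

definition cbasis_sum :: "(label \<Rightarrow> complex) \<Rightarrow> (quat^2^2) \<times> (quat^2^2)"
  where "cbasis_sum c = (\<Sum>b\<in>UNIV. cscale (c b) (cbasis b))"

lemma entry_cbasis_sum:
  "entry q0 1 1 (cbasis_sum c) = 0" "entry q1 1 1 (cbasis_sum c) = c (Jb MM) - c (Jb PP)"
  "entry q2 1 1 (cbasis_sum c) = \<i> * (c (Jb PP) + c (Jb MM))" "entry q3 1 1 (cbasis_sum c) = - c (Jb PM)"
  "entry q0 2 2 (cbasis_sum c) = 0" "entry q1 2 2 (cbasis_sum c) = c (Kb PP) - c (Kb MM)"
  "entry q2 2 2 (cbasis_sum c) = \<i> * (c (Kb PP) + c (Kb MM))" "entry q3 2 2 (cbasis_sum c) = - c (Kb PM)"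
  "entry q0 1 2 (cbasis_sum c) = \<i> * (c (Pb Mi Mi) - c (Pb Pl Pl)) / 2"
  "entry q1 1 2 (cbasis_sum c) = (c (Pb Mi Pl) - c (Pb Pl Mi)) / 2"
  "entry q2 1 2 (cbasis_sum c) = \<i> * (c (Pb Mi Pl) + c (Pb Pl Mi)) / 2"
  "entry q3 1 2 (cbasis_sum c) = - (c (Pb Pl Pl) + c (Pb Mi Mi)) / 2"
  "entry q0 2 1 (cbasis_sum c) = - \<i> * (c (Pb Mi Mi) - c (Pb Pl Pl)) / 2"
  "entry q1 2 1 (cbasis_sum c) = (c (Pb Mi Pl) - c (Pb Pl Mi)) / 2"
  "entry q2 2 1 (cbasis_sum c) = \<i> * (c (Pb Mi Pl) + c (Pb Pl Mi)) / 2"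
  "entry q3 2 1 (cbasis_sum c) = - (c (Pb Pl Pl) + c (Pb Mi Mi)) / 2"
  unfolding cbasis_sum_def UNIV_label
  by (simp_all add: entry_add entry_diff entry_uminus entry_cscale linear_quat_component entry_cincl
      u2H_j_def u2H_k_def u2H_p_def u2H_p0_def algebra_simps)

text \<open>The dual basis of \<open>cbasis\<close>, obtained by solving the equations \<open>entry_cbasis_sum\<close> for \<open>c\<close>.\<close>

fun cdual :: "(quat^2^2) \<times> (quat^2^2) \<Rightarrow> label \<Rightarrow> complex" where
  "cdual Z (Jb PP) = - (entry q1 1 1 Z + \<i> * entry q2 1 1 Z) / 2"
| "cdual Z (Jb PM) = - entry q3 1 1 Z"
| "cdual Z (Jb MM) = (entry q1 1 1 Z - \<i> * entry q2 1 1 Z) / 2"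
| "cdual Z (Pb Pl Pl) = - entry q3 1 2 Z + \<i> * entry q0 1 2 Z"
| "cdual Z (Pb Pl Mi) = - entry q1 1 2 Z - \<i> * entry q2 1 2 Z"
| "cdual Z (Pb Mi Pl) = entry q1 1 2 Z - \<i> * entry q2 1 2 Z"
| "cdual Z (Pb Mi Mi) = - entry q3 1 2 Z - \<i> * entry q0 1 2 Z"
| "cdual Z (Kb PP) = (entry q1 2 2 Z - \<i> * entry q2 2 2 Z) / 2"
| "cdual Z (Kb PM) = - entry q3 2 2 Z"
| "cdual Z (Kb MM) = - (entry q1 2 2 Z + \<i> * entry q2 2 2 Z) / 2"

lemma i_times_i: "\<i> * (\<i> * z) = - z" "\<i> * (\<i> * z / 2) = - z / 2"
  by (simp_all flip: mult.assoc times_divide_eq_right)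

lemma cdual_cbasis_sum: "cdual (cbasis_sum c) = c"
proof
  fix b
  show "cdual (cbasis_sum c) b = c b"
    using label_cases[of b]
    by (auto simp: entry_cbasis_sum i_times_i algebra_simps add_divide_distrib diff_divide_distrib)
qed

lemma u2H_entries:
  fixes X :: "quat^2^2"
  assumes "X \<in> u2H"
  shows "q0 (X $ 1 $ 1) = 0" "q0 (X $ 2 $ 2) = 0"
    "q0 (X $ 2 $ 1) = - q0 (X $ 1 $ 2)" "q1 (X $ 2 $ 1) = q1 (X $ 1 $ 2)"
    "q2 (X $ 2 $ 1) = q2 (X $ 1 $ 2)" "q3 (X $ 2 $ 1) = q3 (X $ 1 $ 2)"
proof -
  have *: "qcnj (X $ s $ r) = - (X $ r $ s)" for r s
    using assms by (simp add: u2H_def)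
  show "q0 (X $ 1 $ 1) = 0" "q0 (X $ 2 $ 2) = 0"
    "q0 (X $ 2 $ 1) = - q0 (X $ 1 $ 2)" "q1 (X $ 2 $ 1) = q1 (X $ 1 $ 2)"
    "q2 (X $ 2 $ 1) = q2 (X $ 1 $ 2)" "q3 (X $ 2 $ 1) = q3 (X $ 1 $ 2)"
    using *[of 1 1] *[of 2 2] *[of 1 2] by (auto simp: qcnj_def quat_eq_iff)
qed

lemma cincl_eq_cbasis_sum:
  assumes "X \<in> u2H" shows "cincl X = cbasis_sum (cdual (cincl X))"
proof (rule entry_eqI)
  fix r s :: 2
  note [simp] = entry_cbasis_sum entry_cincl u2H_entries[OF assms] i_times_i algebra_simps
    add_divide_distrib diff_divide_distrib
  have rs: "(r = 1 \<or> r = 2) \<and> (s = 1 \<or> s = 2)" using exhaust_2 by auto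
  show "entry q0 r s (cincl X) = entry q0 r s (cbasis_sum (cdual (cincl X)))"
    "entry q1 r s (cincl X) = entry q1 r s (cbasis_sum (cdual (cincl X)))"
    "entry q2 r s (cincl X) = entry q2 r s (cbasis_sum (cdual (cincl X)))"
    "entry q3 r s (cincl X) = entry q3 r s (cbasis_sum (cdual (cincl X)))"
    using rs by auto
qed

lemma coords_cbasis:
  assumes "X \<in> u2H" shows "coords cscale cbasis (cincl X) = cdual (cincl X)"
proof (rule coords_eqI)
  show "cincl X = (\<Sum>b\<in>UNIV. cscale (cdual (cincl X) b) (cbasis b))"
    using cincl_eq_cbasis_sum[OF assms] by (simp add: cbasis_sum_def)
  fix d assume "cincl X = (\<Sum>b\<in>UNIV. cscale (d b) (cbasis b))"
  then have "cincl X = cbasis_sum d" by (simp add: cbasis_sum_def)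
  then show "d = cdual (cincl X)" by (simp add: cdual_cbasis_sum)
qed

text \<open>The entries of a real vector \<open>cincl X\<close> are real. In terms of coordinates this becomes the relation that
  matches \<open>rho_m_basis_adjoint\<close>.\<close>

lemma cdual_adj: "adj_sign b * cnj (cdual (cincl X) b) = - cdual (cincl X) (label_adj b)"
  using label_cases[of b]
  by (auto simp: adj_sign_def entry_cincl field_simps)

lemma rho_m_antihermitean:
  assumes m: "m > 0" and X: "X \<in> u2H"
  shows "rho_m m X \<in> antihermitean_ops m"
proof -
  define c where "c = cdual (cincl X)"
  have eq: "rho_m m X f = (\<lambda>x. \<Sum>b\<in>UNIV. c b * rho_m_basis m b f x)" if "f \<in> Hm m" for f
    using that by (simp add: rho_m_def coords_cbasis[OF X] c_def)
  have closed: "rho_m m X \<in> Hm m \<rightarrow>\<^sub>E Hm m"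
    using rho_m_basis_Hm[OF m] by (auto simp: eq rho_m_def intro!: Hm_sum Hm_cmult)
  have lin: "linear_op (Hm m) (rho_m m X)"
    unfolding linear_op_def
  proof (intro ballI allI)
    fix f g y z assume fg: "f \<in> Hm m" "g \<in> Hm m"
    show "rho_m m X (\<lambda>x. y * f x + z * g x) = (\<lambda>x. y * rho_m m X f x + z * rho_m m X g x)"
      using fg by (simp add: eq Hm_linear linear_opD[OF linear_op_rho_m_basis] sum_distrib_left sum.distrib algebra_simps)
  qed
  have "l2_inner (rho_m m X f) g = - l2_inner f (rho_m m X g)" if f: "f \<in> Hm m" and g: "g \<in> Hm m" for f g
  proof -
    have "l2_inner (rho_m m X f) g = (\<Sum>b\<in>UNIV. cnj (c b) * l2_inner (rho_m_basis m b f) g)"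
      unfolding eq[OF f]
      by (rule l2_inner_sum_left[OF finite Hm_schwartz[OF g] Hm_schwartz[OF rho_m_basis_Hm[OF m f]]])
    also have "\<dots> = (\<Sum>b\<in>UNIV. - (c (label_adj b) * l2_inner f (rho_m_basis m (label_adj b) g)))"
    proof (intro sum.cong refl)
      fix b
      have "cnj (c b) * l2_inner (rho_m_basis m b f) g
          = (adj_sign b * cnj (c b)) * l2_inner f (rho_m_basis m (label_adj b) g)"
        unfolding rho_m_basis_adjoint[OF f g] by simp
      then show "cnj (c b) * l2_inner (rho_m_basis m b f) g
          = - (c (label_adj b) * l2_inner f (rho_m_basis m (label_adj b) g))"
        unfolding c_def cdual_adj by simp
    qed
    also have "\<dots> = (\<Sum>b\<in>UNIV. - (c b * l2_inner f (rho_m_basis m b g)))"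
      unfolding UNIV_label by simp
    also have "\<dots> = - l2_inner f (rho_m m X g)"
      unfolding eq[OF g] sum_negf
        l2_inner_sum_right[OF finite Hm_schwartz[OF f] Hm_schwartz[OF rho_m_basis_Hm[OF m g]]] ..
    finally show ?thesis .
  qed
  with closed lin show ?thesis by (simp add: antihermitean_ops_def)
qed


section \<open>Linear independence of the formal embedding\<close>

lemma wconst_diff: "wconst (x - y) = wconst x - wconst y"
  by transfer (simp add: free_const_def single_diff weyl_rel_def weyl_ideal.zero)

lemma wconst_1: "wconst 1 = 1"
  by transfer (simp add: free_const_def weyl_rel_def weyl_ideal.zero flip: single_one zero_list_def)

lemma wconst_0: "wconst 0 = 0"
  using wconst_diff[of 0 0] by simp

lemma S_formal_nth: "k < - 1 \<Longrightarrow> fls_nth S_formal k = 0" "fls_nth S_formal (- 1) = 1"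
  by (simp_all add: S_formal_def S_coeff_def b_coeff_def wconst_1)

text \<open>The order of the basis vectors in the square root of \<open>\<hbar>\<close>.\<close>

fun leading_degree :: "label \<Rightarrow> int" where
  "leading_degree (Jb s) = 0"
| "leading_degree (Kb PM) = - 2"
| "leading_degree b = - 1"

lemma J_formula_fls_const:
  "J_formula hconst (\<lambda>g. fls_const (wgen g)) s = fls_const (J_formula wconst wgen s)"
  by (cases s) (simp_all add: hconst_def fls_plus_const)

lemma embed_basis_nth_below: "k < leading_degree b \<Longrightarrow> fls_nth (embed_basis b) k = 0"
  using label_cases[of b]
  by (auto simp: embed_basis_def J_formula_fls_const hconst_def S_formal_nth N_formula_def n_formula_def
      simp del: J_formula.simps)

fun leading_term :: "label \<Rightarrow> weyl" where
  "leading_term (Jb s) = J_formula wconst wgen s"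
| "leading_term (Pb \<alpha> \<beta>) = wgen (Mode \<alpha> \<beta>)"
| "leading_term (Kb PP) = wconst (- 2 * \<i>) * wgen Ann"
| "leading_term (Kb PM) = wconst \<i>"
| "leading_term (Kb MM) = wconst (2 * \<i>) * wgen Cre"

lemma embed_basis_leading: "fls_nth (embed_basis b) (leading_degree b) = leading_term b"
  using label_cases[of b]
  by (auto simp: embed_basis_def J_formula_fls_const hconst_def S_formal_nth N_formula_def n_formula_def
      simp del: J_formula.simps)

text \<open>The leading terms of a given degree send \<open>hermite (1, 1, 2)\<close> to multiples of distinct Hermite
  functions. The asymmetric choice matters: the leading term of \<open>Jb PM\<close> annihilates \<open>hermite (1, 1, 1)\<close>.\<close>

fun leading_index :: "label \<Rightarrow> nat \<times> nat \<times> nat" where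
  "leading_index (Jb PP) = (1, 0, 3)"
| "leading_index (Jb PM) = (1, 1, 2)"
| "leading_index (Jb MM) = (1, 2, 1)"
| "leading_index (Pb Pl Pl) = (1, 0, 2)"
| "leading_index (Pb Pl Mi) = (1, 1, 3)"
| "leading_index (Pb Mi Pl) = (1, 1, 1)"
| "leading_index (Pb Mi Mi) = (1, 2, 2)"
| "leading_index (Kb PP) = (0, 1, 2)"
| "leading_index (Kb PM) = (1, 1, 2)"
| "leading_index (Kb MM) = (2, 1, 2)"

lemma leading_index_inj:
  assumes "leading_index b = leading_index b'" "leading_degree b = leading_degree b'" shows "b = b'"
  using label_cases[of b] label_cases[of b'] assms by auto

lemma rho_leading_term:
  "\<exists>\<gamma>. \<gamma> \<noteq> 0 \<and> rho (leading_term b) (hermite (1, 1, 2)) = (\<lambda>x. \<gamma> * hermite (leading_index b) x)"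
proof -
  note [simp] = hermite_schwartz rho_wgen rho_const rho_const_mult rho_J_formula lower_schwartz
  have n: "Suc 0 = 1" "Suc 1 = 2" "Suc 2 = 3" by simp_all
  note ladder = lower_hermite raise_hermite lower_cmult[OF hermite_schwartz] raise_cmult[OF hermite_schwartz]
  have "rho (leading_term (Jb PP)) (hermite (1, 1, 2)) = (\<lambda>x. (2 * \<i> * of_real (sqrt 3)) * hermite (1, 0, 3) x)"
    by (simp add: ladder n mult.assoc del: J_formula.simps One_nat_def)
  moreover have "rho (leading_term (Jb PM)) (hermite (1, 1, 2)) = (\<lambda>x. (- \<i>) * hermite (1, 1, 2) x)"
    by (simp add: number_hermite algebra_simps del: J_formula.simps One_nat_def)
  moreover have "rho (leading_term (Jb MM)) (hermite (1, 1, 2)) = (\<lambda>x. (- 4 * \<i>) * hermite (1, 2, 1) x)"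
    by (simp add: ladder n del: J_formula.simps One_nat_def flip: mult.assoc of_real_mult)
  moreover have "rho (leading_term (Pb Pl Pl)) (hermite (1, 1, 2)) = (\<lambda>x. (- 1) * hermite (1, 0, 2) x)"
    by (simp add: ladder n del: One_nat_def)
  moreover have "rho (leading_term (Pb Pl Mi)) (hermite (1, 1, 2)) = (\<lambda>x. of_real (sqrt 3) * hermite (1, 1, 3) x)"
    by (simp add: ladder n del: One_nat_def)
  moreover have "rho (leading_term (Pb Mi Pl)) (hermite (1, 1, 2)) = (\<lambda>x. of_real (sqrt 2) * hermite (1, 1, 1) x)"
    by (simp add: ladder n del: One_nat_def)
  moreover have "rho (leading_term (Pb Mi Mi)) (hermite (1, 1, 2)) = (\<lambda>x. of_real (sqrt 2) * hermite (1, 2, 2) x)"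
    by (simp add: ladder n del: One_nat_def)
  moreover have "rho (leading_term (Kb PP)) (hermite (1, 1, 2)) = (\<lambda>x. (- 2 * \<i>) * hermite (0, 1, 2) x)"
    by (simp add: ladder n del: One_nat_def)
  moreover have "rho (leading_term (Kb PM)) (hermite (1, 1, 2)) = (\<lambda>x. \<i> * hermite (1, 1, 2) x)"
    by simp
  moreover have "rho (leading_term (Kb MM)) (hermite (1, 1, 2)) = (\<lambda>x. (2 * \<i> * of_real (sqrt 2)) * hermite (2, 1, 2) x)"
    by (simp add: ladder n mult.assoc del: One_nat_def)
  moreover have "2 * \<i> * complex_of_real (sqrt 3) \<noteq> 0" "complex_of_real (sqrt 3) \<noteq> 0"
    "complex_of_real (sqrt 2) \<noteq> 0" "2 * \<i> * complex_of_real (sqrt 2) \<noteq> 0" "- 4 * \<i> \<noteq> 0" "- 2 * \<i> \<noteq> 0"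
    "- \<i> \<noteq> 0" "(- 1 :: complex) \<noteq> 0" "\<i> \<noteq> 0"
    by auto
  ultimately show ?thesis
    using label_cases[of b] by (elim insertE emptyE) (auto simp only: leading_index.simps)
qed

text \<open>The functions are indexed by labels, since linear relations between operators are evaluated on a
  single Hermite function.\<close>

lemma hermite_independent:
  assumes "finite B" "inj_on \<nu> B" "\<And>x. (\<Sum>b\<in>B. \<alpha> b * hermite (\<nu> b) x) = 0" "b \<in> B"
  shows "\<alpha> b = 0"
proof -
  have "0 = l2_inner (hermite (\<nu> b)) (\<lambda>x. \<Sum>b\<in>B. \<alpha> b * hermite (\<nu> b) x)"
    by (simp add: assms(3) l2_inner_def)
  also have "\<dots> = (\<Sum>b'\<in>B. \<alpha> b' * l2_inner (hermite (\<nu> b)) (hermite (\<nu> b')))"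
    by (intro l2_inner_sum_right assms(1) hermite_schwartz)
  also have "\<dots> = (\<Sum>b'\<in>B. if b = b' then \<alpha> b' * l2_inner (hermite (\<nu> b)) (hermite (\<nu> b')) else 0)"
    using assms(2,4) by (intro sum.cong) (auto simp: hermite_orthogonal inj_on_eq_iff)
  finally show ?thesis using assms(1,4) hermite_inner_self by simp
qed

text \<open>Compare the coefficients of degree \<open>leading_degree b\<close>: summands of lower degree vanish by
  assumption and those of higher degree start later. Apply \<open>rho\<close> to what remains.\<close>

lemma leading_coeff_eq_0:
  assumes sum: "(\<Sum>b\<in>UNIV. hconst (c b) * embed_basis b) = 0"
    and below: "\<And>b'. leading_degree b' < leading_degree b \<Longrightarrow> c b' = 0"
  shows "c b = 0"
proof -
  define k where "k = leading_degree b"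
  define B where "B = {b'. leading_degree b' = k}"
  obtain \<gamma> where \<gamma>: "\<gamma> b' \<noteq> 0"
    "rho (leading_term b') (hermite (1, 1, 2)) = (\<lambda>x. \<gamma> b' * hermite (leading_index b') x)" for b'
    using rho_leading_term by metis
  have "0 = (\<Sum>b'\<in>UNIV. wconst (c b') * fls_nth (embed_basis b') k)"
    using arg_cong[OF sum, of "\<lambda>f. fls_nth f k"] by (simp add: fls_nth_sum hconst_def)
  also have "\<dots> = (\<Sum>b'\<in>B. wconst (c b') * fls_nth (embed_basis b') k)"
  proof (rule sum.mono_neutral_right)
    show "\<forall>b'\<in>UNIV - B. wconst (c b') * fls_nth (embed_basis b') k = 0"
    proof
      fix b' assume "b' \<in> UNIV - B"
      then consider "leading_degree b' < k" | "k < leading_degree b'" by (fastforce simp: B_def)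
      then show "wconst (c b') * fls_nth (embed_basis b') k = 0"
        by cases (auto simp: below k_def wconst_0 embed_basis_nth_below)
    qed
  qed auto
  also have "\<dots> = (\<Sum>b'\<in>B. wconst (c b') * leading_term b')"
    using embed_basis_leading by (intro sum.cong) (auto simp: B_def)
  finally have "rho (\<Sum>b'\<in>B. wconst (c b') * leading_term b') (hermite (1, 1, 2)) = (\<lambda>x. 0)"
    using rho_zero[OF hermite_schwartz] by simp
  then have "(\<Sum>b'\<in>B. (c b' * \<gamma> b') * hermite (leading_index b') x) = 0" for x
    by (simp add: rho_sum[OF finite hermite_schwartz] rho_const_mult[OF hermite_schwartz] \<gamma>(2) fun_eq_iff mult.assoc del: One_nat_def)
  moreover have "inj_on leading_index B" "b \<in> B"
    using leading_index_inj by (auto simp: inj_on_def B_def k_def)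
  ultimately have "c b * \<gamma> b = 0"
    by (intro hermite_independent[of B leading_index "\<lambda>b. c b * \<gamma> b"]) auto
  then show ?thesis using \<gamma>(1) by simp
qed

lemma embed_basis_independent:
  assumes "(\<Sum>b\<in>UNIV. hconst (c b) * embed_basis b) = 0"
  shows "c b = 0"
proof -
  have "leading_degree b \<in> {- 2, - 1, 0}" for b using label_cases[of b] by auto
  then have deg: "leading_degree b = - 2 \<or> leading_degree b = - 1 \<or> leading_degree b = 0" for b
    by blast
  have 2: "c b = 0" if "leading_degree b = - 2" for b
  proof (rule leading_coeff_eq_0[OF assms])
    show "c b' = 0" if "leading_degree b' < leading_degree b" for b'
      using deg[of b'] that \<open>leading_degree b = - 2\<close> by auto
  qed
  have 1: "c b = 0" if "leading_degree b = - 1" for b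
  proof (rule leading_coeff_eq_0[OF assms])
    show "c b' = 0" if "leading_degree b' < leading_degree b" for b'
      using deg[of b'] that \<open>leading_degree b = - 1\<close> 2 by auto
  qed
  have 0: "c b = 0" if "leading_degree b = 0" for b
  proof (rule leading_coeff_eq_0[OF assms])
    show "c b' = 0" if "leading_degree b' < leading_degree b" for b'
      using deg[of b'] that \<open>leading_degree b = 0\<close> 1 2 by auto
  qed
  show ?thesis using deg[of b] 0 1 2 by blast
qed

lemma coords_embed_basis:
  "coords (\<lambda>z y. hconst z * y) embed_basis (\<Sum>b\<in>UNIV. hconst (c b) * embed_basis b) = c"
proof (rule coords_eqI)
  fix d assume "(\<Sum>b\<in>UNIV. hconst (c b) * embed_basis b) = (\<Sum>b\<in>UNIV. hconst (d b) * embed_basis b)"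
  then have "(\<Sum>b\<in>UNIV. hconst (d b - c b) * embed_basis b) = 0"
    by (simp add: hconst_def wconst_diff fls_minus_const[symmetric] left_diff_distrib sum_subtractf)
  then have "d b - c b = 0" for b by (rule embed_basis_independent)
  then show "d = c" by auto
qed simp

lemma shorten_embed:
  assumes "m > 0" "X \<in> u2H"
  shows "shorten m (embed_u2H X) = rho_m m X"
  unfolding shorten_def embed_u2H_def coords_embed_basis rho_m_def shorten_basis_eq[OF assms(1)] ..

theorem theorem4p4:
  fixes m :: nat
  assumes "m > 0"
  shows "shorten m \<in> embed_u2H ` u2H \<rightarrow> antihermitean_ops m \<and>
    rho_m m \<in> u2H \<rightarrow> antihermitean_ops m \<and>
    (\<forall>X\<in>u2H. (shorten m \<circ> embed_u2H) X = rho_m m X)"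
  using shorten_embed[OF assms] rho_m_antihermitean[OF assms] by auto


end
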